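(* Let $L$ be a binary $\mathbb{Z}$-lattice on a positive definite quadratic space over $\mathbb{Q}$ with $-4d_L$ equal to the discriminant $D$ of an imaginary quadratic field $F$, and assume $D\neq-3,-4$. Then $\zeta^{\mathrm{SL}}_L(s)=\prod_{p\ \text{prime}}\zeta^{\mathrm{SL}}_{L,p}(s)$ if and only if $\mathrm{Cl}_F\cong(\mathbb{Z}/2\mathbb{Z})^e$ for some integer $e\ge0$.
   Context: $V$ is a positive definite quadratic space over $\mathbb{Q}$; a $\mathbb{Z}$-lattice $L$ on $V$ is the $\mathbb{Z}$-span of a basis of $V$ with integral quadratic values, and $d_L$ is the determinant of its Gram matrix. $O^+(V)=O(V)\cap\mathrm{SL}(V)$. $a_m^+(L)$ is the number of classes of sublattices of $L$ of index $m$ under $K_1\sim K_2\iff\sigma(K_1)=K_2$ for some $\sigma\in O^+(V)$; $\zeta^{\mathrm{SL}}_L(s)=\sum_{m\ge1}a_m^+(L)m^{-s}$ and, for a prime $p$, $\zeta^{\mathrm{SL}}_{L,p}(s)=\sum_{i\ge0}a_{p^i}^+(L)p^{-is}$. $\mathrm{Cl}_F$ is the ideal class group of $F$. *)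

theory Defs
  imports
    "HOL-Analysis.Infinite_Sum"
    "HOL-Analysis.Infinite_Products"
    "HOL-Algebra.Product_Groups"
    "Jordan_Normal_Form.Determinant"
    "HOL-Computational_Algebra.Polynomial"
    "HOL-Computational_Algebra.Primes"
begin

text \<open>
  The quadratic map is \<open>Q x = B x x\<close>, so the Gram matrix of a binary lattice with
  \<open>Q (x e + y f) = a x\<^sup>2 + b x y + c y\<^sup>2\<close> has determinant \<open>a c - b\<^sup>2 / 4\<close>.
\<close>

locale quadratic_space =
  vector_space scale for scale :: "rat \<Rightarrow> 'v::ab_group_add \<Rightarrow> 'v" +
  fixes B :: "'v \<Rightarrow> 'v \<Rightarrow> rat"
  assumes finite_dim: "\<exists>b. finite b \<and> span b = UNIV"
    and form_sym: "B x y = B y x"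
    and form_add: "B (x + y) z = B x z + B y z"
    and form_scale: "B (scale c x) z = c * B x z"
begin

definition positive_definite :: bool where
  "positive_definite \<longleftrightarrow> (\<forall>x. x \<noteq> 0 \<longrightarrow> B x x > 0)"

definition is_basis :: "'v list \<Rightarrow> bool" where
  "is_basis bs \<longleftrightarrow> distinct bs \<and> independent (set bs) \<and> span (set bs) = UNIV"

definition Z_span :: "'v set \<Rightarrow> 'v set" where
  "Z_span = Modules.module.span (\<lambda>k::int. scale (of_int k))"

definition lattice_basis :: "'v set \<Rightarrow> 'v list \<Rightarrow> bool" where
  "lattice_basis L bs \<longleftrightarrow> is_basis bs \<and> L = Z_span (set bs)"

definition is_lattice :: "'v set \<Rightarrow> bool" where
  "is_lattice L \<longleftrightarrow> (\<exists>bs. lattice_basis L bs) \<and> (\<forall>x\<in>L. B x x \<in> \<int>)"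

definition gram_matrix :: "'v list \<Rightarrow> rat mat" where
  "gram_matrix bs = mat (length bs) (length bs) (\<lambda>(i, j). B (bs ! i) (bs ! j))"

definition lattice_det :: "'v set \<Rightarrow> rat" where
  "lattice_det L = (THE d. \<exists>bs. lattice_basis L bs \<and> d = det (gram_matrix bs))"

definition endo_matrix :: "'v list \<Rightarrow> ('v \<Rightarrow> 'v) \<Rightarrow> rat mat" where
  "endo_matrix bs \<sigma> = mat (length bs) (length bs)
     (\<lambda>(i, j). representation (set bs) (\<sigma> (bs ! j)) (bs ! i))"

definition endo_det :: "('v \<Rightarrow> 'v) \<Rightarrow> rat" where
  "endo_det \<sigma> = (THE d. \<exists>bs. is_basis bs \<and> d = det (endo_matrix bs \<sigma>))"

definition O_group :: "('v \<Rightarrow> 'v) set" where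
  "O_group = {\<sigma>. Vector_Spaces.linear scale scale \<sigma> \<and> bij \<sigma> \<and> (\<forall>x y. B (\<sigma> x) (\<sigma> y) = B x y)}"

definition O_plus :: "('v \<Rightarrow> 'v) set" where
  "O_plus = {\<sigma> \<in> O_group. endo_det \<sigma> = 1}"

text \<open>Number of cosets of \<open>K\<close> in \<open>L\<close>; it is 0 when the index is infinite, so only \<open>m \<ge> 1\<close> is meaningful
  in the definitions below.\<close>

definition lattice_index :: "'v set \<Rightarrow> 'v set \<Rightarrow> nat" where
  "lattice_index L K = card ((\<lambda>x. (+) x ` K) ` L)"

definition sublattices :: "'v set \<Rightarrow> nat \<Rightarrow> 'v set set" where
  "sublattices L m = {K. is_lattice K \<and> K \<subseteq> L \<and> lattice_index L K = m}"

definition proper_equiv :: "('v set \<times> 'v set) set" where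
  "proper_equiv = {(K1, K2). \<exists>\<sigma>\<in>O_plus. \<sigma> ` K1 = K2}"

definition a_plus :: "'v set \<Rightarrow> nat \<Rightarrow> nat" where
  "a_plus L m = card (sublattices L m // Restr proper_equiv (sublattices L m))"

text \<open>For a lattice of rank \<open>n\<close> both series converge absolutely when \<open>Re s > n\<close>, because there are only
  \<open>O(m\<^sup>n\<^sup>-\<^sup>1\<^sup>+\<^sup>\<epsilon>)\<close> sublattices of index \<open>m\<close>. Outside the region of absolute convergence \<open>infsum\<close> is 0.\<close>

definition zeta_SL :: "'v set \<Rightarrow> complex \<Rightarrow> complex" where
  "zeta_SL L s = (\<Sum>\<^sub>\<infinity>m\<in>{1..}. of_nat (a_plus L m) * of_nat m powr (- s))"

definition zeta_SL_local :: "'v set \<Rightarrow> nat \<Rightarrow> complex \<Rightarrow> complex" where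
  "zeta_SL_local L p s =
     (\<Sum>\<^sub>\<infinity>i\<in>UNIV. of_nat (a_plus L (p ^ i)) * of_nat p powr (- (of_nat i * s)))"

end

text \<open>Number fields are taken as subfields of the complex numbers.\<close>

definition is_subfield :: "complex set \<Rightarrow> bool" where
  "is_subfield F \<longleftrightarrow> 1 \<in> F \<and> (\<forall>x\<in>F. \<forall>y\<in>F. x - y \<in> F \<and> x * y \<in> F) \<and> (\<forall>x\<in>F. inverse x \<in> F)"

definition imaginary_quadratic_field :: "complex set \<Rightarrow> bool" where
  "imaginary_quadratic_field F \<longleftrightarrow> is_subfield F \<and>
     vector_space.dim (\<lambda>(q::rat) (z::complex). of_rat q * z) F = 2 \<and> \<not> F \<subseteq> \<real>"

definition ring_of_integers :: "complex set \<Rightarrow> complex set" where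
  "ring_of_integers F = {x \<in> F. algebraic_int x}"

abbreviation int_span :: "complex set \<Rightarrow> complex set" where
  "int_span \<equiv> Modules.module.span (\<lambda>(k::int) (z::complex). of_int k * z)"

text \<open>
  The square of \<open>det (\<sigma>\<^sub>i \<omega>\<^sub>j)\<close> for an integral basis \<open>\<omega>\<^sub>1, \<omega>\<^sub>2\<close>. The two embeddings of an imaginary
  quadratic field \<open>F \<subseteq> \<complex>\<close> are the inclusion and complex conjugation. A generating pair is
  automatically a basis here, since the ring of integers has rank 2.
\<close>

definition discriminant :: "complex set \<Rightarrow> int" where
  "discriminant F = (THE D. \<exists>w1 w2. ring_of_integers F = int_span {w1, w2} \<and>
     of_int D = (w1 * cnj w2 - w2 * cnj w1)\<^sup>2)"

definition fractional_ideal :: "complex set \<Rightarrow> complex set \<Rightarrow> bool" where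
  "fractional_ideal F I \<longleftrightarrow> I \<subseteq> F \<and> 0 \<in> I \<and> I \<noteq> {0} \<and>
     (\<forall>x\<in>I. \<forall>y\<in>I. x + y \<in> I) \<and> (\<forall>a\<in>ring_of_integers F. \<forall>x\<in>I. a * x \<in> I) \<and>
     (\<exists>d\<in>ring_of_integers F. d \<noteq> 0 \<and> (\<forall>x\<in>I. d * x \<in> ring_of_integers F))"

definition ideal_group :: "complex set \<Rightarrow> complex set monoid" where
  "ideal_group F = \<lparr>carrier = {I. fractional_ideal F I},
     mult = (\<lambda>I J. int_span {x * y | x y. x \<in> I \<and> y \<in> J}),
     one = ring_of_integers F\<rparr>"

definition principal_ideals :: "complex set \<Rightarrow> complex set set" where
  "principal_ideals F = {(*) a ` ring_of_integers F | a. a \<in> F \<and> a \<noteq> 0}"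

definition class_group :: "complex set \<Rightarrow> complex set set monoid" where
  "class_group F = ideal_group F Mod principal_ideals F"

end

theory Submission
  imports Defs "HOL-Analysis.Summation_Tests"
begin

text \<open>
  Up to a similarity \<open>L\<close> is a fractional ideal \<open>M\<close> of \<open>F\<close>, and \<open>O\<^sup>+(V)\<close> is the group \<open>U\<close> of elements of
  norm one. The class of a sublattice \<open>K\<close> of index \<open>m\<close> consists of the \<open>u K\<close> with \<open>u\<close> in
  \<open>S(K) = {u \<in> U. u K \<subseteq> M}\<close>, and the stabiliser of \<open>K\<close> is \<open>{1, -1}\<close> because \<open>D \<noteq> -3, -4\<close>; hence
  \<open>a\<^sub>m\<^sup>+(L)\<close> is the sum of \<open>2 / |S(K)|\<close> over all \<open>K\<close> of index \<open>m\<close>. For coprime \<open>m1, m2\<close> each \<open>K\<close> of index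
  \<open>m1 m2\<close> is uniquely \<open>K1 \<inter> K2\<close> with \<open>Ki\<close> of index \<open>mi\<close>, and multiplication
  \<open>S(K1) \<times> S(K2) \<rightarrow> S(K)\<close> is exactly two-to-one onto its image. So \<open>a\<^sup>+\<close> is submultiplicative, and it is
  multiplicative iff every \<open>u\<close> in \<open>S(K)\<close> splits as \<open>u1 u2\<close>.

  If the class group has exponent two, the splitting comes from factoring the denominator ideal
  \<open>A = A1 A2\<close> of \<open>u\<close> along \<open>m1, m2\<close>, since \<open>cnj A1 = u1 A1\<close> for some \<open>u1\<close>. Conversely, two ideals
  \<open>A, A' = t A\<close> in one class with coprime norms give \<open>u = cnj t / t\<close>, and a splitting of this \<open>u\<close> yields
  \<open>cnj A = w A\<close>, so that \<open>A\<^sup>2\<close> is principal.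
\<close>

section \<open>Quadratic integers\<close>

text \<open>The obstacle is that a single \<open>u\<close> in \<open>U\<close> can have denominators
  at several primes, so classes of sublattices mix primes which an Euler product wants to keep
  apart. Weighting each sublattice by the reciprocal of its class size turns the count into a sum
  over sublattices. These do split along coprime indices, and the splitting of \<open>u\<close>
  remains as the only question. Neither localisation nor prime ideals are used: a membership that
  would be checked prime by prime is checked after multiplication by each of two coprime integers,
  and Bezout recombines the results. The hypothesis on the discriminant makes the multiplier ring of
  the lattice the full ring of integers; primitivity of the quadratic form then makes ideals
  invertible. Coprime norms in the converse come from a value of a primitive form that is prime to
  its leading coefficient. Submultiplicativity is essential for that converse as well: an identity
  of Dirichlet series at one point compares only sums, and a one-sided inequality turns it into an
  identity of coefficients.\<close>

definition zlat :: "complex \<Rightarrow> complex \<Rightarrow> complex set" where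
  "zlat a b = {of_int x * a + of_int y * b | x y. True}"

lemma int_module: "Modules.module (\<lambda>(k::int) (z::complex). of_int k * z)"
  by unfold_locales (auto simp: algebra_simps)

lemma int_span_pair: "int_span {a, b} = zlat a b"
proof -
  interpret Modules.module "\<lambda>(k::int) (z::complex). of_int k * z" by (rule int_module)
  show ?thesis
    unfolding span_insert zlat_def
    by (auto simp: algebra_simps)
qed

lemma zlatI: "of_int x * a + of_int y * b \<in> zlat a b"
  by (auto simp: zlat_def)

lemma zlat_1I: "of_int x + of_int y * b \<in> zlat 1 b"
  using zlatI[of x 1 y b] by simp

lemma zlat_basis [simp]: "a \<in> zlat a b" "b \<in> zlat a b"
  using zlatI[of 1 a 0 b] zlatI[of 0 a 1 b] by auto

lemma map_poly_of_int_add: "map_poly of_int (p + q) = map_poly of_int p + map_poly of_int q"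
  by (intro poly_eqI) (simp add: coeff_map_poly)

lemma map_poly_of_int_mult: "map_poly of_int (p * q) = map_poly of_int p * map_poly of_int q"
  by (intro poly_eqI) (simp add: coeff_map_poly coeff_mult)

text \<open>The pseudo-remainder of \<open>p\<close> by \<open>q\<close> has degree at most one and vanishes at the non-real \<open>x\<close>, so
  it is zero; Gauss's lemma then removes the constant factor.\<close>

lemma primitive_dvd_of_common_root:
  fixes p q :: "int poly" and x :: complex
  assumes p: "lead_coeff p = 1" "poly (map_poly of_int p) x = 0"
    and q: "degree q = 2" "content q = 1" "poly (map_poly of_int q) x = 0" and x: "x \<notin> \<real>"
  shows "q dvd p"
proof -
  have q0: "q \<noteq> 0" using q(1) by auto
  obtain a s where a: "a \<noteq> 0" "smult a p = q * s + pseudo_mod p q"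
    using pseudo_mod(1)[OF q0, of p] by blast
  define r where "r = pseudo_mod p q"
  have r: "r = 0 \<or> degree r < 2" using pseudo_mod(2)[OF q0, of p] q(1) by (auto simp: r_def)
  have "poly (map_poly of_int (smult a p)) x = 0"
    using p(2) by (simp add: map_poly_smult)
  hence rx: "poly (map_poly of_int r) x = 0"
    using a(2) q(3) by (simp add: r_def map_poly_of_int_add map_poly_of_int_mult)
  have "r = 0"
  proof (rule ccontr)
    assume "r \<noteq> 0"
    hence "degree r \<le> 1" using r by auto
    hence "r = [:coeff r 0, coeff r 1:]"
      by (intro poly_eqI) (auto simp: coeff_pCons coeff_eq_0 split: nat.split)
    then obtain u v where uv: "r = [:u, v:]" by metis
    have e: "of_int u + of_int v * x = 0" using rx by (simp add: uv map_poly_pCons mult.commute)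
    show False
    proof (cases "v = 0")
      case True thus ?thesis using e uv \<open>r \<noteq> 0\<close> by auto
    next
      case False
      hence "x = - of_int u / of_int v" using e by (simp add: field_simps add_eq_0_iff)
      thus ?thesis using x by auto
    qed
  qed
  hence e: "smult a p = q * s" using a(2) r_def by simp
  have "content s = \<bar>a\<bar> * content p"
    using arg_cong[OF e, of content] q(2) by (simp add: content_mult)
  hence "[:a:] dvd s"
    by (metis abs_dvd_iff const_poly_dvd_iff_dvd_content dvd_triv_left)
  then obtain s' where "s = smult a s'" by (auto simp: dvd_def)
  hence "smult a p = smult a (q * s')" using e by simp
  hence "p = q * s'" using a(1) by (metis smult_cancel)
  thus ?thesis by auto
qed


text \<open>Clearing denominators makes \<open>X\<^sup>2 - T X + N\<close> primitive; divisibility of a monic polynomial forces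
  the leading coefficient to be a unit.\<close>

lemma algebraic_int_trace_norm:
  fixes x :: complex and T N :: rat
  assumes x: "algebraic_int x" "x \<notin> \<real>" and eq: "x\<^sup>2 - of_rat T * x + of_rat N = 0"
  shows "T \<in> \<int> \<and> N \<in> \<int>"
proof -
  obtain p where p: "lead_coeff p = 1" "poly (map_poly of_int p) x = 0"
    using x(1) by (auto simp: algebraic_int_altdef_ipoly)
  obtain T1 T2 where T: "T = of_int T1 / of_int T2" "T2 > 0"
    by (metis quotient_of_div quotient_of_denom_pos surj_pair)
  obtain N1 N2 where N: "N = of_int N1 / of_int N2" "N2 > 0"
    by (metis quotient_of_div quotient_of_denom_pos surj_pair)
  define q0 where "q0 = [:N1 * T2, - (T1 * N2), T2 * N2:]"
  define g where "g = content q0"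
  define q where "q = primitive_part q0"
  have q0: "q0 \<noteq> 0" "degree q0 = 2" using T N by (auto simp: q0_def)
  have g: "g \<noteq> 0" using q0 by (simp add: g_def)
  have gq: "q0 = smult g q" by (simp add: g_def q_def)
  have dq: "degree q = 2" "content q = 1" using q0 by (simp_all add: q_def)
  have "of_rat T * (of_int T2 :: complex) = of_int T1" "of_rat N * (of_int N2 :: complex) = of_int N1"
    using T N by (simp_all add: of_rat_divide)
  note TN = this
  have "(of_int N1 * of_int T2 :: complex) - of_int T1 * of_int N2 * x + of_int T2 * of_int N2 * x\<^sup>2
      = of_int T2 * of_int N2 * (x\<^sup>2 - of_rat T * x + of_rat N)"
    unfolding TN[symmetric] by (simp add: algebra_simps)
  hence r0: "poly (map_poly of_int q0) x = 0"
    unfolding eq by (simp add: q0_def map_poly_pCons algebra_simps power2_eq_square)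
  have "of_int g * poly (map_poly of_int q) x = 0"
    using r0 by (simp add: gq map_poly_smult)
  hence qx: "poly (map_poly of_int q) x = 0" using g by simp
  have "q dvd p" by (rule primitive_dvd_of_common_root[OF p dq qx x(2)])
  then obtain r where "p = q * r" by (auto simp: dvd_def)
  hence "lead_coeff q * lead_coeff r = 1" using p(1) by (simp add: lead_coeff_mult)
  hence lc: "\<bar>lead_coeff q\<bar> = 1" using zmult_eq_1_iff by fastforce
  have c: "coeff q0 i = g * coeff q i" for i by (simp add: gq)
  have "T2 * N2 = g * lead_coeff q" using c[of 2] dq by (simp add: q0_def numeral_2_eq_2)
  hence gabs: "g = T2 * N2 \<or> g = - (T2 * N2)" using lc by (auto simp: abs_if split: if_splits)
  have e1: "N1 * T2 = g * coeff q 0" using c[of 0] by (simp add: q0_def)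
  have e2: "- (T1 * N2) = g * coeff q 1" using c[of 1] by (simp add: q0_def)
  have "T2 * (N1 - N2 * coeff q 0) = 0 \<or> T2 * (N1 + N2 * coeff q 0) = 0"
    using e1 gabs by (auto simp: algebra_simps)
  hence "N1 = N2 * coeff q 0 \<or> N1 = - N2 * coeff q 0" using T by auto
  hence "N = of_int (coeff q 0) \<or> N = of_int (- coeff q 0)" using N by auto
  moreover have "N2 * (T1 - T2 * coeff q 1) = 0 \<or> N2 * (T1 + T2 * coeff q 1) = 0"
    using e2 gabs by (auto simp: algebra_simps)
  hence "T1 = T2 * coeff q 1 \<or> T1 = - T2 * coeff q 1" using N by auto
  hence "T = of_int (coeff q 1) \<or> T = of_int (- coeff q 1)" using T by auto
  ultimately show ?thesis by (metis Ints_of_int)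
qed

lemma algebraic_int_quadratic:
  fixes x :: complex and T N :: int
  assumes "x\<^sup>2 - of_int T * x + of_int N = 0"
  shows "algebraic_int x"
proof -
  have "lead_coeff [:N, -T, 1:] = 1" by simp
  moreover have "poly (map_poly of_int [:N, -T, 1:]) x = 0"
    using assms by (simp add: map_poly_pCons algebra_simps power2_eq_square)
  ultimately show ?thesis unfolding algebraic_int_altdef_ipoly by blast
qed

section \<open>Integral bases of imaginary quadratic fields\<close>

lemma of_rat_in_Reals: "(of_rat q :: complex) \<in> \<real>"
proof -
  obtain a b where "q = of_int a / of_int b" by (metis quotient_of_div surj_pair)
  thus ?thesis by (auto simp: of_rat_divide)
qed

text \<open>\<open>t\<close> and \<open>n\<close> are the trace and the norm of \<omega>, so the
  discriminant will be \<open>t^2 - 4 n\<close>. Placing \<omega> in the upper half-plane determines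
  it up to integer translations and avoids sign cases.\<close>

locale imag_quad =
  fixes F :: "complex set" and \<omega> :: complex and t n :: int
  assumes F_eq: "F = {of_rat x + of_rat y * \<omega> | x y. True}"
    and Im_omega: "Im \<omega> > 0"
    and omega_sq: "\<omega> * \<omega> = of_int t * \<omega> - of_int n"
    and O_eq: "ring_of_integers F = zlat 1 \<omega>"
    and subfield: "is_subfield F"

lemma subfieldD:
  assumes "is_subfield F"
  shows "1 \<in> F" "0 \<in> F" "x \<in> F \<Longrightarrow> y \<in> F \<Longrightarrow> x - y \<in> F" "x \<in> F \<Longrightarrow> y \<in> F \<Longrightarrow> x * y \<in> F"
    "x \<in> F \<Longrightarrow> inverse x \<in> F" "x \<in> F \<Longrightarrow> - x \<in> F" "x \<in> F \<Longrightarrow> y \<in> F \<Longrightarrow> x + y \<in> F"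
    "x \<in> F \<Longrightarrow> y \<in> F \<Longrightarrow> x / y \<in> F" "of_nat m \<in> F" "of_int k \<in> F" "of_rat q \<in> F"
proof -
  have 1: "1 \<in> F" and d: "\<And>x y. x \<in> F \<Longrightarrow> y \<in> F \<Longrightarrow> x - y \<in> F"
    and m: "\<And>x y. x \<in> F \<Longrightarrow> y \<in> F \<Longrightarrow> x * y \<in> F" and i: "\<And>x. x \<in> F \<Longrightarrow> inverse x \<in> F"
    using assms by (auto simp: is_subfield_def)
  have 0: "0 \<in> F" using d[OF 1 1] by simp
  have u: "- x \<in> F" if "x \<in> F" for x using d[OF 0 that] by simp
  have a: "x + y \<in> F" if "x \<in> F" "y \<in> F" for x y using d[OF that(1) u[OF that(2)]] by simp
  have q: "x / y \<in> F" if "x \<in> F" "y \<in> F" for x y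
    using m[OF that(1) i[OF that(2)]] by (simp add: field_simps)
  have nat: "of_nat m \<in> F" for m by (induction m) (auto intro: 0 1 a)
  have int: "of_int k \<in> F" for k by (cases k rule: int_cases2) (auto intro: nat u)
  have rat: "of_rat q \<in> F" for q
  proof -
    obtain a b where "q = of_int a / of_int b" by (metis quotient_of_div surj_pair)
    thus ?thesis by (auto simp: of_rat_divide intro: q int)
  qed
  show "1 \<in> F" by (rule 1)
  show "0 \<in> F" by (rule 0)
  show "of_nat m \<in> F" by (rule nat)
  show "of_int k \<in> F" by (rule int)
  show "of_rat q \<in> F" by (rule rat)
  show "x \<in> F \<Longrightarrow> inverse x \<in> F" by (rule i)
  show "x \<in> F \<Longrightarrow> - x \<in> F" by (rule u)
  show "x \<in> F \<Longrightarrow> y \<in> F \<Longrightarrow> x - y \<in> F" by (rule d)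
  show "x \<in> F \<Longrightarrow> y \<in> F \<Longrightarrow> x * y \<in> F" by (rule m)
  show "x \<in> F \<Longrightarrow> y \<in> F \<Longrightarrow> x + y \<in> F" by (rule a)
  show "x \<in> F \<Longrightarrow> y \<in> F \<Longrightarrow> x / y \<in> F" by (rule q)
qed

text \<open>Rational numbers are real, so any non-real \<open>z\<close> is independent of 1; a
  further independent element would exceed the dimension 2.\<close>

lemma imaginary_quadratic_field_span:
  assumes "imaginary_quadratic_field F"
  obtains z where "z \<in> F" "z \<notin> \<real>" "F = {of_rat x + of_rat y * z | x y. True}"
proof -
  have sf: "is_subfield F" and dim: "vector_space.dim (\<lambda>(q::rat) (z::complex). of_rat q * z) F = 2"
    using assms by (auto simp: imaginary_quadratic_field_def)
  obtain z where z: "z \<in> F" "z \<notin> \<real>" using assms by (auto simp: imaginary_quadratic_field_def)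
  note sfD = subfieldD[OF sf]
  interpret Q: vector_space "\<lambda>(q::rat) (z::complex). of_rat q * z"
    by unfold_locales (auto simp: algebra_simps of_rat_add of_rat_mult)
  have sub: "Q.subspace F"
    unfolding Q.subspace_def by (auto intro: sfD)
  obtain b where b: "b \<subseteq> F" "Q.independent b" "F \<subseteq> Q.span b" "card b = 2"
    using Q.basis_exists[of F] dim by metis
  have fb: "finite b" using b(4) by (metis card.infinite zero_neq_numeral)
  have ind: "Q.independent {1, z}"
  proof -
    have "z \<notin> Q.span {1}"
    proof
      assume "z \<in> Q.span {1}"
      then obtain k where "z = of_rat k" by (auto simp: Q.span_insert)
      thus False using z(2) by (simp add: of_rat_in_Reals)
    qed
    moreover have "1 \<notin> Q.span {}" by simp
    ultimately show ?thesis
      by (metis Q.independent_empty Q.independent_insert insert_commute)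
  qed
  have "F \<subseteq> Q.span {1, z}"
  proof
    fix w assume w: "w \<in> F"
    show "w \<in> Q.span {1, z}"
    proof (rule ccontr)
      assume nw: "w \<notin> Q.span {1, z}"
      hence "Q.independent (insert w {1, z})" by (simp add: Q.independent_insert ind)
      moreover have "insert w {1, z} \<subseteq> Q.span b" using w z(1) sfD(1) b(3) by auto
      ultimately have "card (insert w {1, z}) \<le> 2"
        using Q.independent_span_bound[OF fb] b(4) by metis
      moreover have "w \<noteq> 1" "w \<noteq> z" using nw Q.span_base[of _ "{1,z}"] by auto
      moreover have "z \<noteq> 1" using z(2) by auto
      ultimately show False by simp
    qed
  qed
  moreover have "Q.span {1, z} = {of_rat x + of_rat y * z | x y. True}"
    unfolding Q.span_insert
    by (auto simp: algebra_simps)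
  moreover have "{of_rat x + of_rat y * z | x y. True} \<subseteq> F"
    using z(1) by (auto intro!: sfD)
  ultimately have "F = {of_rat x + of_rat y * z | x y. True}" by blast
  thus ?thesis by (rule that[OF z])
qed


lemma Reals_in_quadratic_span:
  fixes z :: complex
  assumes F: "F = {of_rat x + of_rat y * z | x y. True}" and z: "z \<notin> \<real>" and w: "w \<in> F" "w \<in> \<real>"
  obtains q where "w = of_rat q"
proof -
  obtain x y where xy: "w = of_rat x + of_rat y * z" using w F by auto
  have "y = 0"
  proof (rule ccontr)
    assume "y \<noteq> 0"
    hence "z = (w - of_rat x) / of_rat y" using xy by simp
    also have "\<dots> \<in> \<real>" by (intro Reals_divide Reals_diff w of_rat_in_Reals)
    finally show False using z by simp
  qed
  thus ?thesis using xy that by simp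
qed

lemma complex_quadratic_eq: "x\<^sup>2 - (x + cnj x) * x + x * cnj x = (0::complex)"
  by (simp add: algebra_simps power2_eq_square)

lemma of_rat_Ints_complex: "q \<in> \<int> \<Longrightarrow> \<exists>k::int. (of_rat q :: complex) = of_int k"
  by (auto elim!: Ints_cases)

lemma rational_root_int:
  fixes k :: rat
  assumes "k\<^sup>2 \<in> \<int>" shows "k \<in> \<int>"
proof -
  obtain j where j: "k\<^sup>2 = of_int j" using assms by (auto elim: Ints_cases)
  have "(of_rat k :: complex)\<^sup>2 - of_int 0 * of_rat k + of_int (- j) = 0"
    using j by (simp flip: of_rat_power)
  hence "algebraic_int (of_rat k :: complex)" by (rule algebraic_int_quadratic)
  hence "(of_rat k :: complex) \<in> \<int>" by (rule rational_algebraic_int_is_int) simp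
  then obtain l where "(of_rat k :: complex) = of_rat (of_int l)" by (auto elim: Ints_cases)
  thus ?thesis by (simp only: of_rat_eq_iff) simp
qed

text \<open>The closure of quadratic integers under addition: with \<open>s = x - cnj x\<close>, \<open>s' = y - cnj y\<close> the
  product \<open>s s'\<close> is rational with integral square, and it has the parity of the product of the
  traces.\<close>

lemma cross_trace_int:
  fixes T N T' N' :: int and k :: rat and x y :: complex
  assumes "x + cnj x = of_int T" "x * cnj x = of_int N" "y + cnj y = of_int T'" "y * cnj y = of_int N'"
    and k: "(x - cnj x) * (y - cnj y) = of_rat k"
  shows "\<exists>m::int. x * cnj y + cnj x * y = of_int m"
proof -
  have "(x - cnj x)\<^sup>2 = (x + cnj x)\<^sup>2 - 4 * (x * cnj x)" "(y - cnj y)\<^sup>2 = (y + cnj y)\<^sup>2 - 4 * (y * cnj y)"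
    by (simp_all add: algebra_simps power2_eq_square)
  hence s: "(x - cnj x)\<^sup>2 = of_int (T\<^sup>2 - 4 * N)" "(y - cnj y)\<^sup>2 = of_int (T'\<^sup>2 - 4 * N')"
    using assms by simp_all
  have "of_rat (k\<^sup>2) = ((x - cnj x) * (y - cnj y))\<^sup>2" unfolding k by (simp add: of_rat_power)
  also have "\<dots> = (x - cnj x)\<^sup>2 * (y - cnj y)\<^sup>2" by (rule power_mult_distrib)
  also have "\<dots> = of_rat (of_int ((T\<^sup>2 - 4 * N) * (T'\<^sup>2 - 4 * N')))"
    unfolding s by (simp only: of_rat_of_int_eq of_int_mult of_rat_mult)
  finally have k2: "k\<^sup>2 = of_int ((T\<^sup>2 - 4 * N) * (T'\<^sup>2 - 4 * N'))" by (simp only: of_rat_eq_iff)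
  have "k \<in> \<int>"
  proof (rule rational_root_int)
    show "k\<^sup>2 \<in> \<int>" unfolding k2 by (rule Ints_of_int)
  qed
  then obtain l where l: "k = of_int l" by (auto elim: Ints_cases)
  have l2: "l\<^sup>2 = (T\<^sup>2 - 4 * N) * (T'\<^sup>2 - 4 * N')" using k2 unfolding l by (metis of_int_eq_iff of_int_power)
  have "even (l\<^sup>2) \<longleftrightarrow> even ((T * T')\<^sup>2)" unfolding l2 by (simp add: power_mult_distrib)
  hence "even (T * T' - l)" by auto
  then obtain m where m: "T * T' - l = 2 * m" by blast
  have "2 * (x * cnj y + cnj x * y) = (x + cnj x) * (y + cnj y) - (x - cnj x) * (y - cnj y)"
    by (simp add: algebra_simps)
  also have "\<dots> = of_int (T * T' - l)" using assms l by simp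
  also have "\<dots> = 2 * of_int m" unfolding m by simp
  finally have "x * cnj y + cnj x * y = of_int m" by (metis mult_cancel_left zero_neq_numeral)
  thus ?thesis by blast
qed

text \<open>The basis comes from minimisation: squares of imaginary parts of integers are discrete,
  so some \<omega> has least positive imaginary part. Subtracting a multiple of \<omega> from an
  integer leaves a real one, and real integers of \<open>F\<close> are rational integers.\<close>

theorem imaginary_quadratic_field_imag_quad:
  assumes "imaginary_quadratic_field F"
  obtains \<omega> t n where "imag_quad F \<omega> t n"
proof -
  have sf: "is_subfield F" using assms by (auto simp: imaginary_quadratic_field_def)
  note sfD = subfieldD[OF sf]
  obtain z where z: "z \<in> F" "z \<notin> \<real>" and F: "F = {of_rat x + of_rat y * z | x y. True}"
    using imaginary_quadratic_field_span[OF assms] by metis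
  have "z * z \<in> F" using z sfD by blast
  then obtain p q where pq: "z * z = of_rat p + of_rat q * z" using F by auto
  have Imz: "Im z \<noteq> 0" using z(2) by (simp add: complex_is_Real_iff)
  have rr: "of_rat r = complex_of_real (Re (of_rat r))" for r
    using of_rat_in_Reals by (metis of_real_Re)
  \<comment> \<open>Comparing imaginary parts in \<open>z * z = p + q z\<close> identifies
    \<open>q\<close> as the trace of \<open>z\<close>; hence conjugation preserves
    \<open>F\<close>.\<close>
  have cz: "cnj z = of_rat q - z"
  proof -
    have "Im (z * z) = Re (of_rat q) * Im z"
      unfolding pq by (subst (1 2) rr) simp
    hence "2 * Re z = Re (of_rat q)" using Imz by (simp add: algebra_simps)
    thus ?thesis by (subst rr) (auto simp: complex_eq_iff)
  qed
  have cnj: "cnj x \<in> F" if x: "x \<in> F" for x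
  proof -
    obtain a b where "x = of_rat a + of_rat b * z" using x F by auto
    hence "cnj x = of_rat a + of_rat b * (of_rat q - z)"
      using cz of_rat_in_Reals by (simp add: Reals_cnj_iff)
    thus ?thesis using sfD z by simp
  qed
  have rat: "\<exists>r. w = of_rat r" if "w \<in> F" "w \<in> \<real>" for w
    using Reals_in_quadratic_span[OF F z(2) that] by metis
  define O1 where "O1 = ring_of_integers F"
  \<comment> \<open>Integrality is read off from trace and norm. Closure under sums and products
    then only needs the cross term \<open>x * cnj y + cnj x * y\<close>, which is the subject of
    \<open>cross_trace_int\<close>.\<close>
  have O1_iff: "x \<in> O1 \<longleftrightarrow> x \<in> F \<and> (\<exists>T N::int. x + cnj x = of_int T \<and> x * cnj x = of_int N)" for x
  proof
    assume "x \<in> O1"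
    hence x: "x \<in> F" "algebraic_int x" by (auto simp: O1_def ring_of_integers_def)
    show "x \<in> F \<and> (\<exists>T N::int. x + cnj x = of_int T \<and> x * cnj x = of_int N)"
    proof (cases "x \<in> \<real>")
      case True
      then obtain r where r: "x = of_rat r" using rat x by blast
      have "x \<in> \<rat>" unfolding r by simp
      hence "x \<in> \<int>" using x(2) rational_algebraic_int_is_int by blast
      then obtain k where "x = of_int k" by (auto elim: Ints_cases)
      hence "x + cnj x = of_int (2 * k)" "x * cnj x = of_int (k * k)" by simp_all
      thus ?thesis using x by blast
    next
      case False
      have "x + cnj x \<in> F" "x * cnj x \<in> F" using sfD cnj x by auto
      moreover have "x + cnj x \<in> \<real>" "x * cnj x \<in> \<real>" by (auto simp: complex_is_Real_iff)
      ultimately obtain T N where TN: "x + cnj x = of_rat T" "x * cnj x = of_rat N" using rat by meson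
      have "T \<in> \<int> \<and> N \<in> \<int>"
        by (rule algebraic_int_trace_norm[OF x(2) False]) (use complex_quadratic_eq[of x] TN in simp)
      thus ?thesis using TN x of_rat_Ints_complex by metis
    qed
  next
    assume "x \<in> F \<and> (\<exists>T N::int. x + cnj x = of_int T \<and> x * cnj x = of_int N)"
    then obtain T N :: int where "x \<in> F" and TN: "x + cnj x = of_int T" "x * cnj x = of_int N" by auto
    moreover have "algebraic_int x"
      by (rule algebraic_int_quadratic) (use complex_quadratic_eq[of x] TN in simp)
    ultimately show "x \<in> O1" by (auto simp: O1_def ring_of_integers_def)
  qed
  have O1_real: "\<exists>k. x = of_int k" if x: "x \<in> O1" "x \<in> \<real>" for x
  proof -
    obtain r where r: "x = of_rat r" using rat[OF _ x(2)] x(1) O1_iff by blast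
    have "x \<in> \<rat>" unfolding r by simp
    moreover have "algebraic_int x" using x(1) by (auto simp: O1_def ring_of_integers_def)
    ultimately have "x \<in> \<int>" using rational_algebraic_int_is_int by blast
    thus ?thesis by (auto elim: Ints_cases)
  qed
  have O1_int: "of_int k \<in> O1" for k
  proof -
    have "(of_int k :: complex) + cnj (of_int k) = of_int (2 * k)"
      "(of_int k :: complex) * cnj (of_int k) = of_int (k * k)" by simp_all
    thus ?thesis using sfD(10) O1_iff by blast
  qed
  have O1_cross: "\<exists>m::int. x * cnj y + cnj x * y = of_int m" if xy: "x \<in> O1" "y \<in> O1" for x y
  proof -
    have "x \<in> F" "y \<in> F" using xy O1_iff by auto
    hence "(x - cnj x) * (y - cnj y) \<in> F" by (intro sfD(3,4) cnj)
    moreover have "(x - cnj x) * (y - cnj y) \<in> \<real>" by (auto simp: complex_is_Real_iff)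
    ultimately obtain k where k: "(x - cnj x) * (y - cnj y) = of_rat k" using rat by blast
    thus ?thesis using xy cross_trace_int unfolding O1_iff by metis
  qed
  have O1_add: "x + y \<in> O1" if xy: "x \<in> O1" "y \<in> O1" for x y
  proof -
    obtain m :: int where m: "x * cnj y + cnj x * y = of_int m" using O1_cross xy by blast
    obtain T N T' N' :: int where "x + cnj x = of_int T" "x * cnj x = of_int N" "y + cnj y = of_int T'" "y * cnj y = of_int N'"
      using xy O1_iff by metis
    moreover have "(x + y) + cnj (x + y) = (x + cnj x) + (y + cnj y)"
      "(x + y) * cnj (x + y) = x * cnj x + y * cnj y + (x * cnj y + cnj x * y)"
      by (simp_all add: algebra_simps)
    ultimately have "(x + y) + cnj (x + y) = of_int (T + T')" "(x + y) * cnj (x + y) = of_int (N + N' + m)"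
      using m by simp_all
    moreover have "x + y \<in> F" using xy sfD(7) O1_iff by blast
    ultimately show ?thesis using O1_iff[of "x + y"] by blast
  qed
  have O1_mult: "x * y \<in> O1" if xy: "x \<in> O1" "y \<in> O1" for x y
  proof -
    obtain m :: int where m: "x * cnj y + cnj x * y = of_int m" using O1_cross xy by blast
    obtain T N T' N' :: int where "x + cnj x = of_int T" "x * cnj x = of_int N" "y + cnj y = of_int T'" "y * cnj y = of_int N'"
      using xy O1_iff by metis
    moreover have "(x * y) + cnj (x * y) = (x + cnj x) * (y + cnj y) - (x * cnj y + cnj x * y)"
      "(x * y) * cnj (x * y) = (x * cnj x) * (y * cnj y)"
      by (simp_all add: algebra_simps)
    ultimately have "(x * y) + cnj (x * y) = of_int (T * T' - m)" "(x * y) * cnj (x * y) = of_int (N * N')"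
      using m by simp_all
    moreover have "x * y \<in> F" using xy sfD(4) O1_iff by blast
    ultimately show ?thesis using O1_iff[of "x * y"] by blast
  qed
  \<comment> \<open>The number is \<open>4 N - T^2\<close>, a non-negative integer; this is the
    discreteness on which \<open>LEAST\<close> relies below.\<close>
  have O1_im: "\<exists>k::nat. 4 * (Im x)\<^sup>2 = real k" if x: "x \<in> O1" for x
  proof -
    obtain T N :: int where TN: "x + cnj x = of_int T" "x * cnj x = of_int N" using x O1_iff by blast
    have "Re (x + cnj x) = of_int T" "Re (x * cnj x) = of_int N" using TN by simp_all
    hence "real_of_int (4 * N - T\<^sup>2) = 4 * (Re x * Re x + Im x * Im x) - (2 * Re x)\<^sup>2" by simp
    hence "4 * (Im x)\<^sup>2 = of_int (4 * N - T\<^sup>2)" by (simp add: power2_eq_square)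
    moreover from this have "4 * N - T\<^sup>2 \<ge> 0" by (metis of_int_0_le_iff zero_le_mult_iff zero_le_numeral zero_le_power2)
    ultimately show ?thesis by (metis of_nat_nat of_int_of_nat_eq)
  qed
  obtain y0 where y0: "y0 \<in> O1" "Im y0 > 0"
  proof -
    obtain p1 p2 where p: "p = of_int p1 / of_int p2" "p2 > 0"
      by (metis quotient_of_div quotient_of_denom_pos surj_pair)
    obtain q1 q2 where q: "q = of_int q1 / of_int q2" "q2 > 0"
      by (metis quotient_of_div quotient_of_denom_pos surj_pair)
    \<comment> \<open>A common denominator of \<open>p\<close> and \<open>q\<close> in
      \<open>z^2 = p + q z\<close>: then \<open>d z\<close> is a root of a monic polynomial with
      integral coefficients.\<close>
    define d where "d = p2 * q2"
    have d: "of_rat p * (of_int p2 :: complex) = of_int p1" "of_rat q * (of_int q2 :: complex) = of_int q1"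
      using p q by (simp_all add: of_rat_divide)
    define y where "y = of_int d * z"
    have "y\<^sup>2 = of_int d * of_int d * (z * z)" by (simp add: y_def power2_eq_square)
    also have "\<dots> = of_int (p2 * q2) * of_int q2 * (of_rat p * of_int p2) + of_int p2 * (of_rat q * of_int q2) * y"
      by (simp add: pq y_def d_def algebra_simps)
    finally have "y\<^sup>2 - of_int (p2 * q1) * y + of_int (- (p2 * q2 * q2 * p1)) = 0"
      unfolding d by (simp add: algebra_simps)
    hence ay: "algebraic_int y" by (rule algebraic_int_quadratic)
    have yF: "y \<in> F" unfolding y_def by (intro sfD(4) sfD(10) z(1))
    have y1: "y \<in> O1" using ay yF by (simp add: O1_def ring_of_integers_def)
    hence y2: "- y \<in> O1" using O1_mult[OF O1_int[of "-1"] y1] by simp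
    have "Im y \<noteq> 0" using Imz p q by (simp add: y_def d_def)
    thus ?thesis using that[OF y1] that[OF y2] by (cases "Im y > 0") auto
  qed
  define P where "P k \<longleftrightarrow> (\<exists>x\<in>O1. Im x > 0 \<and> 4 * (Im x)\<^sup>2 = real k)" for k
  have "\<exists>k. P k" using y0 O1_im P_def by metis
  then obtain \<omega> where om: "\<omega> \<in> O1" "Im \<omega> > 0" "4 * (Im \<omega>)\<^sup>2 = real (LEAST k. P k)"
    using LeastI_ex[of P] P_def by metis
  have om_min: "Im \<omega> \<le> Im x" if x: "x \<in> O1" "Im x > 0" for x
  proof -
    obtain k :: nat where k: "4 * (Im x)\<^sup>2 = real k" using O1_im x by blast
    hence "(LEAST k. P k) \<le> k" using x by (intro Least_le) (auto simp: P_def)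
    hence "(Im \<omega>)\<^sup>2 \<le> (Im x)\<^sup>2" using k om(3) by linarith
    thus ?thesis using x(2) by (meson less_imp_le power2_le_imp_le)
  qed
  have O1_eq: "O1 = zlat 1 \<omega>"
  proof
    show "zlat 1 \<omega> \<subseteq> O1" using O1_add O1_mult O1_int om(1) by (auto simp: zlat_def)
    show "O1 \<subseteq> zlat 1 \<omega>"
    proof
      fix x assume x: "x \<in> O1"
      define k where "k = \<lfloor>Im x / Im \<omega>\<rfloor>"
      define x' where "x' = x + of_int (- k) * \<omega>"
      have x': "x' \<in> O1" unfolding x'_def by (intro O1_add O1_mult O1_int x om(1))
      have "Im x' = Im x - k * Im \<omega>" by (simp add: x'_def)
      moreover have "k * Im \<omega> \<le> Im x" unfolding k_def using om(2)
        by (metis floor_divide_lower)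
      moreover have "Im x < (k + 1) * Im \<omega>" 
      proof -
        have "Im x / Im \<omega> < k + 1" unfolding k_def by linarith
        thus ?thesis using om(2) by (simp add: divide_less_eq)
      qed
      ultimately have "0 \<le> Im x'" "Im x' < Im \<omega>" by (simp_all add: algebra_simps)
      hence "Im x' = 0" using om_min[OF x'] by linarith
      then obtain j where j: "x' = of_int j" using O1_real[OF x'] by (auto simp: complex_is_Real_iff)
      have "x = of_int j + of_int k * \<omega>" using j by (simp add: x'_def algebra_simps)
      thus "x \<in> zlat 1 \<omega>" using zlat_1I by simp
    qed
  qed
  obtain t n :: int where tn: "\<omega> + cnj \<omega> = of_int t" "\<omega> * cnj \<omega> = of_int n" using om(1) O1_iff by blast
  have "imag_quad F \<omega> t n"
  proof
    show "\<omega> * \<omega> = of_int t * \<omega> - of_int n"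
      using complex_quadratic_eq[of \<omega>] tn by (simp add: power2_eq_square algebra_simps)
    have "\<omega> \<in> F" using om(1) O1_iff by blast
    then obtain a b where ab: "\<omega> = of_rat a + of_rat b * z" using F by auto
    have b: "b \<noteq> 0" using ab om(2) of_rat_in_Reals[of a] by (auto simp: complex_is_Real_iff)
    show "F = {of_rat x + of_rat y * \<omega> | x y. True}"
    proof
      show "{of_rat x + of_rat y * \<omega> | x y. True} \<subseteq> F" using sfD \<open>\<omega> \<in> F\<close> by auto
      show "F \<subseteq> {of_rat x + of_rat y * \<omega> | x y. True}"
      proof
        fix w assume "w \<in> F"
        then obtain x y where "w = of_rat x + of_rat y * z" using F by auto
        hence "w = of_rat (x - y * a / b) + of_rat (y / b) * \<omega>"
          using b by (simp add: ab of_rat_diff of_rat_mult of_rat_divide field_simps)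
        thus "w \<in> {of_rat x + of_rat y * \<omega> | x y. True}" by blast
      qed
    qed
  qed (use om O1_eq O1_def sf in auto)
  thus ?thesis using that by blast
qed

section \<open>Plane lattices and the ring of integers\<close>

text \<open>The signed area of the parallelogram on \<open>a\<close> and \<open>b\<close>. It plays
  the role of a determinant: non-vanishing means independence, and index, discriminant and the norm
  of a multiplier are all quotients of areas.\<close>

definition area :: "complex \<Rightarrow> complex \<Rightarrow> real" where "area a b = Im (cnj a * b)"

lemma area_alt: "area a b = Re a * Im b - Im a * Re b"
  by (simp add: area_def)

lemma area_lincomb:
  "area (of_int p * a + of_int q * b) (of_int r * a + of_int s * b) = of_int (p * s - q * r) * area a b"
  by (simp add: area_alt algebra_simps)

lemma area_mult: "area (u * a) (u * b) = (cmod u)\<^sup>2 * area a b"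
  by (simp add: area_alt cmod_power2) (simp add: algebra_simps power2_eq_square)

lemma zlat_0 [simp]: "0 \<in> zlat a b"
  using zlatI[of 0 a 0 b] by simp

lemma zlat_add: "x \<in> zlat a b \<Longrightarrow> y \<in> zlat a b \<Longrightarrow> x + y \<in> zlat a b"
proof -
  assume "x \<in> zlat a b" "y \<in> zlat a b"
  then obtain p q r s where "x = of_int p * a + of_int q * b" "y = of_int r * a + of_int s * b"
    by (auto simp: zlat_def)
  hence "x + y = of_int (p + r) * a + of_int (q + s) * b" by (simp add: algebra_simps)
  thus ?thesis by (simp only: zlatI)
qed

lemma zlat_int_mult: "x \<in> zlat a b \<Longrightarrow> of_int k * x \<in> zlat a b"
proof -
  assume "x \<in> zlat a b"
  then obtain p q where "x = of_int p * a + of_int q * b" by (auto simp: zlat_def)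
  hence "of_int k * x = of_int (k * p) * a + of_int (k * q) * b" by (simp add: algebra_simps)
  thus ?thesis by (simp only: zlatI)
qed

lemma zlat_uminus: "x \<in> zlat a b \<Longrightarrow> - x \<in> zlat a b"
  using zlat_int_mult[of x a b "-1"] by simp

lemma zlat_diff: "x \<in> zlat a b \<Longrightarrow> y \<in> zlat a b \<Longrightarrow> x - y \<in> zlat a b"
  using zlat_add[of x a b "- y"] zlat_uminus[of y a b] by simp

lemma zlat_subset:
  assumes "a \<in> S" "b \<in> S" "\<And>x y. x \<in> S \<Longrightarrow> y \<in> S \<Longrightarrow> x - y \<in> S"
  shows "zlat a b \<subseteq> S"
proof -
  have 0: "0 \<in> S" using assms(3)[OF assms(1,1)] by simp
  have u: "- x \<in> S" if "x \<in> S" for x using assms(3)[OF 0 that] by simp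
  have add: "x + y \<in> S" if "x \<in> S" "y \<in> S" for x y using assms(3)[OF that(1) u[OF that(2)]] by simp
  have nat: "of_nat k * x \<in> S" if "x \<in> S" for k x
    by (induction k) (auto simp: algebra_simps 0 intro: add that)
  have int: "of_int k * x \<in> S" if x: "x \<in> S" for k x
  proof (cases k rule: int_cases2)
    case (nonneg m) thus ?thesis using nat[OF x, of m] by simp
  next
    case (nonpos m) thus ?thesis using u[OF nat[OF x, of m]] by simp
  qed
  show ?thesis by (auto simp: zlat_def intro: add int assms)
qed

lemma image_mult_zlat: "(*) c ` zlat a b = zlat (c * a) (c * b)"
proof (rule subset_antisym; rule subsetI)
  fix z assume "z \<in> (*) c ` zlat a b"
  then obtain x y where "z = c * (of_int x * a + of_int y * b)" by (auto simp: zlat_def)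
  hence "z = of_int x * (c * a) + of_int y * (c * b)" by (simp add: algebra_simps)
  thus "z \<in> zlat (c * a) (c * b)" by (simp add: zlatI)
next
  fix z assume "z \<in> zlat (c * a) (c * b)"
  then obtain x y where "z = of_int x * (c * a) + of_int y * (c * b)" by (auto simp: zlat_def)
  hence "z = c * (of_int x * a + of_int y * b)" by (simp add: algebra_simps)
  thus "z \<in> (*) c ` zlat a b" using zlatI by blast
qed

lemma image_cnj_zlat: "cnj ` zlat a b = zlat (cnj a) (cnj b)"
proof (rule subset_antisym; rule subsetI)
  fix z assume "z \<in> cnj ` zlat a b"
  then obtain x y where "z = cnj (of_int x * a + of_int y * b)" by (auto simp: zlat_def)
  thus "z \<in> zlat (cnj a) (cnj b)" by (simp add: zlatI)
next
  fix z assume "z \<in> zlat (cnj a) (cnj b)"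
  then obtain x y where "z = of_int x * cnj a + of_int y * cnj b" by (auto simp: zlat_def)
  hence "z = cnj (of_int x * a + of_int y * b)" by simp
  thus "z \<in> cnj ` zlat a b" using zlatI by blast
qed

lemma area_of_mem_zlat:
  assumes "c \<in> zlat a b" "d \<in> zlat a b"
  obtains k :: int where "area c d = of_int k * area a b"
proof -
  obtain p q r s where "c = of_int p * a + of_int q * b" "d = of_int r * a + of_int s * b"
    using assms by (auto simp: zlat_def)
  thus ?thesis using that[of "p * s - q * r"] area_lincomb by simp
qed

text \<open>Each area is an integral multiple of the other, so if they do not vanish the two
  integers are mutually inverse, hence signs.\<close>

lemma zlat_area_unique:
  assumes "zlat a b = zlat c d"
  shows "\<bar>area a b\<bar> = \<bar>area c d\<bar>"
proof -
  obtain k where k: "area c d = of_int k * area a b"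
    using area_of_mem_zlat[of c a b d] assms by (metis zlat_basis)
  obtain l where l: "area a b = of_int l * area c d"
    using area_of_mem_zlat[of a c d b] assms by (metis zlat_basis)
  show ?thesis
  proof (cases "area a b = 0")
    case True thus ?thesis using k by simp
  next
    case False
    have "of_int l * (of_int k * area a b) = area a b" using k l by metis
    hence "real_of_int (l * k) * area a b = 1 * area a b" by (simp add: mult.assoc)
    hence "real_of_int (l * k) = 1" by (rule mult_right_cancel[OF False, THEN iffD1])
    hence "l * k = 1" by (metis of_int_eq_1_iff)
    hence "\<bar>k\<bar> = 1" using zmult_eq_1_iff by fastforce
    thus ?thesis using k by (simp add: abs_mult flip: of_int_abs)
  qed
qed

text \<open>Cramer's rule for the real and imaginary parts of the difference.\<close>

lemma zlat_coeffs_unique: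
  assumes "area a b \<noteq> 0" "of_int x * a + of_int y * b = of_int x' * a + of_int y' * b"
  shows "x = x' \<and> y = y'"
proof -
  have "of_int (x - x') * a + of_int (y - y') * b = 0" using assms(2) by (simp add: algebra_simps)
  hence e: "of_int (x - x') * Re a + of_int (y - y') * Re b = 0" "of_int (x - x') * Im a + of_int (y - y') * Im b = 0"
    by (auto simp: complex_eq_iff)
  have "of_int (x - x') * area a b = (of_int (x - x') * Re a + of_int (y - y') * Re b) * Im b
      - (of_int (x - x') * Im a + of_int (y - y') * Im b) * Re b"
    "of_int (y - y') * area a b = Re a * (of_int (x - x') * Im a + of_int (y - y') * Im b)
      - Im a * (of_int (x - x') * Re a + of_int (y - y') * Re b)"
    by (simp_all add: area_alt algebra_simps)
  hence "of_int (x - x') * area a b = 0" "of_int (y - y') * area a b = 0" unfolding e by simp_all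
  thus ?thesis using assms(1) by simp
qed

context imag_quad begin

lemmas F_1 = subfieldD(1)[OF subfield] and F_0 = subfieldD(2)[OF subfield]
  and F_diff = subfieldD(3)[OF subfield] and F_mult = subfieldD(4)[OF subfield]
  and F_inverse = subfieldD(5)[OF subfield] and F_uminus = subfieldD(6)[OF subfield]
  and F_add = subfieldD(7)[OF subfield] and F_divide = subfieldD(8)[OF subfield]
  and F_of_nat = subfieldD(9)[OF subfield] and F_of_int = subfieldD(10)[OF subfield]
  and F_of_rat = subfieldD(11)[OF subfield]

lemmas F_intros = F_1 F_0 F_diff F_mult F_inverse F_uminus F_add F_divide F_of_nat F_of_int F_of_rat

abbreviation OF :: "complex set" where "OF \<equiv> zlat 1 \<omega>"

lemma omega_not_real: "\<omega> \<notin> \<real>" using Im_omega by (auto simp: complex_is_Real_iff)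

lemma omega_in_F: "\<omega> \<in> F"
  using F_eq by (force intro: exI[of _ 0] exI[of _ 1])

lemma re_omega: "2 * Re \<omega> = of_int t"
proof -
  have "Im (\<omega> * \<omega>) = of_int t * Im \<omega>" unfolding omega_sq by simp
  hence "Im \<omega> * (2 * Re \<omega> - of_int t) = 0" by (simp add: algebra_simps)
  thus ?thesis using Im_omega by simp
qed

lemma cnj_omega: "cnj \<omega> = of_int t - \<omega>"
  using re_omega by (simp add: complex_eq_iff)

lemma omega_cnj: "\<omega> * cnj \<omega> = of_int n"
  unfolding cnj_omega using omega_sq by (simp add: algebra_simps)

lemma norm_omega: "(cmod \<omega>)\<^sup>2 = of_int n"
  using omega_cnj by (metis complex_norm_square of_real_eq_iff of_real_of_int_eq)

lemma disc_eq: "of_int (t\<^sup>2 - 4 * n) = - 4 * (Im \<omega>)\<^sup>2"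
proof -
  have "of_int (t\<^sup>2 - 4 * n) = (2 * Re \<omega>)\<^sup>2 - 4 * (cmod \<omega>)\<^sup>2" unfolding re_omega norm_omega by simp
  thus ?thesis by (simp only: cmod_power2) (simp add: power2_eq_square)
qed

lemma disc_neg: "t\<^sup>2 - 4 * n < 0"
proof -
  have "real_of_int (t\<^sup>2 - 4 * n) < 0" unfolding disc_eq using Im_omega by simp
  thus ?thesis by linarith
qed

lemma cnj_F: "x \<in> F \<Longrightarrow> cnj x \<in> F"
proof -
  assume "x \<in> F"
  then obtain a b where "x = of_rat a + of_rat b * \<omega>" using F_eq by auto
  hence "cnj x = of_rat a + of_rat b * (of_int t - \<omega>)"
    using of_rat_in_Reals by (simp add: cnj_omega Reals_cnj_iff)
  thus ?thesis by (auto intro!: F_intros omega_in_F)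
qed

lemma F_real: "x \<in> F \<Longrightarrow> x \<in> \<real> \<Longrightarrow> \<exists>q. x = of_rat q"
  using Reals_in_quadratic_span[OF F_eq omega_not_real] by metis

lemma OF_subset_F: "x \<in> OF \<Longrightarrow> x \<in> F"
  by (auto simp: zlat_def intro!: F_intros omega_in_F)

lemma OF_1: "1 \<in> OF" by simp

lemma OF_of_int: "of_int k \<in> OF"
  using zlat_1I[of k 0 \<omega>] by simp

lemma OF_of_nat: "of_nat k \<in> OF"
  using OF_of_int[of "int k"] by simp

lemma OF_mult: "x \<in> OF \<Longrightarrow> y \<in> OF \<Longrightarrow> x * y \<in> OF"
proof -
  assume "x \<in> OF" "y \<in> OF"
  then obtain a b c d where "x = of_int a + of_int b * \<omega>" "y = of_int c + of_int d * \<omega>"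
    by (auto simp: zlat_def)
  hence "x * y = of_int (a * c - b * d * n) + of_int (a * d + b * c + b * d * t) * \<omega> + of_int (b * d) * (\<omega> * \<omega> - of_int t * \<omega> + of_int n)"
    by (simp add: algebra_simps)
  hence "x * y = of_int (a * c - b * d * n) + of_int (a * d + b * c + b * d * t) * \<omega>"
    unfolding omega_sq by simp
  thus ?thesis by (simp only: zlat_1I)
qed

lemma OF_cnj: "x \<in> OF \<Longrightarrow> cnj x \<in> OF"
proof -
  assume "x \<in> OF"
  then obtain a b where "x = of_int a + of_int b * \<omega>" by (auto simp: zlat_def)
  hence "cnj x = of_int (a + b * t) + of_int (- b) * \<omega>" by (simp add: cnj_omega algebra_simps)
  thus ?thesis by (simp only: zlat_1I)
qed

lemma OF_iff: "x \<in> OF \<longleftrightarrow> x \<in> F \<and> algebraic_int x"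
  using O_eq by (auto simp: ring_of_integers_def)

lemma OF_real: "x \<in> OF \<Longrightarrow> x \<in> \<real> \<Longrightarrow> \<exists>k. x = of_int k"
  using Im_omega by (auto simp: zlat_def complex_is_Real_iff)

lemma OF_norm: "x \<in> OF \<Longrightarrow> \<exists>k::nat. (cmod x)\<^sup>2 = real k"
proof -
  assume x: "x \<in> OF"
  have "x * cnj x \<in> OF" by (intro OF_mult OF_cnj x)
  moreover have "x * cnj x \<in> \<real>" by (simp add: complex_mult_cnj)
  ultimately obtain k where "x * cnj x = of_int k" using OF_real by blast
  hence k: "(cmod x)\<^sup>2 = of_int k" by (metis complex_norm_square of_real_eq_iff of_real_of_int_eq)
  hence "k \<ge> 0" by (metis of_int_0_le_iff zero_le_power2)
  thus ?thesis using k by (metis of_nat_nat of_int_of_nat_eq)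
qed

lemma F_denominator: "x \<in> F \<Longrightarrow> \<exists>d::nat. d > 0 \<and> of_nat d * x \<in> OF"
proof -
  assume "x \<in> F"
  then obtain a b where x: "x = of_rat a + of_rat b * \<omega>" using F_eq by auto
  obtain a1 a2 where a: "a = of_int a1 / of_int a2" "a2 > 0"
    by (metis quotient_of_div quotient_of_denom_pos surj_pair)
  obtain b1 b2 where b: "b = of_int b1 / of_int b2" "b2 > 0"
    by (metis quotient_of_div quotient_of_denom_pos surj_pair)
  have e: "of_rat a * of_int a2 = (of_int a1 :: complex)" "of_rat b * of_int b2 = (of_int b1 :: complex)"
    using a b by (simp_all add: of_rat_divide)
  have "of_int (a2 * b2) * x = (of_rat a * of_int a2) * of_int b2 + of_int a2 * (of_rat b * of_int b2) * \<omega>"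
    by (simp add: x algebra_simps)
  hence "of_int (a2 * b2) * x = of_int (a1 * b2) + of_int (a2 * b1) * \<omega>"
    unfolding e by simp
  hence "of_int (a2 * b2) * x \<in> OF" by (simp only: zlat_1I)
  moreover have "of_int (a2 * b2) = (of_nat (nat (a2 * b2)) :: complex)" "nat (a2 * b2) > 0"
    using a b by simp_all
  ultimately show ?thesis by metis
qed

text \<open>\<open>x\<close> is a root of the characteristic polynomial of multiplication by \<open>x\<close> on the lattice.\<close>

lemma mult_stable_in_OF:
  assumes x: "x \<in> F" and a: "a \<noteq> 0" and xa: "x * a \<in> zlat a b" "x * b \<in> zlat a b"
  shows "x \<in> OF"
proof -
  obtain p q r s where e: "x * a = of_int p * a + of_int q * b" "x * b = of_int r * a + of_int s * b"
    using xa by (auto simp: zlat_def)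
  have "a * (x\<^sup>2 - of_int (p + s) * x + of_int (p * s - q * r))
      = (x - of_int s) * (x * a - of_int p * a - of_int q * b) + of_int q * (x * b - of_int r * a - of_int s * b)"
    by (simp add: algebra_simps power2_eq_square)
  also have "\<dots> = 0" unfolding e by simp
  finally have "x\<^sup>2 - of_int (p + s) * x + of_int (p * s - q * r) = 0" using a by simp
  hence "algebraic_int x" by (rule algebraic_int_quadratic)
  thus ?thesis using x OF_iff by blast
qed

text \<open>The defining expression is \<open>-4 (area w1 w2)^2\<close>, which is independent of the
  basis; this makes the definite description legitimate.\<close>

theorem discriminant_eq: "discriminant F = t\<^sup>2 - 4 * n"
proof -
  have sq: "(w1 * cnj w2 - w2 * cnj w1)\<^sup>2 = of_real (- 4 * (area w1 w2)\<^sup>2)" for w1 w2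
    by (simp add: area_alt complex_eq_iff power2_eq_square algebra_simps)
  have *: "(w1 * cnj w2 - w2 * cnj w1)\<^sup>2 = of_int (t\<^sup>2 - 4 * n)" if "OF = zlat w1 w2" for w1 w2
  proof -
    have "\<bar>area w1 w2\<bar> = \<bar>Im \<omega>\<bar>" using zlat_area_unique[OF that] by (simp add: area_alt)
    hence "(area w1 w2)\<^sup>2 = (Im \<omega>)\<^sup>2" by (metis power2_abs)
    thus ?thesis unfolding sq using disc_eq by (metis of_real_of_int_eq)
  qed
  show ?thesis unfolding discriminant_def
  proof (rule the_equality)
    show "\<exists>w1 w2. ring_of_integers F = int_span {w1, w2} \<and> of_int (t\<^sup>2 - 4 * n) = (w1 * cnj w2 - w2 * cnj w1)\<^sup>2"
      using *[of 1 \<omega>] O_eq int_span_pair by metis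
  next
    fix D :: int
    assume "\<exists>w1 w2. ring_of_integers F = int_span {w1, w2} \<and> of_int D = (w1 * cnj w2 - w2 * cnj w1)\<^sup>2"
    then obtain w1 w2 where w: "OF = zlat w1 w2" "of_int D = (w1 * cnj w2 - w2 * cnj w1)\<^sup>2"
      using O_eq int_span_pair by metis
    have "(of_int D :: complex) = of_int (t\<^sup>2 - 4 * n)" unfolding w(2) by (rule *[OF w(1)])
    thus "D = t\<^sup>2 - 4 * n" by (simp only: of_int_eq_iff)
  qed
qed

text \<open>With \<open>u = r + s \<omega>\<close> and discriminant \<open>D\<close>, four times the
  norm is \<open>(2 r + s t)^2 - s^2 D\<close>. Since \<open>D\<close> is 0 or 1 modulo 4, excluding
  -3 and -4 leaves \<open>D \<le> -7\<close>, and a non-zero \<open>s\<close> would make this at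
  least 7 instead of 4.\<close>

lemma OF_unit:
  assumes D: "t\<^sup>2 - 4 * n \<noteq> - 3" "t\<^sup>2 - 4 * n \<noteq> - 4" and u: "u \<in> OF" "cmod u = 1"
  shows "u = 1 \<or> u = - 1"
proof -
  obtain r s where rs: "u = of_int r + of_int s * \<omega>" using u(1) by (auto simp: zlat_def)
  have "1 = (Re u)\<^sup>2 + (Im u)\<^sup>2" using u(2) cmod_power2[of u] by simp
  hence "4 = (2 * of_int r + of_int s * (2 * Re \<omega>))\<^sup>2 + (of_int s)\<^sup>2 * (4 * (Im \<omega>)\<^sup>2)"
    by (simp add: rs algebra_simps power2_eq_square)
  also have "\<dots> = of_int ((2 * r + s * t)\<^sup>2 - s\<^sup>2 * (t\<^sup>2 - 4 * n))"
    unfolding re_omega using disc_eq by simp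
  finally have e: "(2 * r + s * t)\<^sup>2 - s\<^sup>2 * (t\<^sup>2 - 4 * n) = 4" by linarith
  have "(t\<^sup>2 - 4 * n) mod 4 = 0 \<or> (t\<^sup>2 - 4 * n) mod 4 = 1"
  proof -
    have "t\<^sup>2 mod 4 = 0 \<or> t\<^sup>2 mod 4 = 1"
    proof (cases "even t")
      case True
      then obtain k where "t = 2 * k" by blast
      thus ?thesis by (simp add: power_mult_distrib)
    next
      case False
      then obtain k where "t = 2 * k + 1" by (metis oddE)
      hence "t\<^sup>2 = 1 + 4 * (k * k + k)" by (simp add: power2_eq_square algebra_simps)
      thus ?thesis by presburger
    qed
    thus ?thesis by presburger
  qed
  hence D7: "t\<^sup>2 - 4 * n \<le> - 7" using disc_neg D by presburger
  have "s = 0"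
  proof (rule ccontr)
    assume "s \<noteq> 0"
    hence "s\<^sup>2 \<ge> 1" by (simp add: int_one_le_iff_zero_less)
    hence "s\<^sup>2 * (- (t\<^sup>2 - 4 * n)) \<ge> 1 * 7" using D7 by (intro mult_mono) auto
    thus False using e zero_le_power2[of "2 * r + s * t"] by linarith
  qed
  hence "r * r = 1" using e by (simp add: power2_eq_square)
  hence "r = 1 \<or> r = - 1" by (simp add: zmult_eq_1_iff)
  thus ?thesis using rs \<open>s = 0\<close> by auto
qed

end

section \<open>Fractional ideals\<close>

text \<open>Taken for arbitrary subsets, so that commutativity, associativity and scaling hold
  unconditionally.\<close>

definition imul :: "complex set \<Rightarrow> complex set \<Rightarrow> complex set" where
  "imul I J = int_span {x * y | x y. x \<in> I \<and> y \<in> J}"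

lemma imul_mult: "x \<in> I \<Longrightarrow> y \<in> J \<Longrightarrow> x * y \<in> imul I J"
proof -
  interpret Modules.module "\<lambda>(k::int) (z::complex). of_int k * z" by (rule int_module)
  show "x \<in> I \<Longrightarrow> y \<in> J \<Longrightarrow> x * y \<in> imul I J" unfolding imul_def by (rule span_base) blast
qed

lemma imul_closed:
  "0 \<in> imul I J" "x \<in> imul I J \<Longrightarrow> y \<in> imul I J \<Longrightarrow> x + y \<in> imul I J"
  "x \<in> imul I J \<Longrightarrow> y \<in> imul I J \<Longrightarrow> x - y \<in> imul I J"
  "x \<in> imul I J \<Longrightarrow> of_int k * x \<in> imul I J"
proof -
  interpret Modules.module "\<lambda>(k::int) (z::complex). of_int k * z" by (rule int_module)
  show "0 \<in> imul I J" "x \<in> imul I J \<Longrightarrow> y \<in> imul I J \<Longrightarrow> x + y \<in> imul I J"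
    "x \<in> imul I J \<Longrightarrow> y \<in> imul I J \<Longrightarrow> x - y \<in> imul I J"
    "x \<in> imul I J \<Longrightarrow> of_int k * x \<in> imul I J"
    unfolding imul_def by (fact span_zero, erule (1) span_add, erule (1) span_diff, erule span_scale)
qed

lemma int_mult_closed:
  fixes S :: "complex set"
  assumes "0 \<in> S" "\<And>x y. x \<in> S \<Longrightarrow> y \<in> S \<Longrightarrow> x - y \<in> S" "x \<in> S"
  shows "of_int k * x \<in> S"
proof -
  have "zlat x x \<subseteq> S" using assms by (intro zlat_subset) auto
  moreover have "of_int k * x \<in> zlat x x" by (intro zlat_int_mult) simp
  ultimately show ?thesis by blast
qed

text \<open>The induction principle for products: only pure products need checking. It is mostly
  applied to preimages such as \<open>{x. c * x \<in> S}\<close>, which are again closed under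
  differences.\<close>

lemma imul_subset:
  assumes "\<And>x y. x \<in> I \<Longrightarrow> y \<in> J \<Longrightarrow> x * y \<in> S" "0 \<in> S" "\<And>x y. x \<in> S \<Longrightarrow> y \<in> S \<Longrightarrow> x - y \<in> S"
  shows "imul I J \<subseteq> S"
proof -
  interpret Modules.module "\<lambda>(k::int) (z::complex). of_int k * z" by (rule int_module)
  have add: "x + y \<in> S" if "x \<in> S" "y \<in> S" for x y
    using assms(3)[OF that(1) assms(3)[OF assms(2) that(2)]] by simp
  show ?thesis unfolding imul_def
    by (rule span_minimal) (auto simp: subspace_def intro: assms add int_mult_closed[OF assms(2,3)])
qed

lemma imul_commute: "imul I J = imul J I"
  unfolding imul_def by (metis (no_types, lifting) mult.commute)

lemma imul_mult_left:
  assumes "\<And>y. y \<in> J \<Longrightarrow> c * y \<in> J" "x \<in> imul I J"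
  shows "c * x \<in> imul I J"
proof -
  have "imul I J \<subseteq> {x. c * x \<in> imul I J}"
  proof (rule imul_subset)
    fix x y assume "x \<in> I" "y \<in> J"
    hence "x * (c * y) \<in> imul I J" by (intro imul_mult assms(1))
    thus "x * y \<in> {x. c * x \<in> imul I J}" by (simp add: algebra_simps)
  qed (auto simp: imul_closed right_diff_distrib)
  thus ?thesis using assms(2) by blast
qed

text \<open>Additivity is used in one factor at a time: with \<open>y\<close> fixed, the left factor
  is reduced to pure products. Commutativity then yields the other inclusion.\<close>

lemma imul_assoc_subset: "imul (imul I J) K \<subseteq> imul I (imul J K)"
proof (rule imul_subset)
  fix x y assume x: "x \<in> imul I J" and y: "y \<in> K"
  have "imul I J \<subseteq> {x. x * y \<in> imul I (imul J K)}"
  proof (rule imul_subset)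
    fix a b assume "a \<in> I" "b \<in> J"
    hence "a * (b * y) \<in> imul I (imul J K)" by (intro imul_mult y)
    thus "a * b \<in> {x. x * y \<in> imul I (imul J K)}" by (simp add: mult.assoc)
  qed (auto simp: imul_closed left_diff_distrib)
  thus "x * y \<in> imul I (imul J K)" using x by blast
qed (auto simp: imul_closed)

lemma imul_assoc: "imul (imul I J) K = imul I (imul J K)"
proof
  show "imul (imul I J) K \<subseteq> imul I (imul J K)" by (rule imul_assoc_subset)
  have "imul (imul K J) I \<subseteq> imul K (imul J I)" by (rule imul_assoc_subset)
  thus "imul I (imul J K) \<subseteq> imul (imul I J) K" by (simp add: imul_commute)
qed

lemma imul_scale: "imul ((*) c ` I) J = (*) c ` imul I J"
proof
  have 1: "x - y \<in> (*) c ` imul I J" if "x \<in> (*) c ` imul I J" "y \<in> (*) c ` imul I J" for x y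
    using that imul_closed(3) by (auto simp flip: right_diff_distrib)
  show "imul ((*) c ` I) J \<subseteq> (*) c ` imul I J"
  proof (rule imul_subset)
    show "x * y \<in> (*) c ` imul I J" if "x \<in> (*) c ` I" "y \<in> J" for x y
      using that imul_mult by (auto simp: mult.assoc)
    show "0 \<in> (*) c ` imul I J" using imul_closed(1) by force
  qed (rule 1)
  have "imul I J \<subseteq> {x. c * x \<in> imul ((*) c ` I) J}"
  proof (rule imul_subset)
    fix x y assume "x \<in> I" "y \<in> J"
    hence "(c * x) * y \<in> imul ((*) c ` I) J" by (intro imul_mult imageI)
    thus "x * y \<in> {x. c * x \<in> imul ((*) c ` I) J}" by (simp add: mult.assoc)
  qed (auto simp: imul_closed right_diff_distrib)
  thus "(*) c ` imul I J \<subseteq> imul ((*) c ` I) J" by blast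
qed

lemma imul_scale_right: "imul I ((*) c ` J) = (*) c ` imul I J"
  using imul_scale[of c J I] by (simp add: imul_commute)

lemma of_real_of_rat: "of_real (of_rat q) = (of_rat q :: complex)"
proof -
  obtain a b where "q = of_int a / of_int b" by (metis quotient_of_div surj_pair)
  thus ?thesis by (simp add: of_rat_divide)
qed

lemma image_mult_mult: "(*) (c::complex) ` (*) d ` S = (*) (c * d) ` S"
  by (auto simp: image_image mult.assoc)

lemma image_mult_inverse:
  assumes "(c::complex) \<noteq> 0" "A = (*) c ` B" shows "B = (*) (1 / c) ` A"
  unfolding assms(2) image_mult_mult using assms(1) by simp

context imag_quad begin

abbreviation fi :: "complex set \<Rightarrow> bool" where "fi \<equiv> fractional_ideal F"

lemma fi_iff: "fi I \<longleftrightarrow> I \<subseteq> F \<and> 0 \<in> I \<and> I \<noteq> {0} \<and> (\<forall>x\<in>I. \<forall>y\<in>I. x + y \<in> I) \<and> (\<forall>a\<in>OF. \<forall>x\<in>I. a * x \<in> I) \<and>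
     (\<exists>d\<in>OF. d \<noteq> 0 \<and> (\<forall>x\<in>I. d * x \<in> OF))"
  by (simp add: fractional_ideal_def O_eq)

lemma fiD:
  assumes "fi I"
  shows "x \<in> I \<Longrightarrow> x \<in> F" "0 \<in> I" "x \<in> I \<Longrightarrow> y \<in> I \<Longrightarrow> x + y \<in> I" "a \<in> OF \<Longrightarrow> x \<in> I \<Longrightarrow> a * x \<in> I"
    "x \<in> I \<Longrightarrow> - x \<in> I" "x \<in> I \<Longrightarrow> y \<in> I \<Longrightarrow> x - y \<in> I" "x \<in> I \<Longrightarrow> of_int k * x \<in> I"
    "\<exists>x\<in>I. x \<noteq> 0" "\<exists>d::nat. d > 0 \<and> (\<forall>x\<in>I. of_nat d * x \<in> OF)"
proof -
  show s: "x \<in> I \<Longrightarrow> x \<in> F" "0 \<in> I" and a: "\<And>x y. x \<in> I \<Longrightarrow> y \<in> I \<Longrightarrow> x + y \<in> I"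
    and m: "\<And>a x. a \<in> OF \<Longrightarrow> x \<in> I \<Longrightarrow> a * x \<in> I" and "\<exists>x\<in>I. x \<noteq> 0"
    using assms unfolding fi_iff by blast+
  show u: "- x \<in> I" if "x \<in> I" for x using m[OF OF_of_int[of "-1"] that] by simp
  show "x - y \<in> I" if "x \<in> I" "y \<in> I" for x y using a[OF that(1) u[OF that(2)]] by simp
  show "of_int k * x \<in> I" if "x \<in> I" using m[OF OF_of_int that] .
  obtain d where d: "d \<in> OF" "d \<noteq> 0" "\<And>x. x \<in> I \<Longrightarrow> d * x \<in> OF" using assms unfolding fi_iff by blast
  \<comment> \<open>The denominator is replaced by its norm, a positive natural number which is
    still a multiple of it.\<close>
  obtain k :: nat where k: "(cmod d)\<^sup>2 = real k" using OF_norm[OF d(1)] by blast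
  have "complex_of_real ((cmod d)\<^sup>2) = cnj d * d" by (simp only: complex_norm_square mult.commute)
  hence kd: "of_nat k = cnj d * d" unfolding k by simp
  hence "of_nat k * x \<in> OF" if "x \<in> I" for x
    using OF_mult[OF OF_cnj[OF d(1)] d(3)[OF that]] by (simp add: mult.assoc)
  moreover have "k > 0" using kd d(2) by (metis complex_cnj_zero_iff gr0I mult_eq_0_iff of_nat_0)
  ultimately show "\<exists>d::nat. d > 0 \<and> (\<forall>x\<in>I. of_nat d * x \<in> OF)" by blast
qed

lemma fiI:
  assumes "\<And>x. x \<in> I \<Longrightarrow> x \<in> F" "0 \<in> I" "\<And>x y. x \<in> I \<Longrightarrow> y \<in> I \<Longrightarrow> x + y \<in> I"
    "\<And>a x. a \<in> OF \<Longrightarrow> x \<in> I \<Longrightarrow> a * x \<in> I" "z \<in> I" "z \<noteq> 0" "d > 0" "\<And>x. x \<in> I \<Longrightarrow> of_nat d * x \<in> OF"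
  shows "fi I"
proof -
  have "\<exists>d\<in>OF. d \<noteq> 0 \<and> (\<forall>x\<in>I. d * x \<in> OF)"
    using assms(7,8) OF_of_nat by (intro bexI[of _ "of_nat d"]) auto
  moreover have "I \<noteq> {0}" using assms(5,6) by blast
  ultimately show ?thesis unfolding fi_iff using assms(1-4) by blast
qed

lemma fi_OF: "fi OF"
  by (rule fiI[of _ 1 1]) (auto intro: OF_subset_F zlat_add OF_mult)

lemma fi_scale:
  assumes "fi I" "c \<in> F" "c \<noteq> 0" shows "fi ((*) c ` I)"
proof -
  note D = fiD[OF assms(1)]
  obtain d :: nat where d: "d > 0" "\<And>x. x \<in> I \<Longrightarrow> of_nat d * x \<in> OF" using D(9) by blast
  obtain e :: nat where e: "e > 0" "of_nat e * c \<in> OF" using F_denominator assms(2) by blast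
  obtain z where z: "z \<in> I" "z \<noteq> 0" using D(8) by blast
  show ?thesis
  proof (rule fiI[of _ "c * z" "e * d"])
    show "x \<in> F" if "x \<in> (*) c ` I" for x using that D(1) assms(2) by (auto intro: F_mult)
    show "0 \<in> (*) c ` I" using D(2) by force
    show "x + y \<in> (*) c ` I" if "x \<in> (*) c ` I" "y \<in> (*) c ` I" for x y
      using that D(3) by (auto simp flip: distrib_left)
    show "a * x \<in> (*) c ` I" if "a \<in> OF" "x \<in> (*) c ` I" for a x
      using that D(4) by (auto simp: mult.left_commute[of a c])
    show "of_nat (e * d) * x \<in> OF" if x: "x \<in> (*) c ` I" for x
    proof -
      obtain y where y: "y \<in> I" "x = c * y" using x by blast
      have "(of_nat e * c) * (of_nat d * y) \<in> OF" by (intro OF_mult e d y)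
      thus ?thesis using y by (simp add: mult_ac)
    qed
  qed (use z assms d e in auto)
qed

lemma fi_cnj: assumes "fi I" shows "fi (cnj ` I)"
proof -
  note D = fiD[OF assms]
  obtain d :: nat where d: "d > 0" "\<And>x. x \<in> I \<Longrightarrow> of_nat d * x \<in> OF" using D(9) by blast
  obtain z where z: "z \<in> I" "z \<noteq> 0" using D(8) by blast
  show ?thesis
  proof (rule fiI[of _ "cnj z" d])
    show "x \<in> F" if "x \<in> cnj ` I" for x using that D(1) by (auto intro: cnj_F)
    show "0 \<in> cnj ` I" using D(2) by force
    show "x + y \<in> cnj ` I" if "x \<in> cnj ` I" "y \<in> cnj ` I" for x y
      using that D(3) by (auto simp flip: complex_cnj_add)
    show "a * x \<in> cnj ` I" if ax: "a \<in> OF" "x \<in> cnj ` I" for a x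
    proof -
      obtain y where y: "y \<in> I" "x = cnj y" using ax(2) by blast
      have "cnj (cnj a * y) \<in> cnj ` I" by (intro imageI D(4) OF_cnj ax(1) y(1))
      thus ?thesis using y(2) by simp
    qed
    show "of_nat d * x \<in> OF" if x: "x \<in> cnj ` I" for x
    proof -
      obtain y where y: "y \<in> I" "x = cnj y" using x by blast
      have "cnj (of_nat d * y) \<in> OF" by (intro OF_cnj d y)
      thus ?thesis using y by simp
    qed
  qed (use z d in auto)
qed

lemma fi_imul: assumes "fi I" "fi J" shows "fi (imul I J)"
proof -
  note D = fiD[OF assms(1)] and E = fiD[OF assms(2)]
  obtain d :: nat where d: "d > 0" "\<And>x. x \<in> I \<Longrightarrow> of_nat d * x \<in> OF" using D(9) by blast
  obtain e :: nat where e: "e > 0" "\<And>x. x \<in> J \<Longrightarrow> of_nat e * x \<in> OF" using E(9) by blast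
  obtain z where z: "z \<in> I" "z \<noteq> 0" using D(8) by blast
  obtain w where w: "w \<in> J" "w \<noteq> 0" using E(8) by blast
  have 1: "imul I J \<subseteq> F"
    by (rule imul_subset) (auto intro: F_intros D(1) E(1))
  have 2: "imul I J \<subseteq> {x. of_nat (d * e) * x \<in> OF}"
  proof (rule imul_subset)
    fix x y assume "x \<in> I" "y \<in> J"
    hence "(of_nat d * x) * (of_nat e * y) \<in> OF" by (intro OF_mult d e)
    thus "x * y \<in> {x. of_nat (d * e) * x \<in> OF}" by (simp add: mult_ac)
  qed (auto simp: right_diff_distrib intro: zlat_diff)
  show ?thesis
  proof (rule fiI[of _ "z * w" "d * e"])
    show "z * w \<in> imul I J" using z w imul_mult by blast
    show "a * x \<in> imul I J" if "a \<in> OF" "x \<in> imul I J" for a x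
      using that E(4) by (intro imul_mult_left)
  qed (use 1 2 d e z w imul_closed in auto)
qed

lemma imul_OF: assumes "fi I" shows "imul OF I = I"
proof
  show "imul OF I \<subseteq> I" by (rule imul_subset) (auto intro: fiD[OF assms])
  show "I \<subseteq> imul OF I" using imul_mult[OF OF_1] by force
qed

text \<open>Dividing by a shortest vector turns an ideal into \<open>\<int> + \<int> \<beta>\<close> with \<open>\<beta>\<close> in the standard
  fundamental domain.\<close>

lemma fi_reduced_basis:
  assumes I: "fi I"
  obtains \<alpha> \<beta> where "\<alpha> \<in> I" "\<alpha> \<noteq> 0" "I = (*) \<alpha> ` zlat 1 \<beta>" "\<beta> \<in> F" "Im \<beta> > 0" "\<bar>Re \<beta>\<bar> \<le> 1 / 2" "cmod \<beta> \<ge> 1"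
proof -
  note D = fiD[OF I]
  obtain d :: nat where d: "d > 0" "\<And>x. x \<in> I \<Longrightarrow> of_nat d * x \<in> OF" using D(9) by blast
  have norm: "\<exists>k::nat. (real d * cmod x)\<^sup>2 = real k" if "x \<in> I" for x
    using OF_norm[OF d(2)[OF that]] by (simp add: norm_mult)
  \<comment> \<open>The integers \<open>d x\<close> have natural norms, so a shortest non-zero
    vector exists.\<close>
  define P where "P k \<longleftrightarrow> (\<exists>x\<in>I. x \<noteq> 0 \<and> (real d * cmod x)\<^sup>2 = real k)" for k
  have "\<exists>k. P k" using D(8) norm unfolding P_def by metis
  then obtain \<alpha> where al: "\<alpha> \<in> I" "\<alpha> \<noteq> 0" "(real d * cmod \<alpha>)\<^sup>2 = real (LEAST k. P k)"
    using LeastI_ex[of P] P_def by metis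
  have shortest: "cmod \<alpha> \<le> cmod x" if x: "x \<in> I" "x \<noteq> 0" for x
  proof -
    obtain k :: nat where k: "(real d * cmod x)\<^sup>2 = real k" using norm x by blast
    hence "(LEAST k. P k) \<le> k" using x by (intro Least_le) (auto simp: P_def)
    hence "(real d * cmod \<alpha>)\<^sup>2 \<le> (real d * cmod x)\<^sup>2" using k al(3) by linarith
    hence "real d * cmod \<alpha> \<le> real d * cmod x" by (rule power2_le_imp_le) simp
    thus ?thesis using d(1) by simp
  qed
  define J where "J = (*) (1 / \<alpha>) ` I"
  have alF: "\<alpha> \<in> F" using D(1) al(1) by blast
  have J: "fi J" unfolding J_def using al(2) alF by (intro fi_scale I F_divide F_1) auto
  note E = fiD[OF J]
  have J1: "1 \<in> J" unfolding J_def using al by (intro image_eqI[of _ _ \<alpha>]) auto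
  have long: "cmod x \<ge> 1" if x: "x \<in> J" "x \<noteq> 0" for x
  proof -
    obtain y where y: "y \<in> I" "x = y / \<alpha>" using x(1) unfolding J_def by auto
    hence "cmod \<alpha> \<le> cmod y" using shortest x(2) by auto
    thus ?thesis unfolding y(2) norm_divide using al(2) by (subst le_divide_eq_1_pos) auto
  qed
  have Jint: "of_int k \<in> J" for k using E(7)[OF J1, of k] by simp
  \<comment> \<open>Removing the integral part leaves an element of modulus below 1, which must
    vanish because the shortest vector of \<open>J\<close> has length 1.\<close>
  have real: "\<exists>k. x = of_int k" if x: "x \<in> J" "Im x = 0" for x
  proof -
    have "x - of_int \<lfloor>Re x\<rfloor> \<in> J" using E(6) x Jint by blast
    moreover have "x - of_int \<lfloor>Re x\<rfloor> = of_real (frac (Re x))" using x(2) by (simp add: complex_eq_iff frac_def)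
    moreover have "cmod (of_real (frac (Re x))) < 1" using frac_lt_1[of "Re x"] by simp
    ultimately have "x - of_int \<lfloor>Re x\<rfloor> = 0" using long by (metis not_le)
    thus ?thesis by (intro exI[of _ "\<lfloor>Re x\<rfloor>"]) simp
  qed
  obtain e :: nat where e: "e > 0" "\<And>x. x \<in> J \<Longrightarrow> of_nat e * x \<in> OF" using E(9) by blast
  have imJ: "\<exists>b::int. real e * Im x = of_int b * Im \<omega>" if x: "x \<in> J" for x
  proof -
    obtain a b where "of_nat e * x = of_int a + of_int b * \<omega>" using e(2)[OF x] by (auto simp: zlat_def)
    hence "Im (of_nat e * x) = Im (of_int a + of_int b * \<omega>)" by simp
    thus ?thesis by (intro exI[of _ b]) simp
  qed
  \<comment> \<open>Imaginary parts in \<open>J\<close> are integral multiples of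
    \<open>Im \<omega> / e\<close>, so a least positive one exists; \<omega> itself lies in
    \<open>J\<close> and shows that there is a candidate.\<close>
  define R where "R k \<longleftrightarrow> (\<exists>x\<in>J. k > 0 \<and> real e * Im x = real k * Im \<omega>)" for k :: nat
  have "\<omega> \<in> J" using E(4)[OF zlat_basis(2) J1] by simp
  hence "R e" using e(1) by (auto simp: R_def)
  define k0 where "k0 = (LEAST k. R k)"
  have "R k0" unfolding k0_def using \<open>R e\<close> by (rule LeastI)
  then obtain \<beta>0 where b0: "\<beta>0 \<in> J" "k0 > 0" "real e * Im \<beta>0 = real k0 * Im \<omega>"
    unfolding R_def by blast
  \<comment> \<open>Subtracting the nearest integer bounds the real part by 1/2 without leaving
    \<open>J\<close>. The bound \<open>cmod \<beta> \<ge> 1\<close> is minimality of \<alpha> once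
    more.\<close>
  define \<beta> where "\<beta> = \<beta>0 - of_int (round (Re \<beta>0))"
  have bJ: "\<beta> \<in> J" unfolding \<beta>_def by (intro E(6) b0(1) Jint)
  have be: "real e * Im \<beta> = real k0 * Im \<omega>" using b0(3) by (simp add: \<beta>_def)
  have "real e * Im \<beta> > 0" unfolding be using b0(2) Im_omega by simp
  hence bpos: "Im \<beta> > 0" using e(1) by (simp add: zero_less_mult_iff)
  have min: "Im \<beta> \<le> Im x" if x: "x \<in> J" "Im x > 0" for x
  proof -
    obtain b :: int where b: "real e * Im x = of_int b * Im \<omega>" using imJ x by blast
    have "real e * Im x > 0" using x e by simp
    hence "b > 0" unfolding b using Im_omega by (simp add: zero_less_mult_iff)
    hence "R (nat b)" unfolding R_def using b x by (intro bexI[of _ x]) auto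
    hence "k0 \<le> nat b" unfolding k0_def by (rule Least_le)
    hence "real k0 * Im \<omega> \<le> of_int b * Im \<omega>" using Im_omega \<open>b > 0\<close> by (intro mult_right_mono) linarith+
    hence "real e * Im \<beta> \<le> real e * Im x" using b be by simp
    thus ?thesis using e(1) by simp
  qed
  have JE: "J = zlat 1 \<beta>"
  proof
    show "zlat 1 \<beta> \<subseteq> J" by (rule zlat_subset) (auto intro: J1 bJ E(6))
    show "J \<subseteq> zlat 1 \<beta>"
    proof
      fix x assume x: "x \<in> J"
      define k where "k = \<lfloor>Im x / Im \<beta>\<rfloor>"
      define x' where "x' = x - of_int k * \<beta>"
      have x': "x' \<in> J" unfolding x'_def by (intro E(6,7) x bJ)
      have "k \<le> Im x / Im \<beta>" "Im x / Im \<beta> < k + 1" unfolding k_def by linarith+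
      hence "k * Im \<beta> \<le> Im x" "Im x < (k + 1) * Im \<beta>" using bpos by (simp_all add: field_simps)
      hence "0 \<le> Im x'" "Im x' < Im \<beta>" by (simp_all add: x'_def algebra_simps)
      hence "Im x' = 0" using min[OF x'] by linarith
      then obtain j where "x' = of_int j" using real[OF x'] by auto
      hence "x = of_int j + of_int k * \<beta>" by (simp add: x'_def algebra_simps)
      thus "x \<in> zlat 1 \<beta>" by (simp only: zlat_1I)
    qed
  qed
  show ?thesis
  proof (rule that[of \<alpha> \<beta>])
    have "I = (*) (1 / (1 / \<alpha>)) ` J" by (rule image_mult_inverse) (use al J_def in auto)
    thus "I = (*) \<alpha> ` zlat 1 \<beta>" by (simp add: JE)
    show "\<beta> \<in> F" using E(1) bJ by blast
    have "\<bar>of_int (round (Re \<beta>0)) - Re \<beta>0\<bar> \<le> 1 / 2" by (rule of_int_round_abs_le)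
    thus "\<bar>Re \<beta>\<bar> \<le> 1 / 2" by (simp add: \<beta>_def abs_minus_commute)
    show "cmod \<beta> \<ge> 1" using long[OF bJ] bpos by (cases "\<beta> = 0") auto
  qed (use al bpos in auto)
qed

text \<open>A multiplier \<open>r + s \<beta>\<close> of \<open>\<int> + \<int> \<beta>\<close> sends \<open>\<beta>\<close> into the lattice only if \<open>a\<close> divides \<open>s b\<close> and \<open>s c\<close>,
  hence \<open>s\<close>.\<close>

lemma primitive_quadratic:
  assumes J: "fi (zlat 1 \<beta>)" and pos: "Im \<beta> > 0"
  obtains a b c :: int where "a > 0" "gcd a (gcd b c) = 1" "of_int a * (\<beta> + cnj \<beta>) = of_int b"
    "of_int a * (\<beta> * cnj \<beta>) = of_int c" "OF = zlat 1 (of_int a * \<beta>)"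
proof -
  note D = fiD[OF J]
  have bF: "\<beta> \<in> F" using D(1) by simp
  have "\<beta> + cnj \<beta> \<in> F" "\<beta> * cnj \<beta> \<in> F" by (intro F_intros bF cnj_F)+
  moreover have "\<beta> + cnj \<beta> \<in> \<real>" "\<beta> * cnj \<beta> \<in> \<real>" by (auto simp: complex_is_Real_iff)
  ultimately obtain T N where TN: "\<beta> + cnj \<beta> = of_rat T" "\<beta> * cnj \<beta> = of_rat N" using F_real by meson
  obtain T1 T2 where T: "T = of_int T1 / of_int T2" "T2 > 0"
    by (metis quotient_of_div quotient_of_denom_pos surj_pair)
  obtain N1 N2 where N: "N = of_int N1 / of_int N2" "N2 > 0"
    by (metis quotient_of_div quotient_of_denom_pos surj_pair)
  \<comment> \<open>Dividing by the content makes \<open>a X^2 - b X + c\<close> the primitive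
    integral polynomial with root \<beta>.\<close>
  define g where "g = gcd (T2 * N2) (gcd (T1 * N2) (N1 * T2))"
  have g: "g > 0" using T N by (simp add: g_def)
  obtain a where a: "T2 * N2 = g * a" unfolding g_def by (meson dvdE gcd_dvd1)
  obtain b where b: "T1 * N2 = g * b" unfolding g_def by (meson dvdE dvd_trans gcd_dvd1 gcd_dvd2)
  obtain c where c: "N1 * T2 = g * c" unfolding g_def by (meson dvdE dvd_trans gcd_dvd2)
  have "gcd (T2 * N2) (gcd (T1 * N2) (N1 * T2)) = g" by (simp add: g_def)
  hence "gcd (g * a) (gcd (g * b) (g * c)) = g" unfolding a b c .
  moreover have "gcd (g * b) (g * c) = g * gcd b c" using g gcd_mult_distrib_int[of g b c] by simp
  moreover have "gcd (g * a) (g * gcd b c) = g * gcd a (gcd b c)"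
    using g gcd_mult_distrib_int[of g a "gcd b c"] by simp
  ultimately have gcd: "gcd a (gcd b c) = 1" using g by simp
  have apos: "a > 0" using a g T N by (metis zero_less_mult_pos mult_pos_pos)
  have e: "of_rat T * (of_int T2 :: complex) = of_int T1" "of_rat N * (of_int N2 :: complex) = of_int N1"
    using T N by (simp_all add: of_rat_divide)
  have "of_int g * (of_int a * (\<beta> + cnj \<beta>)) = of_int (g * a) * of_rat T" by (simp add: TN)
  also have "\<dots> = (of_rat T * of_int T2) * of_int N2" by (simp add: a[symmetric])
  also have "\<dots> = of_int (g * b)" unfolding e by (simp add: b[symmetric])
  finally have tr: "of_int a * (\<beta> + cnj \<beta>) = of_int b" using g by simp
  have "of_int g * (of_int a * (\<beta> * cnj \<beta>)) = of_int (g * a) * of_rat N" by (simp add: TN)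
  also have "\<dots> = (of_rat N * of_int N2) * of_int T2" by (simp add: a[symmetric])
  also have "\<dots> = of_int (g * c)" unfolding e by (simp add: c[symmetric])
  finally have nm: "of_int a * (\<beta> * cnj \<beta>) = of_int c" using g by simp
  have q: "of_int a * \<beta>\<^sup>2 = of_int b * \<beta> - of_int c"
  proof -
    have "of_int a * \<beta>\<^sup>2 = of_int a * (\<beta> + cnj \<beta>) * \<beta> - of_int a * (\<beta> * cnj \<beta>)"
      by (simp add: algebra_simps power2_eq_square)
    thus ?thesis unfolding tr nm .
  qed
  have area: "area 1 \<beta> \<noteq> 0" using pos by (simp add: area_alt)
  have "OF = zlat 1 (of_int a * \<beta>)"
  proof
    have "(of_int a * \<beta>)\<^sup>2 - of_int b * (of_int a * \<beta>) + of_int (a * c)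
        = of_int a * (of_int a * \<beta>\<^sup>2 - of_int b * \<beta> + of_int c)"
      by (simp add: algebra_simps power2_eq_square)
    hence "(of_int a * \<beta>)\<^sup>2 - of_int b * (of_int a * \<beta>) + of_int (a * c) = 0" unfolding q by simp
    hence "algebraic_int (of_int a * \<beta>)" by (rule algebraic_int_quadratic)
    hence "of_int a * \<beta> \<in> OF" using OF_iff bF F_mult F_of_int by blast
    thus "zlat 1 (of_int a * \<beta>) \<subseteq> OF" by (intro zlat_subset) (auto intro: zlat_diff)
    show "OF \<subseteq> zlat 1 (of_int a * \<beta>)"
    proof
      fix x assume x: "x \<in> OF"
      have "x * 1 \<in> zlat 1 \<beta>" by (rule D(4)[OF x]) simp
      then obtain r s where rs: "x = of_int r + of_int s * \<beta>" by (auto simp: zlat_def)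
      have "x * \<beta> - of_int r * \<beta> \<in> zlat 1 \<beta>" by (intro D(6) D(4)[OF x] zlat_int_mult) simp_all
      then obtain u v where uv: "x * \<beta> - of_int r * \<beta> = of_int u + of_int v * \<beta>" by (auto simp: zlat_def)
      have "of_int (a * u) * 1 + of_int (a * v) * \<beta> = of_int a * (x * \<beta> - of_int r * \<beta>)"
        unfolding uv by (simp add: algebra_simps)
      also have "\<dots> = of_int s * (of_int a * \<beta>\<^sup>2)" by (simp add: rs algebra_simps power2_eq_square)
      also have "\<dots> = of_int (- s * c) * 1 + of_int (s * b) * \<beta>" unfolding q by (simp add: algebra_simps)
      finally have "a * u = - s * c \<and> a * v = s * b" by (rule zlat_coeffs_unique[OF area])
      hence "s * b = a * v" "s * c = a * (- u)" by auto
      hence "a dvd s * b" "a dvd s * c" using dvd_triv_left by metis+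
      hence "a dvd gcd (s * b) (s * c)" by simp
      also have "gcd (s * b) (s * c) = \<bar>s\<bar> * gcd b c" using gcd_mult_distrib_int[of s b c] by simp
      finally have "a dvd \<bar>s\<bar> * gcd b c" .
      moreover have "coprime a (gcd b c)" using gcd by (simp add: coprime_iff_gcd_eq_1)
      ultimately have "a dvd s" by (simp add: coprime_dvd_mult_left_iff)
      then obtain w where "s = a * w" by blast
      hence "x = of_int r + of_int w * (of_int a * \<beta>)" using rs by simp
      thus "x \<in> zlat 1 (of_int a * \<beta>)" by (simp only: zlat_1I)
    qed
  qed
  thus ?thesis by (rule that[OF apos gcd tr nm])
qed

text \<open>The product is spanned by 1, \<beta>, its conjugate and their product. Multiplied by
  \<open>a\<close> these become integers, and a Bezout combination of \<open>a\<close>,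
  \<open>b\<close>, \<open>c\<close> shows that \<open>1 / a\<close> is attained. Thus the lattice
  has ideal norm \<open>1 / a\<close>.\<close>

lemma imul_cnj_lattice:
  assumes J: "fi (zlat 1 \<beta>)" and abc: "a > 0" "gcd a (gcd b c) = 1" "of_int a * (\<beta> + cnj \<beta>) = of_int b"
    "of_int a * (\<beta> * cnj \<beta>) = of_int c" "OF = zlat 1 (of_int a * \<beta>)"
  shows "imul (zlat 1 \<beta>) (cnj ` zlat 1 \<beta>) = (*) (1 / of_int a) ` OF"
proof
  let ?J = "zlat 1 \<beta>"
  have a0: "(of_int a :: complex) \<noteq> 0" using abc(1) by simp
  have ab: "of_int a * \<beta> \<in> OF" using abc(5) by simp
  have ab': "of_int a * cnj \<beta> \<in> OF" using OF_cnj[OF ab] by simp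
  have "imul ?J (cnj ` ?J) \<subseteq> {x. of_int a * x \<in> OF}"
  proof (rule imul_subset)
    fix x y assume "x \<in> ?J" "y \<in> cnj ` ?J"
    then obtain p q r s where "x = of_int p + of_int q * \<beta>" "y = of_int r + of_int s * cnj \<beta>"
      by (auto simp: zlat_def)
    hence "of_int a * (x * y) = of_int (a * p * r) + of_int (q * r) * (of_int a * \<beta>)
        + of_int (p * s) * (of_int a * cnj \<beta>) + of_int (q * s) * (of_int a * (\<beta> * cnj \<beta>))"
      by (simp add: algebra_simps)
    also have "\<dots> = of_int (a * p * r) + of_int (q * r) * (of_int a * \<beta>)
        + of_int (p * s) * (of_int a * cnj \<beta>) + of_int (q * s) * of_int c" unfolding abc(4) ..
    also have "\<dots> \<in> OF" by (intro zlat_add OF_of_int zlat_int_mult ab ab')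
    finally show "x * y \<in> {x. of_int a * x \<in> OF}" by simp
  qed (auto simp: right_diff_distrib intro: zlat_diff)
  thus "imul ?J (cnj ` ?J) \<subseteq> (*) (1 / of_int a) ` OF" using a0 by (force intro: image_eqI[of _ _ "of_int a * _"])
  let ?K = "imul ?J (cnj ` ?J)"
  have 1: "1 * cnj 1 \<in> ?K" "\<beta> * cnj 1 \<in> ?K" "1 * cnj \<beta> \<in> ?K" "\<beta> * cnj \<beta> \<in> ?K"
    by (intro imul_mult imageI zlat_basis)+
  hence "\<beta> + cnj \<beta> \<in> ?K" using imul_closed(2) by fastforce
  obtain x y z :: int where xyz: "x * a + y * b + z * c = 1"
  proof -
    obtain u v where uv: "u * a + v * gcd b c = 1" using bezout_int[of a "gcd b c"] abc(2) by auto
    obtain r s where rs: "r * b + s * c = gcd b c" using bezout_int[of b c] by auto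
    have "u * a + v * (r * b + s * c) = 1" unfolding rs by (rule uv)
    hence "u * a + (v * r) * b + (v * s) * c = 1" by (simp add: algebra_simps)
    thus ?thesis using that by blast
  qed
  have "of_int x * 1 + of_int y * (\<beta> + cnj \<beta>) + of_int z * (\<beta> * cnj \<beta>) \<in> ?K"
    using 1 \<open>\<beta> + cnj \<beta> \<in> ?K\<close> by (intro imul_closed(2) imul_closed(4)) auto
  also have "of_int x * 1 + of_int y * (\<beta> + cnj \<beta>) + of_int z * (\<beta> * cnj \<beta>) = 1 / of_int a"
  proof -
    have "of_int a * (of_int x * 1 + of_int y * (\<beta> + cnj \<beta>) + of_int z * (\<beta> * cnj \<beta>))
      = of_int (x * a) + of_int y * (of_int a * (\<beta> + cnj \<beta>)) + of_int z * (of_int a * (\<beta> * cnj \<beta>))"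
      by (simp add: algebra_simps)
    also have "\<dots> = of_int (x * a + y * b + z * c)" unfolding abc(3,4) by simp
    also have "\<dots> = 1" unfolding xyz by simp
    finally show ?thesis using a0 by (simp add: field_simps)
  qed
  finally have "1 / of_int a \<in> ?K" .
  moreover have "fi ?K" using J by (intro fi_imul fi_cnj)
  ultimately show "(*) (1 / of_int a) ` OF \<subseteq> ?K" using fiD(4) by (auto simp: mult.commute) fastforce
qed

text \<open>Here \<open>r\<close> is the norm of \<open>I\<close>: the primitive form gives
  \<open>1 / a\<close> for the reduced lattice, and scaling by \<alpha> contributes its norm.
  Inverses of ideals come from this.\<close>

lemma imul_cnj:
  assumes "fi I"
  obtains r :: rat where "r > 0" "imul I (cnj ` I) = (*) (of_rat r) ` OF"
proof -
  obtain \<alpha> \<beta> where b: "\<alpha> \<in> I" "\<alpha> \<noteq> 0" "I = (*) \<alpha> ` zlat 1 \<beta>" "Im \<beta> > 0"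
    using fi_reduced_basis[OF assms] by metis
  have aF: "\<alpha> \<in> F" using fiD(1)[OF assms] b(1) .
  have "zlat 1 \<beta> = (*) (1 / \<alpha>) ` I" by (rule image_mult_inverse[OF b(2,3)])
  hence J: "fi (zlat 1 \<beta>)" using fi_scale[OF assms, of "1 / \<alpha>"] aF b(2) by (simp add: F_intros)
  obtain a b' c where abc: "a > 0" "gcd a (gcd b' c) = 1" "of_int a * (\<beta> + cnj \<beta>) = of_int b'"
    "of_int a * (\<beta> * cnj \<beta>) = of_int c" "OF = zlat 1 (of_int a * \<beta>)"
    using primitive_quadratic[OF J b(4)] by metis
  have "\<alpha> * cnj \<alpha> \<in> F" "\<alpha> * cnj \<alpha> \<in> \<real>" by (auto intro!: F_intros aF cnj_F simp: complex_is_Real_iff)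
  then obtain s where s: "\<alpha> * cnj \<alpha> = of_rat s" using F_real by blast
  have "(of_rat s :: complex) = of_real ((cmod \<alpha>)\<^sup>2)" using s complex_norm_square by metis
  hence "real_of_rat s = (cmod \<alpha>)\<^sup>2" by (metis of_real_eq_iff of_real_of_rat)
  hence "s > 0" using b(2) by (metis zero_less_norm_iff zero_less_power zero_less_of_rat_iff)
  have "cnj ` I = (*) (cnj \<alpha>) ` cnj ` zlat 1 \<beta>" unfolding b(3) by (auto simp: image_image)
  hence "imul I (cnj ` I) = (*) \<alpha> ` (*) (cnj \<alpha>) ` imul (zlat 1 \<beta>) (cnj ` zlat 1 \<beta>)"
    by (subst b(3)) (simp only: imul_scale imul_scale_right image_mult_mult mult.commute[of "cnj \<alpha>" \<alpha>])
  also have "\<dots> = (*) (\<alpha> * cnj \<alpha> * (1 / of_int a)) ` OF"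
    unfolding imul_cnj_lattice[OF J abc] image_mult_mult by (simp add: mult.assoc)
  also have "\<alpha> * cnj \<alpha> * (1 / of_int a) = of_rat (s / of_int a)" unfolding s by (simp add: of_rat_divide)
  finally show ?thesis using that[of "s / of_int a"] \<open>s > 0\<close> abc(1) by simp
qed

end

section \<open>Finite groups of exponent two\<close>

text \<open>The new coordinate is sent to the powers of \<open>g\<close>, which is a homomorphism
  because \<open>g\<close> squares to one. An element of the kernel with last coordinate 1 would put
  \<open>g\<close>, its own inverse, into the old image.\<close>

lemma elementary_2_hom_extend:
  fixes G (structure)
  assumes "comm_group G" and sq: "\<And>x. x \<in> carrier G \<Longrightarrow> x \<otimes> x = \<one>"
    and h: "h \<in> hom (product_group {..<e} (\<lambda>_. integer_mod_group 2)) G"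
    and inj: "inj_on h (carrier (product_group {..<e} (\<lambda>_. integer_mod_group 2)))"
    and g: "g \<in> carrier G" "g \<notin> h ` carrier (product_group {..<e} (\<lambda>_. integer_mod_group 2))"
  defines "h' \<equiv> \<lambda>f. h (restrict f {..<e}) \<otimes> (if f e = 1 then g else \<one>)"
  shows "h' \<in> hom (product_group {..<Suc e} (\<lambda>_. integer_mod_group 2)) G"
    and "inj_on h' (carrier (product_group {..<Suc e} (\<lambda>_. integer_mod_group 2)))"
proof -
  interpret G: comm_group G by fact
  let ?P = "\<lambda>e. product_group {..<e::nat} (\<lambda>_. integer_mod_group 2)"
  have Pg: "group (?P e)" for e by simp
  have C2: "carrier (integer_mod_group 2) = {0, 1}"
    by (auto simp: carrier_integer_mod_group)
  have restr: "restrict f {..<e} \<in> carrier (?P e)" and fe: "f e = 0 \<or> f e = 1"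
    if "f \<in> carrier (?P (Suc e))" for f
    using that by (auto simp: C2 PiE_iff)
  have hc: "h f \<in> carrier G" if "f \<in> carrier (?P e)" for f using h that by (rule hom_in_carrier)
  have hm: "h (x \<otimes>\<^bsub>?P e\<^esub> y) = h x \<otimes> h y" if "x \<in> carrier (?P e)" "y \<in> carrier (?P e)" for x y
    using h that by (rule hom_mult)
  have restr_mult: "restrict (x \<otimes>\<^bsub>?P (Suc e)\<^esub> y) {..<e} = restrict x {..<e} \<otimes>\<^bsub>?P e\<^esub> restrict y {..<e}" for x y
    by (auto simp: fun_eq_iff)
  show hom': "h' \<in> hom (?P (Suc e)) G"
  proof (rule homI)
    fix x assume x: "x \<in> carrier (?P (Suc e))"
    show "h' x \<in> carrier G" unfolding h'_def using hc[OF restr[OF x]] g(1) by auto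
  next
    fix x y assume x: "x \<in> carrier (?P (Suc e))" and y: "y \<in> carrier (?P (Suc e))"
    have a: "h (restrict x {..<e}) \<in> carrier G" "h (restrict y {..<e}) \<in> carrier G"
      using hc restr x y by blast+
    have "(x \<otimes>\<^bsub>?P (Suc e)\<^esub> y) e = (x e + y e) mod 2" by simp
    moreover have "h (restrict (x \<otimes>\<^bsub>?P (Suc e)\<^esub> y) {..<e}) = h (restrict x {..<e}) \<otimes> h (restrict y {..<e})"
      unfolding restr_mult by (rule hm) (use restr x y in blast)+
    moreover have "(h (restrict x {..<e}) \<otimes> g) \<otimes> (h (restrict y {..<e}) \<otimes> g)
        = (h (restrict x {..<e}) \<otimes> h (restrict y {..<e})) \<otimes> (g \<otimes> g)"
      using a g(1) by (simp add: G.m_ac)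
    ultimately show "h' (x \<otimes>\<^bsub>?P (Suc e)\<^esub> y) = h' x \<otimes> h' y"
      unfolding h'_def using fe[OF x] fe[OF y] a g(1) sq[OF g(1)]
      by (elim disjE) (simp_all add: G.m_ac del: mult_product_group)
  qed
  have "group_hom (?P (Suc e)) G h'" using Pg hom' G.is_group by (simp add: group_hom_def group_hom_axioms_def)
  moreover have "\<forall>x\<in>carrier (?P (Suc e)). h' x = \<one> \<longrightarrow> x = \<one>\<^bsub>?P (Suc e)\<^esub>"
  proof (intro ballI impI)
    fix x assume x: "x \<in> carrier (?P (Suc e))" and 1: "h' x = \<one>"
    have c: "h (restrict x {..<e}) \<in> carrier G" using hc restr x by blast
    have xe: "x e = 0"
    proof (rule ccontr)
      assume "x e \<noteq> 0"
      hence "h (restrict x {..<e}) \<otimes> g = \<one>" using 1 fe[OF x] by (simp add: h'_def)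
      hence "h (restrict x {..<e}) = g" using sq[OF g(1)] c g(1) by (metis G.right_cancel)
      thus False using g(2) restr[OF x] by (metis imageI)
    qed
    hence "h (restrict x {..<e}) = \<one>" using 1 c by (simp add: h'_def)
    also have "\<one> = h (\<one>\<^bsub>?P e\<^esub>)" using h Pg G.is_group by (metis hom_one)
    finally have "restrict x {..<e} = \<one>\<^bsub>?P e\<^esub>"
      using inj restr[OF x] Pg[of e] by (meson group.is_monoid inj_onD monoid.one_closed)
    hence "x i = 0" if "i < e" for i using that by (auto simp: fun_eq_iff split: if_splits)
    hence "x i = 0" if "i < Suc e" for i using that xe less_SucE by blast
    thus "x = \<one>\<^bsub>?P (Suc e)\<^esub>" using x by (auto simp: fun_eq_iff PiE_iff extensional_def)
  qed
  ultimately show "inj_on h' (carrier (?P (Suc e)))" using group_hom.inj_on_one_iff by blast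
qed

text \<open>Injections from powers of the two-element group exist only for bounded exponents,
  because \<open>2 ^ e\<close> cannot exceed the order of \<open>G\<close>. One with the largest
  exponent is onto, since otherwise it could be extended.\<close>

theorem finite_exponent_2_iso:
  fixes G (structure)
  assumes "comm_group G" and fin: "finite (carrier G)" and sq: "\<And>x. x \<in> carrier G \<Longrightarrow> x \<otimes> x = \<one>"
  shows "\<exists>e. G \<cong> product_group {..<e::nat} (\<lambda>_. integer_mod_group 2)"
proof -
  interpret G: comm_group G by fact
  let ?P = "\<lambda>e. product_group {..<e::nat} (\<lambda>_. integer_mod_group 2)"
  define Q where "Q e \<longleftrightarrow> (\<exists>h \<in> hom (?P e) G. inj_on h (carrier (?P e)))" for e
  have C2: "carrier (integer_mod_group 2) = {0, 1}"
    by (auto simp: carrier_integer_mod_group)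
  have "Q 0" unfolding Q_def
    by (rule bexI[of _ "\<lambda>_. \<one>"]) (auto simp: hom_def)
  moreover have bound: "e \<le> card (carrier G)" if Q: "Q e" for e
  proof -
    obtain h where h: "h \<in> hom (?P e) G" "inj_on h (carrier (?P e))" using Q unfolding Q_def by blast
    have "card (carrier (?P e)) \<le> card (carrier G)"
      using h fin by (intro card_inj_on_le[of h]) (auto simp: hom_def)
    moreover have "card (carrier (?P e)) = 2 ^ e"
      unfolding carrier_product_group C2 by (simp add: card_PiE numeral_2_eq_2)
    ultimately show ?thesis using less_exp[of e] by linarith
  qed
  ultimately obtain e where e: "Q e" "\<And>e'. Q e' \<Longrightarrow> e' \<le> e"
    using GreatestI_nat[of Q 0 "card (carrier G)"] Greatest_le_nat[of Q _ "card (carrier G)"] by metis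
  obtain h where h: "h \<in> hom (?P e) G" "inj_on h (carrier (?P e))" using e(1) Q_def by blast
  have "h ` carrier (?P e) = carrier G"
  proof (rule ccontr)
    assume "h ` carrier (?P e) \<noteq> carrier G"
    moreover have "h ` carrier (?P e) \<subseteq> carrier G" using h(1) by (auto simp: hom_def)
    ultimately obtain g where g: "g \<in> carrier G" "g \<notin> h ` carrier (?P e)" by blast
    have "Q (Suc e)"
      unfolding Q_def using elementary_2_hom_extend[OF assms(1) sq h g] by blast
    thus False using e(2) by fastforce
  qed
  hence "h \<in> iso (?P e) G" using h by (simp add: iso_def bij_betw_def)
  hence "?P e \<cong> G" by (rule is_isoI)
  moreover have "group (?P e)" by simp
  ultimately have "G \<cong> ?P e" by (metis group.iso_sym)
  thus ?thesis by blast
qed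

lemma iso_elementary_2_square:
  fixes G (structure)
  assumes "group G" "G \<cong> product_group I (\<lambda>_. integer_mod_group 2)" "x \<in> carrier G"
  shows "x \<otimes> x = \<one>"
proof -
  interpret G: group G by fact
  let ?P = "product_group I (\<lambda>_. integer_mod_group 2)"
  obtain h where h: "h \<in> iso G ?P" using assms(2) by (auto simp: is_iso_def)
  hence hom: "h \<in> hom G ?P" and inj: "inj_on h (carrier G)" by (auto simp: iso_def bij_betw_def)
  have hx: "h x \<in> carrier ?P" using hom assms(3) by (rule hom_in_carrier)
  have "h (x \<otimes> x) = h x \<otimes>\<^bsub>?P\<^esub> h x" using hom assms(3) by (simp add: hom_mult)
  also have "\<dots> = \<one>\<^bsub>?P\<^esub>"
    using hx by (auto simp: fun_eq_iff carrier_integer_mod_group PiE_iff)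
  also have "\<dots> = h \<one>" using hom assms(1) by (metis hom_one group_integer_mod_group product_group)
  finally show ?thesis using inj assms(3) by (meson G.m_closed G.one_closed inj_onD)
qed

section \<open>The class group\<close>

context imag_quad begin

lemma ideal_group_simps [simp]:
  "carrier (ideal_group F) = {I. fi I}" "I \<otimes>\<^bsub>ideal_group F\<^esub> J = imul I J" "\<one>\<^bsub>ideal_group F\<^esub> = OF"
  by (simp_all add: ideal_group_def imul_def O_eq)

lemma principal_ideals_eq: "principal_ideals F = {(*) a ` OF | a. a \<in> F \<and> a \<noteq> 0}"
  by (simp add: principal_ideals_def O_eq)

text \<open>The inverse of \<open>I\<close> is its conjugate divided by its norm.\<close>

lemma ideal_comm_group: "comm_group (ideal_group F)"
proof (rule comm_groupI; simp)
  show "fi (imul I J)" if "fi I" "fi J" for I J by (rule fi_imul[OF that])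
  show "fi OF" by (rule fi_OF)
  show "imul (imul I J) K = imul I (imul J K)" for I J K by (rule imul_assoc)
  show "imul I J = imul J I" for I J by (rule imul_commute)
  show "imul OF I = I" if "fi I" for I by (rule imul_OF[OF that])
  show "\<exists>J. fi J \<and> imul J I = OF" if I: "fi I" for I
  proof -
    obtain r where r: "r > 0" "imul I (cnj ` I) = (*) (of_rat r) ` OF" using imul_cnj[OF I] by metis
    have "imul ((*) (1 / of_rat r) ` cnj ` I) I = OF"
      unfolding imul_scale using r image_mult_mult[of "1 / of_rat r" "of_rat r" OF] by (simp add: imul_commute)
    moreover have "fi ((*) (1 / of_rat r) ` cnj ` I)"
      using r(1) by (intro fi_scale fi_cnj I F_intros) auto
    ultimately show ?thesis by blast
  qed
qed

lemma imul_principal: "imul ((*) a ` OF) ((*) b ` OF) = (*) (a * b) ` OF"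
  unfolding imul_scale imul_scale_right image_mult_mult imul_OF[OF fi_OF] by (simp only: mult.commute)

lemma principal_ideals_subgroup: "subgroup (principal_ideals F) (ideal_group F)"
proof -
  interpret comm_group "ideal_group F" by (rule ideal_comm_group)
  show ?thesis
  proof (rule subgroupI)
    show "principal_ideals F \<subseteq> carrier (ideal_group F)"
      using fi_scale[OF fi_OF] by (auto simp: principal_ideals_eq)
    show "principal_ideals F \<noteq> {}" using F_1 by (auto simp: principal_ideals_eq)
    show "inv\<^bsub>ideal_group F\<^esub> I \<in> principal_ideals F" if I: "I \<in> principal_ideals F" for I
    proof -
      obtain a where a: "I = (*) a ` OF" "a \<in> F" "a \<noteq> 0" using I by (auto simp: principal_ideals_eq)
      have "imul ((*) (1 / a) ` OF) I = OF" unfolding a(1) imul_principal using a(3) by simp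
      moreover have "fi I" unfolding a(1) by (intro fi_scale fi_OF a)
      moreover have "fi ((*) (1 / a) ` OF)" by (intro fi_scale fi_OF F_intros) (use a in auto)
      ultimately have "inv\<^bsub>ideal_group F\<^esub> I = (*) (1 / a) ` OF" by (intro inv_equality) auto
      moreover have "1 / a \<in> F" "1 / a \<noteq> 0" using a by (auto intro: F_intros)
      ultimately show ?thesis unfolding principal_ideals_eq by blast
    qed
    show "I \<otimes>\<^bsub>ideal_group F\<^esub> J \<in> principal_ideals F" if "I \<in> principal_ideals F" "J \<in> principal_ideals F" for I J
      using that imul_principal unfolding principal_ideals_eq ideal_group_simps
      by (auto, metis F_mult mult_eq_0_iff)
  qed
qed

lemma class_comm_group: "comm_group (class_group F)"
proof -
  interpret comm_group "ideal_group F" by (rule ideal_comm_group)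
  show ?thesis unfolding class_group_def by (rule abelian_FactGroup[OF principal_ideals_subgroup])
qed

abbreviation icl :: "complex set \<Rightarrow> complex set set" where
  "icl I \<equiv> principal_ideals F #>\<^bsub>ideal_group F\<^esub> I"

lemma class_carrier: "carrier (class_group F) = icl ` {I. fi I}"
  by (simp add: class_group_def carrier_FactGroup)

lemma class_mult: "fi I \<Longrightarrow> fi J \<Longrightarrow> icl I \<otimes>\<^bsub>class_group F\<^esub> icl J = icl (imul I J)"
proof -
  interpret comm_group "ideal_group F" by (rule ideal_comm_group)
  interpret normal "principal_ideals F" "ideal_group F"
    using principal_ideals_subgroup normal_iff_subgroup by blast
  show "fi I \<Longrightarrow> fi J \<Longrightarrow> icl I \<otimes>\<^bsub>class_group F\<^esub> icl J = icl (imul I J)"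
    using rcos_sum[of I J] by (simp add: class_group_def)
qed

lemma class_one: "\<one>\<^bsub>class_group F\<^esub> = principal_ideals F"
  by (simp add: class_group_def)

lemma icl_eq_one_iff: "fi I \<Longrightarrow> icl I = principal_ideals F \<longleftrightarrow> I \<in> principal_ideals F"
proof -
  interpret comm_group "ideal_group F" by (rule ideal_comm_group)
  show "fi I \<Longrightarrow> icl I = principal_ideals F \<longleftrightarrow> I \<in> principal_ideals F"
    using coset_join1[of "principal_ideals F" I] coset_join2[of I "principal_ideals F"] principal_ideals_subgroup by auto
qed

lemma icl_scale:
  assumes "fi I" "c \<in> F" "c \<noteq> 0" shows "icl ((*) c ` I) = icl I"
proof -
  interpret comm_group "ideal_group F" by (rule ideal_comm_group)
  have "(*) c ` I = imul ((*) c ` OF) I" unfolding imul_scale imul_OF[OF assms(1)] ..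
  also have "\<dots> \<in> icl I" unfolding r_coset_def principal_ideals_eq using assms by auto
  finally show ?thesis using repr_independence principal_ideals_subgroup assms(1) by (metis ideal_group_simps(1) mem_Collect_eq)
qed

text \<open>Reduction theory: each class contains some \<open>zlat 1 \<beta>\<close> with \<beta> in
  the fundamental domain. Comparing areas gives \<open>Im \<beta> = Im \<omega> / a\<close>, and the
  trace gives \<open>Re \<beta> = b / (2 a)\<close>. The crude bound
  \<open>Im \<beta> \<ge> 1 / 2\<close> limits \<open>a\<close> by \<open>2 Im \<omega>\<close>, and
  then \<open>\<bar>b\<bar> \<le> a\<close>.\<close>

lemma finite_class_group: "finite (carrier (class_group F))"
proof -
  define A where "A = \<lceil>2 * Im \<omega>\<rceil>"
  define Bset where "Bset = (\<lambda>(a::int, b::int). Complex (of_int b / (2 * of_int a)) (Im \<omega> / of_int a)) ` ({1..A} \<times> {-A..A})"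
  have fin: "finite Bset" unfolding Bset_def by (intro finite_imageI finite_cartesian_product) auto
  have "carrier (class_group F) \<subseteq> (\<lambda>\<beta>. icl (zlat 1 \<beta>)) ` Bset"
  proof
    fix X assume "X \<in> carrier (class_group F)"
    then obtain I where I: "fi I" "X = icl I" using class_carrier by auto
    obtain \<alpha> \<beta> where b: "\<alpha> \<in> I" "\<alpha> \<noteq> 0" "I = (*) \<alpha> ` zlat 1 \<beta>" "\<beta> \<in> F" "Im \<beta> > 0" "\<bar>Re \<beta>\<bar> \<le> 1 / 2" "cmod \<beta> \<ge> 1"
      using fi_reduced_basis[OF I(1)] by metis
    have aF: "\<alpha> \<in> F" using fiD(1)[OF I(1)] b(1) .
    have "zlat 1 \<beta> = (*) (1 / \<alpha>) ` I" by (rule image_mult_inverse[OF b(2,3)])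
    hence J: "fi (zlat 1 \<beta>)" using fi_scale[OF I(1), of "1 / \<alpha>"] aF b(2) by (simp add: F_intros)
    have X: "X = icl (zlat 1 \<beta>)" unfolding I(2) b(3) by (rule icl_scale[OF J aF b(2)])
    obtain a b' c where abc: "a > 0" "gcd a (gcd b' c) = 1" "of_int a * (\<beta> + cnj \<beta>) = of_int b'"
      "of_int a * (\<beta> * cnj \<beta>) = of_int c" "OF = zlat 1 (of_int a * \<beta>)"
      using primitive_quadratic[OF J b(5)] by metis
    have "\<bar>area 1 \<omega>\<bar> = \<bar>area 1 (of_int a * \<beta>)\<bar>" by (rule zlat_area_unique[OF abc(5)])
    hence im: "Im \<omega> = of_int a * Im \<beta>" using Im_omega abc(1) b(5) by (simp add: area_alt)
    have "Re (of_int a * (\<beta> + cnj \<beta>)) = Re (of_int b')" unfolding abc(3) ..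
    hence re: "of_int b' = 2 * of_int a * Re \<beta>" by simp
    have "1 \<le> (cmod \<beta>)\<^sup>2" using b(7) by simp
    hence "1 \<le> (Re \<beta>)\<^sup>2 + (Im \<beta>)\<^sup>2" by (simp only: cmod_power2)
    moreover have "(Re \<beta>)\<^sup>2 \<le> (1 / 2)\<^sup>2" using b(6) by (simp add: abs_le_square_iff[symmetric])
    ultimately have "(1 / 2)\<^sup>2 \<le> (Im \<beta>)\<^sup>2" by (simp add: power2_eq_square)
    hence "1 / 2 \<le> Im \<beta>" by (rule power2_le_imp_le) (use b(5) in simp)
    hence "of_int a * (1 / 2) \<le> Im \<omega>" unfolding im using abc(1) by (intro mult_left_mono) auto
    hence a: "a \<le> A" unfolding A_def by linarith
    have "\<bar>of_int b'\<bar> \<le> 2 * real_of_int a * (1 / 2)"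
      unfolding re abs_mult using b(6) abc(1) by (intro mult_mono) auto
    hence "\<bar>b'\<bar> \<le> A" using a by linarith
    hence "(a, b') \<in> {1..A} \<times> {-A..A}" using abc(1) a by auto
    moreover have "\<beta> = Complex (of_int b' / (2 * of_int a)) (Im \<omega> / of_int a)"
      using abc(1) by (simp add: complex_eq_iff re im)
    ultimately have "\<beta> \<in> Bset" unfolding Bset_def by (intro image_eqI[of _ _ "(a, b')"]) auto
    thus "X \<in> (\<lambda>\<beta>. icl (zlat 1 \<beta>)) ` Bset" using X by blast
  qed
  thus ?thesis using fin finite_surj by blast
qed

text \<open>Since \<open>imul I (cnj I)\<close> is generated by a rational number, conjugation
  inverts ideal classes. A class is its own inverse exactly when it contains the conjugate of its
  members.\<close>

lemma imul_self_principal_iff: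
  assumes I: "fi I"
  shows "imul I I \<in> principal_ideals F \<longleftrightarrow> (\<exists>w\<in>F. w \<noteq> 0 \<and> cnj ` I = (*) w ` I)"
proof -
  obtain r where r: "r > 0" "imul I (cnj ` I) = (*) (of_rat r) ` OF" using imul_cnj[OF I] by metis
  have rF: "of_rat r \<in> F" "of_rat r \<noteq> (0 :: complex)" using r(1) by (auto intro: F_intros)
  show ?thesis
  proof
    assume "imul I I \<in> principal_ideals F"
    then obtain c where c: "c \<in> F" "c \<noteq> 0" "imul I I = (*) c ` OF" unfolding principal_ideals_eq by blast
    have "(*) c ` cnj ` I = imul (imul I I) (cnj ` I)"
      unfolding c(3) imul_scale imul_OF[OF fi_cnj[OF I]] ..
    also have "\<dots> = (*) (of_rat r) ` I"
      unfolding imul_assoc r(2) imul_scale_right imul_commute[of I OF] imul_OF[OF I] ..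
    finally have "cnj ` I = (*) (1 / c) ` (*) (of_rat r) ` I" using image_mult_inverse[OF c(2)] by metis
    hence "cnj ` I = (*) (of_rat r / c) ` I" unfolding image_mult_mult by simp
    moreover have "of_rat r / c \<in> F" "of_rat r / c \<noteq> 0" using c rF by (auto intro: F_intros)
    ultimately show "\<exists>w\<in>F. w \<noteq> 0 \<and> cnj ` I = (*) w ` I" by blast
  next
    assume "\<exists>w\<in>F. w \<noteq> 0 \<and> cnj ` I = (*) w ` I"
    then obtain w where w: "w \<in> F" "w \<noteq> 0" "cnj ` I = (*) w ` I" by blast
    have "(*) (of_rat r) ` OF = (*) w ` imul I I" unfolding r(2)[symmetric] w(3) imul_scale_right ..
    hence "imul I I = (*) (1 / w) ` (*) (of_rat r) ` OF" using image_mult_inverse[OF w(2)] by metis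
    hence "imul I I = (*) (of_rat r / w) ` OF" unfolding image_mult_mult by simp
    moreover have "of_rat r / w \<in> F" "of_rat r / w \<noteq> 0" using w rF by (auto intro: F_intros)
    ultimately show "imul I I \<in> principal_ideals F" unfolding principal_ideals_eq by blast
  qed
qed

text \<open>The group-theoretic condition enters the counting argument only in this form, as a
  multiplier from each ideal to its conjugate.\<close>

theorem class_group_elementary_2_iff:
  "(\<exists>e::nat. class_group F \<cong> product_group {..<e} (\<lambda>_. integer_mod_group 2))
    \<longleftrightarrow> (\<forall>I. fi I \<longrightarrow> (\<exists>w\<in>F. w \<noteq> 0 \<and> cnj ` I = (*) w ` I))"
proof
  assume "\<exists>e::nat. class_group F \<cong> product_group {..<e} (\<lambda>_. integer_mod_group 2)"
  then obtain e :: nat where e: "class_group F \<cong> product_group {..<e} (\<lambda>_. integer_mod_group 2)" ..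
  have g: "group (class_group F)" using class_comm_group by (simp add: comm_group_def)
  show "\<forall>I. fi I \<longrightarrow> (\<exists>w\<in>F. w \<noteq> 0 \<and> cnj ` I = (*) w ` I)"
  proof (intro allI impI)
    fix I assume I: "fi I"
    have "icl I \<otimes>\<^bsub>class_group F\<^esub> icl I = \<one>\<^bsub>class_group F\<^esub>"
      by (rule iso_elementary_2_square[OF g e]) (use I class_carrier in blast)
    hence "imul I I \<in> principal_ideals F"
      using I by (simp add: class_mult class_one icl_eq_one_iff fi_imul)
    thus "\<exists>w\<in>F. w \<noteq> 0 \<and> cnj ` I = (*) w ` I" using imul_self_principal_iff[OF I] by blast
  qed
next
  assume *: "\<forall>I. fi I \<longrightarrow> (\<exists>w\<in>F. w \<noteq> 0 \<and> cnj ` I = (*) w ` I)"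
  show "\<exists>e::nat. class_group F \<cong> product_group {..<e} (\<lambda>_. integer_mod_group 2)"
  proof (rule finite_exponent_2_iso[OF class_comm_group finite_class_group])
    fix X assume "X \<in> carrier (class_group F)"
    then obtain I where I: "fi I" "X = icl I" using class_carrier by auto
    have "imul I I \<in> principal_ideals F" using * I(1) imul_self_principal_iff by blast
    thus "X \<otimes>\<^bsub>class_group F\<^esub> X = \<one>\<^bsub>class_group F\<^esub>"
      unfolding I(2) using I(1) by (simp add: class_mult class_one icl_eq_one_iff fi_imul)
  qed
qed

end

section \<open>Sublattices of finite index\<close>

text \<open>Stated for every abelian group, so that the index in the quadratic space and the index
  of the image in the complex plane are instances of one notion.\<close>

definition coset_index :: "'a::ab_group_add set \<Rightarrow> 'a set \<Rightarrow> nat" where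
  "coset_index M K = card ((\<lambda>x. (+) x ` K) ` M)"

definition is_subgroup :: "'a::ab_group_add set \<Rightarrow> bool" where
  "is_subgroup K \<longleftrightarrow> 0 \<in> K \<and> (\<forall>x\<in>K. \<forall>y\<in>K. x - y \<in> K)"

lemma is_subgroupD:
  assumes "is_subgroup K"
  shows "0 \<in> K" "x \<in> K \<Longrightarrow> y \<in> K \<Longrightarrow> x - y \<in> K" "x \<in> K \<Longrightarrow> - x \<in> K" "x \<in> K \<Longrightarrow> y \<in> K \<Longrightarrow> x + y \<in> K"
proof -
  show 0: "0 \<in> K" and d: "\<And>x y. x \<in> K \<Longrightarrow> y \<in> K \<Longrightarrow> x - y \<in> K" using assms by (auto simp: is_subgroup_def)
  show u: "\<And>x. x \<in> K \<Longrightarrow> - x \<in> K" using d[OF 0] by simp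
  show "x \<in> K \<Longrightarrow> y \<in> K \<Longrightarrow> x + y \<in> K" using d[of x "- y"] u by simp
qed

lemma coset_eq_iff:
  assumes "is_subgroup K"
  shows "(+) x ` K = (+) y ` K \<longleftrightarrow> x - y \<in> K"
proof
  assume "(+) x ` K = (+) y ` K"
  moreover have "x \<in> (+) x ` K" using is_subgroupD(1)[OF assms] by (auto intro: image_eqI[of _ _ 0])
  ultimately obtain k where "x = y + k" "k \<in> K" by auto
  thus "x - y \<in> K" by simp
next
  assume d: "x - y \<in> K"
  have "(+) x ` K \<subseteq> (+) y ` K" if "x - y \<in> K" for x y
  proof
    fix z assume "z \<in> (+) x ` K"
    then obtain k where k: "z = x + k" "k \<in> K" by auto
    have "z = y + (x - y + k)" using k by simp
    thus "z \<in> (+) y ` K" using is_subgroupD(4)[OF assms that k(2)] by blast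
  qed
  from this[OF d] this[of y x] show "(+) x ` K = (+) y ` K"
    using is_subgroupD(3)[OF assms d] by auto
qed

text \<open>Both sides count the fibres, which are the same for \<open>f\<close> and
  \<open>g\<close>.\<close>

lemma card_image_eq_of_iff:
  assumes "\<And>x y. x \<in> M \<Longrightarrow> y \<in> M \<Longrightarrow> f x = f y \<longleftrightarrow> g x = g y"
  shows "card (f ` M) = card (g ` M)"
proof (rule bij_betw_same_card)
  let ?h = "\<lambda>c. g (SOME x. x \<in> M \<and> f x = c)"
  have h: "?h (f x) = g x" if "x \<in> M" for x
  proof -
    have "(SOME y. y \<in> M \<and> f y = f x) \<in> M \<and> f (SOME y. y \<in> M \<and> f y = f x) = f x"
      by (rule someI[of _ x]) (use that in simp)
    thus ?thesis using assms that by blast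
  qed
  show "bij_betw ?h (f ` M) (g ` M)"
    by (rule bij_betw_imageI) (auto simp: inj_on_def h assms image_image cong: image_cong)
qed

lemma is_subgroup_zlat: "is_subgroup (zlat a b)"
  by (auto simp: is_subgroup_def intro: zlat_diff)

lemma zlat_subset_subgroup: "is_subgroup K \<Longrightarrow> a \<in> K \<Longrightarrow> b \<in> K \<Longrightarrow> zlat a b \<subseteq> K"
  by (rule zlat_subset) (auto simp: is_subgroup_def)

lemma subgroup_int_mult:
  fixes K :: "complex set"
  shows "is_subgroup K \<Longrightarrow> x \<in> K \<Longrightarrow> of_int k * x \<in> K"
  by (rule int_mult_closed) (auto simp: is_subgroup_def)

text \<open>The substitute for localisation: a membership is verified once up to the factor
  \<open>m\<close> and once up to the factor \<open>n\<close>.\<close>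

lemma bezout_membership:
  fixes K :: "complex set"
  assumes K: "is_subgroup K" and mn: "coprime m n" and x: "of_int m * x \<in> K" "of_int n * x \<in> K"
  shows "x \<in> K"
proof -
  obtain p q where pq: "p * m + q * n = 1" using bezout_int[of m n] mn by auto
  have "of_int p * (of_int m * x) + of_int q * (of_int n * x) \<in> K"
    by (rule is_subgroupD(4)[OF K subgroup_int_mult[OF K x(1)] subgroup_int_mult[OF K x(2)]])
  also have "of_int p * (of_int m * x) + of_int q * (of_int n * x) = of_int (p * m + q * n) * x"
    by (simp add: algebra_simps)
  finally show ?thesis unfolding pq by simp
qed

text \<open>\<open>d\<close> is the least positive multiple of \<open>a\<close> in \<open>K\<close>,
  and \<open>e\<close> the least positive coefficient of \<open>b\<close> among all elements of
  \<open>K\<close>; division with remainder shows that both generate. The common multiple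
  \<open>k\<close> ensures that these minima exist.\<close>

lemma hermite_normal_form:
  assumes ar: "area a b \<noteq> 0" and K: "is_subgroup K" "K \<subseteq> zlat a b"
    and k: "k > 0" "of_int k * a \<in> K" "of_int k * b \<in> K"
  obtains d e r :: int where "d > 0" "e > 0" "0 \<le> r" "r < d" "K = zlat (of_int d * a) (of_int r * a + of_int e * b)"
proof -
  note D = is_subgroupD[OF K(1)] and Dm = subgroup_int_mult[OF K(1)]
  define P where "P j \<longleftrightarrow> j > 0 \<and> of_nat j * a \<in> K" for j :: nat
  define R where "R j \<longleftrightarrow> j > 0 \<and> (\<exists>x::int. of_int x * a + of_nat j * b \<in> K)" for j :: nat
  have "P (nat k)" using k by (simp add: P_def)
  hence P: "P (LEAST j. P j)" by (rule LeastI)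
  have "R (nat k)" using k unfolding R_def by (intro conjI exI[of _ 0]) auto
  hence R: "R (LEAST j. R j)" by (rule LeastI)
  define d where "d = int (LEAST j. P j)"
  define e where "e = int (LEAST j. R j)"
  have d: "d > 0" "of_int d * a \<in> K" using P by (simp_all add: P_def d_def)
  have e: "e > 0" using R by (simp add: R_def e_def)
  obtain x0 :: int where x0: "of_int x0 * a + of_int e * b \<in> K" using R by (auto simp: R_def e_def)
  define r where "r = x0 mod d"
  have r: "0 \<le> r" "r < d" using d by (simp_all add: r_def)
  have "of_int x0 * a + of_int e * b - of_int (x0 div d) * (of_int d * a) \<in> K"
    by (intro D Dm x0 d)
  also have "of_int x0 * a + of_int e * b - of_int (x0 div d) * (of_int d * a)
      = of_int (x0 - x0 div d * d) * a + of_int e * b" by (simp add: algebra_simps)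
  also have "x0 - x0 div d * d = r" unfolding r_def by (simp add: minus_div_mult_eq_mod)
  finally have re: "of_int r * a + of_int e * b \<in> K" .
  have dmin: "d dvd x" if x: "of_int x * a \<in> K" for x
  proof (rule ccontr)
    assume "\<not> d dvd x"
    hence "x mod d \<noteq> 0" by (simp add: dvd_eq_mod_eq_0)
    moreover have "0 \<le> x mod d" "x mod d < d" using d(1) by simp_all
    ultimately have pos: "x mod d > 0" "x mod d < d" by linarith+
    have "of_int x * a - of_int (x div d) * (of_int d * a) \<in> K" by (intro D Dm x d)
    also have "of_int x * a - of_int (x div d) * (of_int d * a) = of_int (x - x div d * d) * a"
      by (simp add: algebra_simps)
    also have "x - x div d * d = x mod d" by (simp add: minus_div_mult_eq_mod)
    finally have "P (nat (x mod d))" using pos by (simp add: P_def)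
    hence "(LEAST j. P j) \<le> nat (x mod d)" by (rule Least_le)
    thus False using pos by (simp add: d_def)
  qed
  have emin: "e dvd y" if xy: "of_int x * a + of_int y * b \<in> K" for x y
  proof (rule ccontr)
    assume "\<not> e dvd y"
    hence "y mod e \<noteq> 0" by (simp add: dvd_eq_mod_eq_0)
    moreover have "0 \<le> y mod e" "y mod e < e" using e by simp_all
    ultimately have pos: "y mod e > 0" "y mod e < e" by linarith+
    have "of_int x * a + of_int y * b - of_int (y div e) * (of_int r * a + of_int e * b) \<in> K" by (intro D Dm xy re)
    also have "of_int x * a + of_int y * b - of_int (y div e) * (of_int r * a + of_int e * b)
        = of_int (x - y div e * r) * a + of_int (y - y div e * e) * b"
      by (simp add: algebra_simps)
    also have "y - y div e * e = y mod e" by (simp add: minus_div_mult_eq_mod)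
    finally have "of_int (x - y div e * r) * a + of_nat (nat (y mod e)) * b \<in> K" using pos by simp
    hence "R (nat (y mod e))"
      using pos unfolding R_def by (intro conjI exI[of _ "x - y div e * r"]) simp_all
    hence "(LEAST j. R j) \<le> nat (y mod e)" by (rule Least_le)
    thus False using pos by (simp add: e_def)
  qed
  have "K = zlat (of_int d * a) (of_int r * a + of_int e * b)"
  proof
    show "zlat (of_int d * a) (of_int r * a + of_int e * b) \<subseteq> K"
      by (rule zlat_subset_subgroup[OF K(1) d(2) re])
    show "K \<subseteq> zlat (of_int d * a) (of_int r * a + of_int e * b)"
    proof
      fix z assume z: "z \<in> K"
      then obtain x y where xy: "z = of_int x * a + of_int y * b" using K(2) by (auto simp: zlat_def)
      obtain j where j: "y = e * j" using emin z unfolding xy by blast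
      have "z - of_int j * (of_int r * a + of_int e * b) \<in> K" by (intro D Dm z re)
      also have "z - of_int j * (of_int r * a + of_int e * b) = of_int (x - j * r) * a"
        by (simp add: xy j algebra_simps)
      finally obtain i where i: "x - j * r = d * i" using dmin by blast
      have "of_int (x - j * r) * a = of_int i * (of_int d * a)" unfolding i by simp
      hence "z = of_int i * (of_int d * a) + of_int j * (of_int r * a + of_int e * b)"
        by (simp add: xy j algebra_simps)
      thus "z \<in> zlat (of_int d * a) (of_int r * a + of_int e * b)" by (simp only: zlatI)
    qed
  qed
  thus ?thesis using that[OF d(1) e r] by blast
qed

text \<open>The points \<open>i a + j b\<close> of a \<open>d\<close> by \<open>e\<close> box
  represent every coset once: the second generator reduces the coefficient of \<open>b\<close>
  modulo \<open>e\<close>, then the first reduces that of \<open>a\<close> modulo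
  \<open>d\<close>.\<close>

lemma coset_index_hermite:
  assumes ar: "area a b \<noteq> 0" and de: "d > 0" "e > 0"
  shows "coset_index (zlat a b) (zlat (of_int d * a) (of_int r * a + of_int e * b)) = nat (d * e)"
proof -
  let ?M = "zlat a b" and ?K = "zlat (of_int d * a) (of_int r * a + of_int e * b)"
  let ?v = "\<lambda>(i::int, j::int). of_int i * a + of_int j * b"
  let ?c = "\<lambda>x. (+) x ` ?K"
  note ceq = coset_eq_iff[OF is_subgroup_zlat]
  have inj: "inj_on (\<lambda>p. ?c (?v p)) ({0..<d} \<times> {0..<e})"
  proof (rule inj_onI)
    fix p q assume pq: "p \<in> {0..<d} \<times> {0..<e}" "q \<in> {0..<d} \<times> {0..<e}" "?c (?v p) = ?c (?v q)"
    obtain i j i' j' where ij: "p = (i, j)" "q = (i', j')" by (cases p, cases q)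
    have b: "0 \<le> i" "i < d" "0 \<le> j" "j < e" "0 \<le> i'" "i' < d" "0 \<le> j'" "j' < e" using pq(1,2) ij by auto
    have "?v p - ?v q \<in> ?K" using pq(3) ceq by blast
    then obtain s u where "?v p - ?v q = of_int s * (of_int d * a) + of_int u * (of_int r * a + of_int e * b)"
      by (auto simp: zlat_def)
    hence "of_int (i - i') * a + of_int (j - j') * b = of_int (s * d + u * r) * a + of_int (u * e) * b"
      by (simp add: ij algebra_simps)
    hence e1: "i - i' = s * d + u * r \<and> j - j' = u * e" by (rule zlat_coeffs_unique[OF ar])
    have "\<bar>u * e\<bar> < e" using e1 b by linarith
    hence "u = 0" using de by (simp add: abs_mult)
    moreover have "\<bar>i - i'\<bar> < d" using b by linarith
    ultimately have "\<bar>s * d\<bar> < d" using e1 by simp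
    hence "s = 0" using de by (simp add: abs_mult)
    thus "p = q" using e1 \<open>u = 0\<close> ij by simp
  qed
  have "?c ` ?M = (\<lambda>p. ?c (?v p)) ` ({0..<d} \<times> {0..<e})"
  proof
    show "(\<lambda>p. ?c (?v p)) ` ({0..<d} \<times> {0..<e}) \<subseteq> ?c ` ?M" using zlatI by auto
    show "?c ` ?M \<subseteq> (\<lambda>p. ?c (?v p)) ` ({0..<d} \<times> {0..<e})"
    proof clarify
      fix z assume "z \<in> ?M"
      then obtain x y where xy: "z = of_int x * a + of_int y * b" by (auto simp: zlat_def)
      define q where "q = y div e"
      define s where "s = (x - q * r) div d"
      define p where "p = ((x - q * r) mod d, y mod e)"
      have "y = q * e + y mod e" "x - q * r = s * d + (x - q * r) mod d" by (simp_all add: q_def s_def)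
      hence "z - ?v p = of_int s * (of_int d * a) + of_int q * (of_int r * a + of_int e * b)"
      proof -
        have "of_int x = of_int q * of_int r + of_int s * of_int d + (of_int ((x - q * r) mod d) :: complex)"
          using arg_cong[OF \<open>x - q * r = _\<close>, of "of_int :: int \<Rightarrow> complex"] by (simp add: algebra_simps)
        moreover have "of_int y = of_int q * of_int e + (of_int (y mod e) :: complex)"
          using arg_cong[OF \<open>y = _\<close>, of "of_int :: int \<Rightarrow> complex"] by simp
        ultimately show ?thesis unfolding xy p_def by (simp add: algebra_simps)
      qed
      hence "z - ?v p \<in> ?K" by (simp only: zlatI)
      hence "?c z = ?c (?v p)" using ceq by blast
      moreover have "p \<in> {0..<d} \<times> {0..<e}" using de by (simp add: p_def)
      ultimately show "?c z \<in> (\<lambda>p. ?c (?v p)) ` ({0..<d} \<times> {0..<e})" by blast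
    qed
  qed
  hence "coset_index ?M ?K = card ({0..<d} \<times> {0..<e})"
    unfolding coset_index_def using card_image[OF inj] by simp
  thus ?thesis using de by (simp add: nat_mult_distrib)
qed

text \<open>At \<open>m = 0\<close> this would collect the subgroups of infinite index, because
  \<open>card\<close> is then 0; hence the recurring hypothesis \<open>m > 0\<close>.\<close>

definition isub :: "complex set \<Rightarrow> nat \<Rightarrow> complex set set" where
  "isub M m = {K. is_subgroup K \<and> K \<subseteq> M \<and> coset_index M K = m}"

lemma isub_hermite:
  assumes ar: "area a b \<noteq> 0" and m: "m > 0" and K: "K \<in> isub (zlat a b) m"
  obtains d e r :: int where "d > 0" "e > 0" "0 \<le> r" "r < d" "d * e = int m"
    "K = zlat (of_int d * a) (of_int r * a + of_int e * b)"
proof -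
  let ?M = "zlat a b"
  have sg: "is_subgroup K" and KM: "K \<subseteq> ?M" and idx: "coset_index ?M K = m" using K by (auto simp: isub_def)
  have fin: "finite ((\<lambda>x. (+) x ` K) ` ?M)" using idx m unfolding coset_index_def by (intro card_ge_0_finite) simp
  \<comment> \<open>Pigeonhole: the infinitely many multiples of \<open>x\<close> meet only finitely
    many cosets.\<close>
  have mult: "\<exists>k::nat. k > 0 \<and> of_nat k * x \<in> K" if x: "x \<in> ?M" for x
  proof -
    have "(\<lambda>i::nat. (+) (of_nat i * x) ` K) ` UNIV \<subseteq> (\<lambda>x. (+) x ` K) ` ?M"
      using zlat_int_mult[OF x, of "int _"] by auto
    hence "\<not> inj (\<lambda>i::nat. (+) (of_nat i * x) ` K)"
      using fin finite_subset finite_imageD infinite_UNIV_nat by metis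
    then obtain i j :: nat where ij: "i \<noteq> j" "(+) (of_nat i * x) ` K = (+) (of_nat j * x) ` K"
      by (auto simp: inj_def)
    hence *: "of_nat i * x - of_nat j * x \<in> K" "of_nat j * x - of_nat i * x \<in> K"
      using coset_eq_iff[OF sg] by metis+
    show ?thesis
    proof (cases "i > j")
      case True
      hence "of_nat (i - j) * x \<in> K" using *(1) by (simp add: of_nat_diff left_diff_distrib)
      thus ?thesis using True by (intro exI[of _ "i - j"]) simp
    next
      case False
      hence "of_nat (j - i) * x \<in> K" using *(2) by (simp add: of_nat_diff left_diff_distrib)
      thus ?thesis using False ij(1) by (intro exI[of _ "j - i"]) simp
    qed
  qed
  obtain k :: nat where k: "k > 0" "of_nat k * a \<in> K" using mult[of a] by auto
  obtain l :: nat where l: "l > 0" "of_nat l * b \<in> K" using mult[of b] by auto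
  have "of_int (int l) * (of_nat k * a) \<in> K" "of_int (int k) * (of_nat l * b) \<in> K"
    by (intro subgroup_int_mult[OF sg] k l)+
  hence kl: "of_int (int (k * l)) * a \<in> K" "of_int (int (k * l)) * b \<in> K" by (simp_all add: mult_ac)
  have "int (k * l) > 0" using k l by simp
  then obtain d e r :: int where h: "d > 0" "e > 0" "0 \<le> r" "r < d" "K = zlat (of_int d * a) (of_int r * a + of_int e * b)"
    using hermite_normal_form[OF ar sg KM _ kl] by metis
  have "nat (d * e) = m" using coset_index_hermite[OF ar h(1,2)] idx h(5) by simp
  hence "d * e = int m" using h by auto
  thus ?thesis using that h by blast
qed

lemma hermite_in_isub:
  assumes "area a b \<noteq> 0" "d > 0" "e > 0" "d * e = int m"
  shows "zlat (of_int d * a) (of_int r * a + of_int e * b) \<in> isub (zlat a b) m"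
proof -
  have "zlat (of_int d * a) (of_int r * a + of_int e * b) \<subseteq> zlat a b"
    by (intro zlat_subset_subgroup is_subgroup_zlat zlatI zlat_int_mult zlat_basis)
  thus ?thesis
    unfolding isub_def using coset_index_hermite[OF assms(1-3), of r] assms(4)
    by (simp add: is_subgroup_zlat)
qed

lemma isub_mult_mem:
  assumes "area a b \<noteq> 0" "m > 0" "K \<in> isub (zlat a b) m" "x \<in> zlat a b"
  shows "of_nat m * x \<in> K"
proof -
  obtain d e r :: int where h: "d > 0" "e > 0" "d * e = int m" "K = zlat (of_int d * a) (of_int r * a + of_int e * b)"
    using isub_hermite[OF assms(1-3)] by metis
  obtain p q where x: "x = of_int p * a + of_int q * b" using assms(4) by (auto simp: zlat_def)
  have "(of_nat m :: complex) = of_int (d * e)" unfolding h(3) by simp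
  hence "of_nat m * x = of_int (p * e - q * r) * (of_int d * a) + of_int (q * d) * (of_int r * a + of_int e * b)"
    by (simp add: x algebra_simps)
  thus ?thesis unfolding h(4) by (simp only: zlatI)
qed

text \<open>The index as a quotient of areas. In this form it is visibly unchanged by multiplication
  with a number of modulus one.\<close>

lemma isub_area:
  assumes ar: "area a b \<noteq> 0" and m: "m > 0"
  shows "K \<in> isub (zlat a b) m \<longleftrightarrow>
    K \<subseteq> zlat a b \<and> (\<exists>c d. K = zlat c d \<and> \<bar>area c d\<bar> = real m * \<bar>area a b\<bar>)"
proof
  assume K: "K \<in> isub (zlat a b) m"
  then obtain d e r :: int where h: "d > 0" "e > 0" "d * e = int m" "K = zlat (of_int d * a) (of_int r * a + of_int e * b)"
    using isub_hermite[OF ar m] by metis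
  have "area (of_int d * a) (of_int r * a + of_int e * b) = of_int (d * e) * area a b"
    using area_lincomb[of d a 0 b r e] by simp
  hence "\<bar>area (of_int d * a) (of_int r * a + of_int e * b)\<bar> = real m * \<bar>area a b\<bar>"
    unfolding h(3) by (simp add: abs_mult)
  thus "K \<subseteq> zlat a b \<and> (\<exists>c d. K = zlat c d \<and> \<bar>area c d\<bar> = real m * \<bar>area a b\<bar>)"
    using K h(4) by (auto simp: isub_def)
next
  assume "K \<subseteq> zlat a b \<and> (\<exists>c d. K = zlat c d \<and> \<bar>area c d\<bar> = real m * \<bar>area a b\<bar>)"
  then obtain c d where K: "K \<subseteq> zlat a b" "K = zlat c d" "\<bar>area c d\<bar> = real m * \<bar>area a b\<bar>" by blast
  have "c \<in> zlat a b" "d \<in> zlat a b" using K(1,2) by auto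
  then obtain p q r s where e: "c = of_int p * a + of_int q * b" "d = of_int r * a + of_int s * b"
    by (auto simp: zlat_def)
  define D where "D = p * s - q * r"
  have "area c d = of_int D * area a b" unfolding e D_def by (rule area_lincomb)
  hence "\<bar>real_of_int D\<bar> * \<bar>area a b\<bar> = real m * \<bar>area a b\<bar>" using K(3) by (simp add: abs_mult)
  hence D: "\<bar>D\<bar> = int m" using ar by simp
  \<comment> \<open>The adjugate of the base change matrix: it puts the multiples by the determinant
    into \<open>K\<close>, as the normal form requires.\<close>
  have Da: "of_int D * a = of_int s * c + of_int (- q) * d" "of_int D * b = of_int (- r) * c + of_int p * d"
    by (simp_all add: e D_def algebra_simps)
  have "of_int D * a \<in> K" "of_int D * b \<in> K" unfolding Da K(2) by (rule zlatI)+
  hence "of_int \<bar>D\<bar> * a \<in> K" "of_int \<bar>D\<bar> * b \<in> K"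
    using zlat_uminus unfolding K(2) by (auto simp: abs_if)
  moreover have "\<bar>D\<bar> > 0" using D m by simp
  moreover have sg: "is_subgroup K" unfolding K(2) by (rule is_subgroup_zlat)
  ultimately obtain d' e' r' :: int where h: "d' > 0" "e' > 0" "K = zlat (of_int d' * a) (of_int r' * a + of_int e' * b)"
    using hermite_normal_form[OF ar sg K(1)] by metis
  have "\<bar>area c d\<bar> = \<bar>area (of_int d' * a) (of_int r' * a + of_int e' * b)\<bar>"
    by (rule zlat_area_unique) (use K(2) h(3) in simp)
  also have "area (of_int d' * a) (of_int r' * a + of_int e' * b) = of_int (d' * e') * area a b"
    using area_lincomb[of d' a 0 b r' e'] by simp
  finally have "real m * \<bar>area a b\<bar> = of_int (d' * e') * \<bar>area a b\<bar>"
    unfolding K(3) using h by (simp add: abs_mult)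
  hence "real m = of_int (d' * e')" using ar by simp
  hence "d' * e' = int m" by linarith
  thus "K \<in> isub (zlat a b) m" unfolding h(3) by (intro hermite_in_isub ar h)
qed

lemma isub_subset_divisors:
  assumes "area a b \<noteq> 0" "m > 0"
  shows "isub (zlat a b) m \<subseteq> (\<lambda>(d, r). zlat (of_nat d * a) (of_nat r * a + of_nat (m div d) * b)) ` (SIGMA d:{d. d dvd m}. {..<d})"
proof
  fix K assume "K \<in> isub (zlat a b) m"
  then obtain d e r :: int where h: "d > 0" "e > 0" "0 \<le> r" "r < d" "d * e = int m" "K = zlat (of_int d * a) (of_int r * a + of_int e * b)"
    using isub_hermite[OF assms] by metis
  have "int (nat d * nat e) = int m" using h by simp
  hence de: "nat d * nat e = m" by (simp only: of_nat_eq_iff)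
  hence "m div nat d = nat e" using h(1) by (metis nonzero_mult_div_cancel_left zero_less_nat_eq less_numeral_extra(3))
  hence "K = zlat (of_nat (nat d) * a) (of_nat (nat r) * a + of_nat (m div nat d) * b)" using h by simp
  moreover have "(nat d, nat r) \<in> (SIGMA d:{d. d dvd m}. {..<d})" using h de by auto
  ultimately show "K \<in> (\<lambda>(d, r). zlat (of_nat d * a) (of_nat r * a + of_nat (m div d) * b)) ` (SIGMA d:{d. d dvd m}. {..<d})"
    by (intro image_eqI[of _ _ "(nat d, nat r)"]) auto
qed

lemma finite_isub: "area a b \<noteq> 0 \<Longrightarrow> m > 0 \<Longrightarrow> finite (isub (zlat a b) m)"
  by (rule finite_subset[OF isub_subset_divisors]) auto

text \<open>In the normal form each divisor \<open>d\<close> leaves \<open>d\<close> choices for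
  \<open>r\<close>. This bound is what makes the Dirichlet series converge for
  \<open>Re s > 2\<close>.\<close>

lemma card_isub_le: "area a b \<noteq> 0 \<Longrightarrow> m > 0 \<Longrightarrow> card (isub (zlat a b) m) \<le> \<Sum> {d. d dvd m}"
proof -
  assume am: "area a b \<noteq> 0" "m > 0"
  hence "finite (SIGMA d:{d. d dvd m}. {..<d})" by auto
  hence "card (isub (zlat a b) m) \<le> card (SIGMA d:{d. d dvd m}. {..<d})"
    by (rule surj_card_le[OF _ isub_subset_divisors[OF am]])
  also have "\<dots> = \<Sum> {d. d dvd m}" using am by (subst card_SigmaI) auto
  finally show ?thesis .
qed

text \<open>Between two normal forms the base change is triangular, and its diagonal entries
  multiply to the quotient of the indices.\<close>

lemma isub_dvd:
  assumes ar: "area a b \<noteq> 0" and mn: "m > 0" "n > 0" and K: "K \<in> isub (zlat a b) m" "K' \<in> isub (zlat a b) n" "K \<subseteq> K'"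
  shows "n dvd m"
proof -
  obtain d e r :: int where h: "d > 0" "e > 0" "d * e = int m" "K = zlat (of_int d * a) (of_int r * a + of_int e * b)"
    using isub_hermite[OF ar mn(1) K(1)] by metis
  obtain d' e' r' :: int where h': "d' > 0" "e' > 0" "d' * e' = int n" "K' = zlat (of_int d' * a) (of_int r' * a + of_int e' * b)"
    using isub_hermite[OF ar mn(2) K(2)] by metis
  have "of_int d * a \<in> K'" "of_int r * a + of_int e * b \<in> K'" using K(3) unfolding h(4) by auto
  then obtain p q p' q' where "of_int d * a = of_int p * (of_int d' * a) + of_int q * (of_int r' * a + of_int e' * b)"
    "of_int r * a + of_int e * b = of_int p' * (of_int d' * a) + of_int q' * (of_int r' * a + of_int e' * b)"
    unfolding h'(4) zlat_def by blast
  hence eqs: "of_int d * a + of_int 0 * b = of_int (p * d' + q * r') * a + of_int (q * e') * b"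
    "of_int r * a + of_int e * b = of_int (p' * d' + q' * r') * a + of_int (q' * e') * b"
    by (simp_all add: algebra_simps)
  note 1 = zlat_coeffs_unique[OF ar eqs(1)] zlat_coeffs_unique[OF ar eqs(2)]
  hence "q = 0" using h' by simp
  hence "d = p * d'" "e = q' * e'" using 1 by auto
  hence "int m = (d' * e') * (p * q')" by (simp add: mult_ac flip: h(3))
  hence "int m = int n * (p * q')" unfolding h'(3) .
  hence "int n dvd int m" by simp
  thus ?thesis by (simp only: int_dvd_int_iff)
qed

lemma subgroup_with_multiple_in_isub:
  assumes ar: "area a b \<noteq> 0" and K: "is_subgroup K" "K \<subseteq> zlat a b" and k: "k > 0" "\<And>x. x \<in> zlat a b \<Longrightarrow> of_nat k * x \<in> K"
  obtains N where "N > 0" "K \<in> isub (zlat a b) N"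
proof -
  have "int k > 0" "of_int (int k) * a \<in> K" "of_int (int k) * b \<in> K" using k by auto
  then obtain d e r :: int where h: "d > 0" "e > 0" "K = zlat (of_int d * a) (of_int r * a + of_int e * b)"
    using hermite_normal_form[OF ar K] by metis
  have "K \<in> isub (zlat a b) (nat (d * e))" unfolding h(3) using h by (intro hermite_in_isub ar) auto
  moreover have "nat (d * e) > 0" using h by simp
  ultimately show ?thesis using that by blast
qed

section \<open>Splitting a sublattice along coprime indices\<close>

lemma is_subgroup_Int: "is_subgroup A \<Longrightarrow> is_subgroup B \<Longrightarrow> is_subgroup (A \<inter> B)"
  by (auto simp: is_subgroup_def)

text \<open>Both \<open>m\<close> and \<open>n\<close> divide the index, since the intersection lies
  in \<open>K1\<close> and in \<open>K2\<close>. Conversely a coset of the intersection is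
  determined by its cosets modulo \<open>K1\<close> and \<open>K2\<close>, so the index is at most
  \<open>m * n\<close>.\<close>

lemma isub_Int:
  assumes ar: "area a b \<noteq> 0" and mn: "m > 0" "n > 0" "coprime m n"
    and K: "K1 \<in> isub (zlat a b) m" "K2 \<in> isub (zlat a b) n"
  shows "K1 \<inter> K2 \<in> isub (zlat a b) (m * n)"
proof -
  let ?M = "zlat a b"
  have s: "is_subgroup K1" "is_subgroup K2" "K1 \<subseteq> ?M" using K by (auto simp: isub_def)
  have m1: "of_nat m * x \<in> K1" if "x \<in> ?M" for x by (rule isub_mult_mem[OF ar mn(1) K(1) that])
  have n1: "of_nat n * x \<in> K2" if "x \<in> ?M" for x by (rule isub_mult_mem[OF ar mn(2) K(2) that])
  have "of_nat (m * n) * x \<in> K1 \<inter> K2" if x: "x \<in> ?M" for x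
    using subgroup_int_mult[OF s(1) m1[OF x], of "int n"] subgroup_int_mult[OF s(2) n1[OF x], of "int m"]
    by (simp add: mult_ac)
  then obtain N where N: "N > 0" "K1 \<inter> K2 \<in> isub ?M N"
    using subgroup_with_multiple_in_isub[OF ar is_subgroup_Int[OF s(1,2)], of "m * n"] s(3) mn by auto
  have "m dvd N" "n dvd N" using isub_dvd[OF ar N(1) mn(1) N(2) K(1)] isub_dvd[OF ar N(1) mn(2) N(2) K(2)] by auto
  hence "m * n dvd N" using mn(3) by (simp add: divides_mult)
  moreover have "N \<le> m * n"
  proof -
    let ?c = "\<lambda>K x. (+) (x::complex) ` K"
    have "N = card (?c (K1 \<inter> K2) ` ?M)" using N(2) by (simp add: isub_def coset_index_def)
    also have "\<dots> = card ((\<lambda>x. (?c K1 x, ?c K2 x)) ` ?M)"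
      by (rule card_image_eq_of_iff) (simp add: coset_eq_iff is_subgroup_Int s)
    also have "\<dots> \<le> card (?c K1 ` ?M \<times> ?c K2 ` ?M)"
    proof (rule card_mono)
      have "card (?c K1 ` ?M) = m" "card (?c K2 ` ?M) = n" using K by (auto simp: isub_def coset_index_def)
      thus "finite (?c K1 ` ?M \<times> ?c K2 ` ?M)" using mn by (intro finite_cartesian_product card_ge_0_finite) auto
    qed auto
    also have "\<dots> = m * n" using K by (auto simp: isub_def coset_index_def card_cartesian_product)
    finally show ?thesis .
  qed
  ultimately have "N = m * n" using N(1) mn by (meson dvd_imp_le le_antisym)
  thus ?thesis using N(2) by simp
qed

text \<open>The sum \<open>K + m M\<close>. For \<open>K\<close> of index \<open>m n\<close> with
  coprime factors it recovers the component of index \<open>m\<close>; for an integral ideal and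
  \<open>M = OF\<close> it is the greatest common divisor of the ideal and \<open>m\<close>.\<close>

definition add_mult :: "complex set \<Rightarrow> nat \<Rightarrow> complex set \<Rightarrow> complex set" where
  "add_mult K m M = {x + of_nat m * y | x y. x \<in> K \<and> y \<in> M}"

lemma is_subgroup_add_mult: "is_subgroup K \<Longrightarrow> is_subgroup M \<Longrightarrow> is_subgroup (add_mult K m M)"
proof -
  assume K: "is_subgroup K" and M: "is_subgroup M"
  have "0 = 0 + of_nat m * (0::complex)" by simp
  hence "0 \<in> add_mult K m M" unfolding add_mult_def using is_subgroupD(1)[OF K] is_subgroupD(1)[OF M] by blast
  moreover have "x - y \<in> add_mult K m M" if xy: "x \<in> add_mult K m M" "y \<in> add_mult K m M" for x y
  proof -
    obtain p q r s where e: "x = p + of_nat m * q" "y = r + of_nat m * s" "p \<in> K" "q \<in> M" "r \<in> K" "s \<in> M"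
      using xy unfolding add_mult_def by blast
    have "x - y = (p - r) + of_nat m * (q - s)" using e by (simp add: algebra_simps)
    moreover have "p - r \<in> K" "q - s \<in> M" using e is_subgroupD(2)[OF K] is_subgroupD(2)[OF M] by auto
    ultimately show ?thesis unfolding add_mult_def by blast
  qed
  ultimately show ?thesis by (simp add: is_subgroup_def)
qed

lemma add_mult_memI: "x \<in> K \<Longrightarrow> 0 \<in> M \<Longrightarrow> x \<in> add_mult K m M"
  unfolding add_mult_def by force

lemma add_mult_memI2: "y \<in> M \<Longrightarrow> 0 \<in> K \<Longrightarrow> of_nat m * y \<in> add_mult K m M"
  unfolding add_mult_def by force

text \<open>For \<open>x\<close> in \<open>K1\<close>, the multiple \<open>n x\<close> lies in the
  intersection and \<open>m x\<close> in \<open>m M\<close>; coprimality recovers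
  \<open>x\<close>.\<close>

lemma add_mult_Int:
  assumes K: "is_subgroup K1" "is_subgroup K2" "K1 \<subseteq> M" and mn: "coprime m n" "is_subgroup M"
    and 1: "\<And>x. x \<in> M \<Longrightarrow> of_nat m * x \<in> K1" and 2: "\<And>x. x \<in> M \<Longrightarrow> of_nat n * x \<in> K2"
  shows "add_mult (K1 \<inter> K2) m M = K1"
proof
  show "add_mult (K1 \<inter> K2) m M \<subseteq> K1" using 1 is_subgroupD(4)[OF K(1)] by (auto simp: add_mult_def)
  show "K1 \<subseteq> add_mult (K1 \<inter> K2) m M"
  proof
    fix x assume x: "x \<in> K1"
    have "of_int (int n) * x \<in> K1 \<inter> K2" using subgroup_int_mult[OF K(1) x, of "int n"] 2 x K(3) by auto
    hence "of_int (int n) * x \<in> add_mult (K1 \<inter> K2) m M" using is_subgroupD(1)[OF mn(2)] by (intro add_mult_memI) auto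
    moreover have "of_int (int m) * x \<in> add_mult (K1 \<inter> K2) m M"
      using add_mult_memI2[of x M "K1 \<inter> K2" m] x K is_subgroupD(1) by auto
    moreover have "coprime (int m) (int n)" using mn by simp
    moreover have "is_subgroup (add_mult (K1 \<inter> K2) m M)" by (intro is_subgroup_add_mult is_subgroup_Int K mn)
    ultimately show "x \<in> add_mult (K1 \<inter> K2) m M" using bezout_membership by blast
  qed
qed

text \<open>The index divides \<open>m n\<close>, because the sum contains \<open>K\<close>, and
  \<open>m^2\<close>, because it contains \<open>m M\<close>. The greatest common divisor of these
  numbers is \<open>m\<close>.\<close>

lemma isub_add_mult:
  assumes ar: "area a b \<noteq> 0" and mn: "m > 0" "n > 0" "coprime m n" and K: "K \<in> isub (zlat a b) (m * n)"
  shows "\<exists>m'. m' dvd m \<and> m' > 0 \<and> add_mult K m (zlat a b) \<in> isub (zlat a b) m'"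
proof -
  let ?M = "zlat a b" and ?A = "add_mult K m (zlat a b)"
  have s: "is_subgroup K" "K \<subseteq> ?M" using K by (auto simp: isub_def)
  have sA: "is_subgroup ?A" by (intro is_subgroup_add_mult s is_subgroup_zlat)
  have mM: "of_nat m * x \<in> ?M" if "x \<in> ?M" for x using zlat_int_mult[OF that, of "int m"] by simp
  have AM: "?A \<subseteq> ?M" using s(2) mM zlat_add by (auto simp: add_mult_def)
  have mA: "of_nat m * x \<in> ?A" if "x \<in> ?M" for x using that is_subgroupD(1)[OF s(1)] by (rule add_mult_memI2)
  obtain N where N: "N > 0" "?A \<in> isub ?M N" using subgroup_with_multiple_in_isub[OF ar sA AM mn(1) mA] by blast
  have "N dvd m * n"
    by (rule isub_dvd[OF ar _ N(1) K N(2)]) (use mn add_mult_memI[of _ K ?M] in auto)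
  have i: "zlat (of_int (int m) * a) (of_int 0 * a + of_int (int m) * b) \<in> isub ?M (m * m)"
    using mn by (intro hermite_in_isub ar) auto
  have "zlat (of_int (int m) * a) (of_int 0 * a + of_int (int m) * b) \<subseteq> ?A"
    using mA[of a] mA[of b] by (intro zlat_subset_subgroup[OF sA]) auto
  hence "N dvd m * m" using isub_dvd[OF ar _ N(1) i N(2)] mn by simp
  hence "N dvd gcd (m * n) (m * m)" using \<open>N dvd m * n\<close> by simp
  also have "gcd (m * n) (m * m) = m" using mn(3) by (simp add: gcd_mult_distrib_nat[symmetric] gcd.commute coprime_iff_gcd_eq_1)
  finally show ?thesis using N by blast
qed

text \<open>A Chinese remainder theorem for sublattices. Every \<open>K\<close> is the intersection
  of \<open>K + m M\<close> and \<open>K + n M\<close>; their indices divide \<open>m\<close> and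
  \<open>n\<close> and multiply to \<open>m n\<close>, so they are exact.\<close>

lemma bij_betw_isub_Int:
  assumes ar: "area a b \<noteq> 0" and mn: "m > 0" "n > 0" "coprime m n"
  shows "bij_betw (\<lambda>(K1, K2). K1 \<inter> K2) (isub (zlat a b) m \<times> isub (zlat a b) n) (isub (zlat a b) (m * n))"
proof (rule bij_betw_imageI)
  let ?M = "zlat a b"
  have nm: "coprime n m" using mn(3) by (simp add: coprime_commute)
  have rec: "add_mult (K1 \<inter> K2) m ?M = K1 \<and> add_mult (K1 \<inter> K2) n ?M = K2"
    if K: "K1 \<in> isub ?M m" "K2 \<in> isub ?M n" for K1 K2
  proof -
    have s: "is_subgroup K1" "is_subgroup K2" "K1 \<subseteq> ?M" "K2 \<subseteq> ?M" using K by (auto simp: isub_def)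
    note 1 = isub_mult_mem[OF ar mn(1) K(1)] and 2 = isub_mult_mem[OF ar mn(2) K(2)]
    show ?thesis
      using add_mult_Int[OF s(1,2,3) mn(3) is_subgroup_zlat 1 2] add_mult_Int[OF s(2,1,4) nm is_subgroup_zlat 2 1]
      by (simp add: Int_commute)
  qed
  show "inj_on (\<lambda>(K1, K2). K1 \<inter> K2) (isub ?M m \<times> isub ?M n)"
  proof (rule inj_onI)
    fix p q assume pq: "p \<in> isub ?M m \<times> isub ?M n" "q \<in> isub ?M m \<times> isub ?M n"
      "(case p of (K1, K2) \<Rightarrow> K1 \<inter> K2) = (case q of (K1, K2) \<Rightarrow> K1 \<inter> K2)"
    obtain K1 K2 L1 L2 where e: "p = (K1, K2)" "q = (L1, L2)" by (cases p, cases q)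
    have KL: "K1 \<in> isub ?M m" "K2 \<in> isub ?M n" "L1 \<in> isub ?M m" "L2 \<in> isub ?M n" "K1 \<inter> K2 = L1 \<inter> L2"
      using pq e by auto
    from rec[OF KL(1,2)] rec[OF KL(3,4)] have "K1 = L1 \<and> K2 = L2" unfolding KL(5) by metis
    thus "p = q" using e by simp
  qed
  show "(\<lambda>(K1, K2). K1 \<inter> K2) ` (isub ?M m \<times> isub ?M n) = isub ?M (m * n)"
  proof
    show "(\<lambda>(K1, K2). K1 \<inter> K2) ` (isub ?M m \<times> isub ?M n) \<subseteq> isub ?M (m * n)"
      using isub_Int[OF ar mn] by auto
    show "isub ?M (m * n) \<subseteq> (\<lambda>(K1, K2). K1 \<inter> K2) ` (isub ?M m \<times> isub ?M n)"
    proof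
      fix K assume K: "K \<in> isub ?M (m * n)"
      have sg: "is_subgroup K" "K \<subseteq> ?M" using K by (auto simp: isub_def)
      let ?A = "add_mult K m ?M" and ?B = "add_mult K n ?M"
      obtain m' where m': "m' dvd m" "m' > 0" "?A \<in> isub ?M m'" using isub_add_mult[OF ar mn K] by blast
      have "K \<in> isub ?M (n * m)" using K by (simp add: mult.commute)
      then obtain n' where n': "n' dvd n" "n' > 0" "?B \<in> isub ?M n'" using isub_add_mult[OF ar mn(2,1) nm] by blast
      have cop: "coprime m' n'" using mn(3) m'(1) n'(1) by (meson coprime_divisors)
      have AB: "?A \<inter> ?B = K"
      proof
        show "K \<subseteq> ?A \<inter> ?B" by (auto intro: add_mult_memI)
        show "?A \<inter> ?B \<subseteq> K"
        proof
          fix x assume x: "x \<in> ?A \<inter> ?B"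
          obtain p q where p: "x = p + of_nat m * q" "p \<in> K" "q \<in> ?M" using x by (auto simp: add_mult_def)
          obtain r s where r: "x = r + of_nat n * s" "r \<in> K" "s \<in> ?M" using x by (auto simp: add_mult_def)
          have mnK: "of_nat (m * n) * y \<in> K" if "y \<in> ?M" for y
            by (rule isub_mult_mem[OF ar _ K that]) (use mn in simp)
          have "of_int (int n) * x = of_int (int n) * p + of_nat (m * n) * q" by (simp add: p(1) algebra_simps)
          also have "\<dots> \<in> K" by (intro is_subgroupD(4)[OF sg(1)] subgroup_int_mult[OF sg(1)] p mnK)
          finally have 1: "of_int (int n) * x \<in> K" .
          have "of_int (int m) * x = of_int (int m) * r + of_nat (m * n) * s" by (simp add: r(1) algebra_simps)
          also have "\<dots> \<in> K" by (intro is_subgroupD(4)[OF sg(1)] subgroup_int_mult[OF sg(1)] r mnK)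
          finally have 2: "of_int (int m) * x \<in> K" .
          have "coprime (int m) (int n)" using mn by simp
          thus "x \<in> K" using bezout_membership[OF sg(1) _ 2 1] by blast
        qed
      qed
      have "K \<in> isub ?M (m' * n')" using isub_Int[OF ar m'(2) n'(2) cop m'(3) n'(3)] AB by simp
      hence "m' * n' = m * n" using K by (simp add: isub_def)
      moreover have "m' \<le> m" "n' \<le> n" using m' n' mn by (auto intro: dvd_imp_le)
      ultimately have "m * n \<le> m' * n" "m * n \<le> m * n'" by (metis mult_le_mono2, metis mult_le_mono1)
      hence "m' = m" "n' = n" using mn \<open>m' \<le> m\<close> \<open>n' \<le> n\<close> by simp_all
      thus "K \<in> (\<lambda>(K1, K2). K1 \<inter> K2) ` (isub ?M m \<times> isub ?M n)"
        using m' n' AB by (intro image_eqI[of _ _ "(?A, ?B)"]) auto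
    qed
  qed
qed

section \<open>Counting classes of sublattices\<close>

text \<open>Each class contributes its size times the reciprocal of its size.\<close>

lemma card_quotient_sum:
  assumes "finite X" "equiv X r"
  shows "real (card (X // r)) = (\<Sum>x\<in>X. 1 / real (card (r `` {x})))"
proof -
  have fin: "finite (X // r)" "\<And>C. C \<in> X // r \<Longrightarrow> finite C"
    using assms finite_quotient finite_equiv_class by (metis equiv_type)+
  have "(\<Sum>x\<in>X. 1 / real (card (r `` {x}))) = (\<Sum>x\<in>\<Union>(X // r). 1 / real (card (r `` {x})))"
    by (simp add: Union_quotient[OF assms(2)])
  also have "\<dots> = (\<Sum>C\<in>X // r. \<Sum>x\<in>C. 1 / real (card (r `` {x})))"
    by (subst sum.Union_disjoint) (use fin(2) quotient_disj[OF assms(2)] in auto)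
  also have "\<dots> = (\<Sum>C\<in>X // r. 1)"
  proof (rule sum.cong[OF refl])
    fix C assume C: "C \<in> X // r"
    have "r `` {x} = C" if "x \<in> C" for x
    proof -
      obtain y where y: "y \<in> X" "C = r `` {y}" using C by (rule quotientE)
      have "(y, x) \<in> r" using that y(2) by simp
      thus ?thesis using equiv_class_eq[OF assms(2)] y(2) by simp
    qed
    hence "(\<Sum>x\<in>C. 1 / real (card (r `` {x}))) = (\<Sum>x\<in>C. 1 / real (card C))" by simp
    also have "\<dots> = 1" using fin(2)[OF C] in_quotient_imp_non_empty[OF assms(2) C] by (simp add: card_gt_0_iff)
    finally show "(\<Sum>x\<in>C. 1 / real (card (r `` {x}))) = 1" .
  qed
  finally show ?thesis by simp
qed

text \<open>Picks exactly one of \<open>u\<close> and \<open>-u\<close> for non-zero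
  \<open>u\<close>. Recording it next to a value turns the two-to-one maps below into
  injections.\<close>

definition upper :: "complex \<Rightarrow> bool" where
  "upper u \<longleftrightarrow> Im u > 0 \<or> (Im u = 0 \<and> Re u > 0)"

lemma upper_uminus: "u \<noteq> 0 \<Longrightarrow> upper (- u) \<longleftrightarrow> \<not> upper u"
  by (auto simp: upper_def complex_eq_iff)

text \<open>\<open>M\<close> is a fractional ideal given by a basis over the integers: indices are
  measured by areas, while the ideal property enters as stability under multiplication.\<close>

locale ideal_lattice = imag_quad +
  fixes \<mu> \<nu> :: complex
  assumes lattice_F: "\<mu> \<in> F" "\<nu> \<in> F" and lattice_area: "area \<mu> \<nu> \<noteq> 0"
    and lattice_mult: "a \<in> zlat 1 \<omega> \<Longrightarrow> x \<in> zlat \<mu> \<nu> \<Longrightarrow> a * x \<in> zlat \<mu> \<nu>"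
    and disc_not: "t\<^sup>2 - 4 * n \<noteq> - 3" "t\<^sup>2 - 4 * n \<noteq> - 4"
begin

abbreviation M :: "complex set" where "M \<equiv> zlat \<mu> \<nu>"

definition U :: "complex set" where "U = {u \<in> F. cmod u = 1}"

definition rot_rel :: "(complex set \<times> complex set) set" where
  "rot_rel = {(K1, K2). \<exists>u\<in>U. (*) u ` K1 = K2}"

text \<open>This is \<open>S(K)\<close>. The sublattice \<open>K\<close> need not be an ideal; only
  the ambient \<open>M\<close> is one.\<close>

definition stays :: "complex set \<Rightarrow> complex set" where
  "stays K = {u \<in> U. (*) u ` K \<subseteq> M}"

definition class_count :: "nat \<Rightarrow> nat" where
  "class_count m = card (isub M m // Restr rot_rel (isub M m))"

lemma U_nonzero: "u \<in> U \<Longrightarrow> u \<noteq> 0" by (auto simp: U_def)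

lemma U_cnj: "u \<in> U \<Longrightarrow> u * cnj u = 1" "u \<in> U \<Longrightarrow> cnj u * u = 1"
  by (auto simp: U_def complex_norm_square[symmetric] mult.commute)

lemma U_intros: "1 \<in> U" "u \<in> U \<Longrightarrow> v \<in> U \<Longrightarrow> u * v \<in> U" "u \<in> U \<Longrightarrow> cnj u \<in> U" "u \<in> U \<Longrightarrow> - u \<in> U"
  "u \<in> U \<Longrightarrow> v \<in> U \<Longrightarrow> u / v \<in> U"
  by (auto simp: U_def norm_mult norm_divide intro: F_intros cnj_F)

lemma mu_nonzero: "\<mu> \<noteq> 0" using lattice_area by (auto simp: area_alt)

lemma mult_M_in_OF: "x \<in> F \<Longrightarrow> (\<And>y. y \<in> M \<Longrightarrow> x * y \<in> M) \<Longrightarrow> x \<in> OF"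
  by (rule mult_stable_in_OF[OF _ mu_nonzero, of _ \<nu>]) auto

text \<open>Multiplication by a number of modulus one preserves areas, so an image inside
  \<open>M\<close> automatically has the same index.\<close>

lemma rot_isub:
  assumes m: "m > 0" and K: "K \<in> isub M m" and u: "u \<in> U" "(*) u ` K \<subseteq> M"
  shows "(*) u ` K \<in> isub M m"
proof -
  obtain c d where cd: "K = zlat c d" "\<bar>area c d\<bar> = real m * \<bar>area \<mu> \<nu>\<bar>"
    using K unfolding isub_area[OF lattice_area m] by blast
  have "area (u * c) (u * d) = area c d" using u(1) by (simp add: area_mult U_def)
  thus ?thesis unfolding isub_area[OF lattice_area m] using u(2) cd image_mult_zlat by metis
qed

text \<open>The quotient \<open>v / u\<close> maps the lattice \<open>K\<close> to itself, hence is
  an algebraic integer of modulus one.\<close>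

lemma rot_eq_imp:
  assumes m: "m > 0" and K: "K \<in> isub M m" and u: "u \<in> U" "v \<in> U" "(*) u ` K = (*) v ` K"
  shows "v = u \<or> v = - u"
proof -
  obtain c d where cd: "K = zlat c d" "\<bar>area c d\<bar> = real m * \<bar>area \<mu> \<nu>\<bar>"
    using K unfolding isub_area[OF lattice_area m] by blast
  have "c \<noteq> 0" using cd(2) m lattice_area by (auto simp: area_alt)
  have "K = (*) (1 / u) ` (*) v ` K" by (rule image_mult_inverse[OF U_nonzero[OF u(1)] u(3)[symmetric]])
  hence e: "(*) (v / u) ` K = K" unfolding image_mult_mult by simp
  have "v / u * c \<in> (*) (v / u) ` K" "v / u * d \<in> (*) (v / u) ` K" unfolding cd(1) by (intro imageI zlat_basis)+
  hence "v / u * c \<in> zlat c d" "v / u * d \<in> zlat c d" unfolding e unfolding cd(1) by auto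
  moreover have vu: "v / u \<in> U" using u by (intro U_intros)
  ultimately have "v / u \<in> OF" using mult_stable_in_OF[OF _ \<open>c \<noteq> 0\<close>] U_def by blast
  moreover have "cmod (v / u) = 1" using vu by (simp only: U_def mem_Collect_eq)
  ultimately have "v / u = 1 \<or> v / u = - 1" by (rule OF_unit[OF disc_not])
  moreover have "v / u * u = v" using U_nonzero[OF u(1)] by simp
  ultimately show ?thesis by (metis mult_1 mult_minus1)
qed

lemma equiv_rot: "equiv (isub M m) (Restr rot_rel (isub M m))"
proof (rule equivI)
  show "refl_on (isub M m) (Restr rot_rel (isub M m))"
    using U_intros(1) by (auto simp: refl_on_def rot_rel_def intro: bexI[of _ 1])
  show "sym (Restr rot_rel (isub M m))"
  proof (rule symI)
    fix K L assume KL: "(K, L) \<in> Restr rot_rel (isub M m)"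
    then obtain u where u: "u \<in> U" "(*) u ` K = L" by (auto simp: rot_rel_def)
    have "(*) (cnj u) ` L = K" unfolding u(2)[symmetric] image_mult_mult using U_cnj(2)[OF u(1)] by simp
    thus "(L, K) \<in> Restr rot_rel (isub M m)" using KL U_intros(3)[OF u(1)] by (auto simp: rot_rel_def)
  qed
  show "trans (Restr rot_rel (isub M m))"
  proof (rule transI)
    fix K L N assume KL: "(K, L) \<in> Restr rot_rel (isub M m)" "(L, N) \<in> Restr rot_rel (isub M m)"
    then obtain u v where u: "u \<in> U" "(*) u ` K = L" "v \<in> U" "(*) v ` L = N" by (auto simp: rot_rel_def)
    have "(*) (v * u) ` K = N" unfolding u(4)[symmetric] u(2)[symmetric] image_mult_mult ..
    thus "(K, N) \<in> Restr rot_rel (isub M m)" using KL U_intros(2)[OF u(3,1)] by (auto simp: rot_rel_def)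
  qed
qed auto

lemma rot_class_eq:
  assumes m: "m > 0" and K: "K \<in> isub M m"
  shows "Restr rot_rel (isub M m) `` {K} = (\<lambda>u. (*) u ` K) ` stays K"
proof
  show "Restr rot_rel (isub M m) `` {K} \<subseteq> (\<lambda>u. (*) u ` K) ` stays K"
  proof
    fix L assume "L \<in> Restr rot_rel (isub M m) `` {K}"
    then obtain u where "u \<in> U" "(*) u ` K = L" "L \<in> isub M m" by (auto simp: rot_rel_def)
    moreover from this have "L \<subseteq> M" by (auto simp: isub_def)
    ultimately show "L \<in> (\<lambda>u. (*) u ` K) ` stays K" by (auto simp: stays_def)
  qed
  show "(\<lambda>u. (*) u ` K) ` stays K \<subseteq> Restr rot_rel (isub M m) `` {K}"
  proof (rule image_subsetI)
    fix u assume "u \<in> stays K"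
    hence u: "u \<in> U" "(*) u ` K \<subseteq> M" by (auto simp: stays_def)
    have "(*) u ` K \<in> isub M m" by (rule rot_isub[OF m K u])
    thus "(*) u ` K \<in> Restr rot_rel (isub M m) `` {K}" using K u(1) by (auto simp: rot_rel_def)
  qed
qed

text \<open>The map from \<open>u\<close> to the image of \<open>K\<close> has fibres
  \<open>{u, -u}\<close> and the class of \<open>K\<close> as its range; adding
  \<open>upper u\<close> makes it a bijection onto the class times \<open>bool\<close>. Finiteness
  comes from that of \<open>isub M m\<close>.\<close>

lemma stays_card:
  assumes m: "m > 0" and K: "K \<in> isub M m"
  shows "finite (stays K)" "card (stays K) = 2 * card (Restr rot_rel (isub M m) `` {K})"
    "card (stays K) > 0"
proof -
  let ?O = "Restr rot_rel (isub M m) `` {K}"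
  let ?f = "\<lambda>u. ((*) u ` K, upper u)"
  have inj: "inj_on ?f (stays K)"
  proof (rule inj_onI)
    fix u v assume uv: "u \<in> stays K" "v \<in> stays K" "?f u = ?f v"
    have U: "u \<in> U" "v \<in> U" using uv by (auto simp: stays_def)
    have "v = u \<or> v = - u" by (rule rot_eq_imp[OF m K U]) (use uv in simp)
    thus "u = v" using uv(3) upper_uminus[OF U_nonzero[OF U(1)]] by auto
  qed
  have sg: "is_subgroup K" using K by (auto simp: isub_def)
  have neg: "(*) (- u) ` K = (*) u ` K" for u
  proof -
    have "(\<lambda>x. - x) ` K = K"
      using is_subgroupD(3)[OF sg] by (auto intro!: image_eqI[where x = "- _"])
    hence "(*) u ` (\<lambda>x. - x) ` K = (*) u ` K" by simp
    thus ?thesis by (simp add: image_image)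
  qed
  have "?f ` stays K = ?O \<times> UNIV"
  proof
    show "?f ` stays K \<subseteq> ?O \<times> UNIV" unfolding rot_class_eq[OF m K] by auto
    show "?O \<times> UNIV \<subseteq> ?f ` stays K"
    proof clarify
      fix L :: "complex set" and s :: bool assume "(K, L) \<in> rot_rel" "K \<in> isub M m" "L \<in> isub M m"
      hence "L \<in> ?O" by auto
      then obtain u where u: "u \<in> stays K" "L = (*) u ` K" unfolding rot_class_eq[OF m K] by auto
      have nu: "- u \<in> stays K" using u(1) neg[of u] U_intros(4) by (auto simp: stays_def)
      have "upper u = s \<or> upper (- u) = s" using upper_uminus[of u] U_nonzero[of u] u(1) by (auto simp: stays_def)
      thus "(L, s) \<in> ?f ` stays K"
      proof
        assume "upper u = s" thus ?thesis using u by (intro image_eqI[of _ _ u]) auto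
      next
        assume "upper (- u) = s" thus ?thesis using u(2) nu neg[of u] by (intro image_eqI[of _ _ "- u"]) auto
      qed
    qed
  qed
  hence bij: "bij_betw ?f (stays K) (?O \<times> UNIV)" using inj by (simp add: bij_betw_def)
  have fO: "finite ?O" by (rule finite_subset[OF _ finite_isub[OF lattice_area m]]) auto
  hence "finite (?O \<times> (UNIV :: bool set))" by simp
  thus fin: "finite (stays K)" using bij_betw_finite[OF bij] by blast
  show c: "card (stays K) = 2 * card ?O"
    using bij_betw_same_card[OF bij] by (simp add: card_cartesian_product)
  have "1 \<in> stays K" using K U_intros(1) by (auto simp: stays_def isub_def)
  thus "card (stays K) > 0" using fin card_gt_0_iff by blast
qed

lemma class_count_sum:
  assumes m: "m > 0"
  shows "real (class_count m) = (\<Sum>K\<in>isub M m. 2 / real (card (stays K)))"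
proof -
  have "real (class_count m) = (\<Sum>K\<in>isub M m. 1 / real (card (Restr rot_rel (isub M m) `` {K})))"
    unfolding class_count_def by (rule card_quotient_sum[OF finite_isub[OF lattice_area m] equiv_rot])
  also have "\<dots> = (\<Sum>K\<in>isub M m. 2 / real (card (stays K)))"
    by (rule sum.cong[OF refl]) (simp add: stays_card(2)[OF m])
  finally show ?thesis .
qed

lemma class_count_le: "m > 0 \<Longrightarrow> class_count m \<le> card (isub M m)"
  unfolding class_count_def quotient_def
  by (simp add: UNION_singleton_eq_range card_image_le finite_isub lattice_area)

lemma isub_1: "isub M 1 = {M}"
proof -
  have "K = M" if K: "K \<in> isub M 1" for K
  proof
    show "K \<subseteq> M" using K by (auto simp: isub_def)
    show "M \<subseteq> K" using isub_mult_mem[OF lattice_area _ K] by auto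
  qed
  moreover have "M \<in> isub M 1" using isub_area[OF lattice_area, of 1 M] by auto
  ultimately show ?thesis by blast
qed

lemma class_count_1: "class_count 1 = 1"
proof -
  have "isub M 1 // Restr rot_rel (isub M 1) = {Restr rot_rel (isub M 1) `` {M}}"
    unfolding isub_1 by (auto simp: quotient_def)
  thus ?thesis unfolding class_count_def by simp
qed

text \<open>\<open>k M\<close> lies in \<open>L\<close>, so \<open>k u\<close> maps \<open>M\<close>
  into itself, and every multiplier of \<open>M\<close> in \<open>F\<close> is an algebraic
  integer.\<close>

lemma stays_denominator:
  assumes "k > 0" "L \<in> isub M k" "u \<in> stays L"
  shows "of_nat k * u \<in> OF"
proof (rule mult_M_in_OF)
  show "of_nat k * u \<in> F" using assms(3) by (auto simp: stays_def U_def intro: F_intros)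
  fix y assume "y \<in> M"
  hence "of_nat k * y \<in> L" by (rule isub_mult_mem[OF lattice_area assms(1,2)])
  hence "u * (of_nat k * y) \<in> M" using assms(3) by (auto simp: stays_def)
  thus "of_nat k * u * y \<in> M" by (simp add: mult_ac)
qed

text \<open>For coprime \<open>m1\<close>, \<open>m2\<close> the partial actions of \<open>U\<close> on sublattices of index \<open>m1\<close> and \<open>m2\<close> combine:
  \<open>u1\<close> acts as a unit away from \<open>m1\<close>, so \<open>u1 u2\<close> keeps \<open>K1 \<inter> K2\<close> inside \<open>M\<close>.\<close>

context
  fixes m1 m2 :: nat and K1 K2 :: "complex set"
  assumes m: "m1 > 0" "m2 > 0" "coprime m1 m2" and K: "K1 \<in> isub M m1" "K2 \<in> isub M m2"
begin

lemma stays_mult: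
  assumes u: "u1 \<in> stays K1" "u2 \<in> stays K2"
  shows "u1 * u2 \<in> stays (K1 \<inter> K2)"
proof -
  have d: "of_nat m1 * u1 \<in> OF" "of_nat m2 * u2 \<in> OF"
    using stays_denominator m K u by blast+
  have "u1 * u2 * x \<in> M" if x: "x \<in> K1 \<inter> K2" for x
  proof (rule bezout_membership[OF is_subgroup_zlat])
    show "coprime (int m2) (int m1)" using m(3) by (simp add: coprime_commute)
    have "u1 * x \<in> M" "u2 * x \<in> M" using u x by (auto simp: stays_def)
    hence "(of_nat m2 * u2) * (u1 * x) \<in> M" "(of_nat m1 * u1) * (u2 * x) \<in> M" using d lattice_mult by blast+
    thus "of_int (int m2) * (u1 * u2 * x) \<in> M" "of_int (int m1) * (u1 * u2 * x) \<in> M" by (simp_all add: mult_ac)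
  qed
  thus ?thesis using u U_intros(2) by (auto simp: stays_def)
qed

text \<open>The ratio \<open>v1 / u1\<close> equals \<open>u2 / v2\<close>. The first form has
  denominator dividing \<open>m1^2\<close>, the second \<open>m2^2\<close>, so the ratio is integral
  of modulus one.\<close>

lemma stays_mult_inj:
  assumes u: "u1 \<in> stays K1" "u2 \<in> stays K2" "v1 \<in> stays K1" "v2 \<in> stays K2" and eq: "u1 * u2 = v1 * v2"
  shows "v1 = u1 \<or> v1 = - u1"
proof -
  have UU: "u1 \<in> U" "u2 \<in> U" "v1 \<in> U" "v2 \<in> U" using u by (auto simp: stays_def)
  have d: "of_nat m1 * u1 \<in> OF" "of_nat m2 * u2 \<in> OF" "of_nat m1 * v1 \<in> OF" "of_nat m2 * v2 \<in> OF"
    using stays_denominator m K u by blast+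
  let ?w = "v1 * cnj u1"
  have w: "?w = u2 * cnj v2"
  proof -
    have "?w * (u1 * u2) * cnj v2 = v1 * (cnj u1 * u1) * u2 * cnj v2" by (simp add: mult_ac)
    also have "\<dots> = v1 * u2 * cnj v2" using U_cnj UU by simp
    finally have "?w * (v1 * v2) * cnj v2 = v1 * u2 * cnj v2" unfolding eq .
    hence "v1 * (?w * (v2 * cnj v2)) = v1 * (u2 * cnj v2)" by (simp add: mult_ac)
    thus ?thesis using U_cnj(1)[OF UU(4)] U_nonzero[OF UU(3)] by simp
  qed
  have "?w \<in> OF"
  proof (rule bezout_membership[OF is_subgroup_zlat])
    show "coprime (int (m1 ^ 2)) (int (m2 ^ 2))" using m(3) by simp
    have "(of_nat m1 * v1) * cnj (of_nat m1 * u1) \<in> OF" by (intro OF_mult OF_cnj d)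
    thus "of_int (int (m1 ^ 2)) * ?w \<in> OF" by (simp add: power2_eq_square mult_ac)
    have "(of_nat m2 * u2) * cnj (of_nat m2 * v2) \<in> OF" by (intro OF_mult OF_cnj d)
    thus "of_int (int (m2 ^ 2)) * ?w \<in> OF" unfolding w by (simp add: power2_eq_square mult_ac)
  qed
  moreover have "cmod ?w = 1" using UU by (simp add: U_def norm_mult)
  ultimately have "?w = 1 \<or> ?w = - 1" by (rule OF_unit[OF disc_not])
  hence "?w * u1 = u1 \<or> ?w * u1 = - u1" by auto
  moreover have "?w * u1 = v1" using U_cnj(2)[OF UU(1)] by (simp add: mult.assoc)
  ultimately show ?thesis by simp
qed

text \<open>A product determines the pair \<open>(u1, u2)\<close> up to a common sign, which
  \<open>upper u1\<close> fixes. The resulting injection bounds the cardinalities, and equality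
  means that it is onto.\<close>

lemma stays_Int_card:
  shows "card (stays K1) * card (stays K2) \<le> 2 * card (stays (K1 \<inter> K2))"
    and "card (stays K1) * card (stays K2) = 2 * card (stays (K1 \<inter> K2)) \<longleftrightarrow>
      (\<forall>u\<in>stays (K1 \<inter> K2). \<exists>u1\<in>stays K1. \<exists>u2\<in>stays K2. u = u1 * u2)"
proof -
  let ?f = "\<lambda>(u1, u2). (u1 * u2, upper u1)"
  let ?A = "stays K1 \<times> stays K2" and ?B = "stays (K1 \<inter> K2) \<times> (UNIV :: bool set)"
  have m12: "m1 * m2 > 0" using m by simp
  have K12: "K1 \<inter> K2 \<in> isub M (m1 * m2)" by (rule isub_Int[OF lattice_area m K])
  have fB: "finite ?B" using stays_card(1)[OF m12 K12] by simp
  have cB: "card ?B = 2 * card (stays (K1 \<inter> K2))" by (simp add: card_cartesian_product)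
  have inj: "inj_on ?f ?A"
  proof (rule inj_onI)
    fix p q assume pq: "p \<in> ?A" "q \<in> ?A" "?f p = ?f q"
    obtain u1 u2 v1 v2 where e: "p = (u1, u2)" "q = (v1, v2)" by (cases p, cases q)
    have s: "u1 \<in> stays K1" "u2 \<in> stays K2" "v1 \<in> stays K1" "v2 \<in> stays K2" using pq e by auto
    have eq: "u1 * u2 = v1 * v2" "upper u1 = upper v1" using pq(3) e by auto
    have u0: "u1 \<noteq> 0" using s(1) U_nonzero by (auto simp: stays_def)
    have "v1 = u1 \<or> v1 = - u1" by (rule stays_mult_inj[OF s eq(1)])
    hence "v1 = u1" using eq(2) upper_uminus[OF u0] by auto
    thus "p = q" using eq(1) u0 e by simp
  qed
  have sub: "?f ` ?A \<subseteq> ?B" using stays_mult by auto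
  have cA: "card (?f ` ?A) = card (stays K1) * card (stays K2)"
    using card_image[OF inj] by (simp add: card_cartesian_product)
  show "card (stays K1) * card (stays K2) \<le> 2 * card (stays (K1 \<inter> K2))"
    using card_mono[OF fB sub] cA cB by simp
  have "card (stays K1) * card (stays K2) = 2 * card (stays (K1 \<inter> K2)) \<longleftrightarrow> ?f ` ?A = ?B"
  proof
    assume "card (stays K1) * card (stays K2) = 2 * card (stays (K1 \<inter> K2))"
    thus "?f ` ?A = ?B" by (intro card_subset_eq[OF fB sub]) (simp only: cA cB)
  next
    assume "?f ` ?A = ?B"
    hence "card (?f ` ?A) = card ?B" by (simp only:)
    thus "card (stays K1) * card (stays K2) = 2 * card (stays (K1 \<inter> K2))" by (simp only: cA cB)
  qed
  also have "\<dots> \<longleftrightarrow> (\<forall>u\<in>stays (K1 \<inter> K2). \<exists>u1\<in>stays K1. \<exists>u2\<in>stays K2. u = u1 * u2)"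
  proof
    assume eq: "?f ` ?A = ?B"
    show "\<forall>u\<in>stays (K1 \<inter> K2). \<exists>u1\<in>stays K1. \<exists>u2\<in>stays K2. u = u1 * u2"
    proof
      fix u assume "u \<in> stays (K1 \<inter> K2)"
      hence "(u, True) \<in> ?f ` ?A" unfolding eq by simp
      thus "\<exists>u1\<in>stays K1. \<exists>u2\<in>stays K2. u = u1 * u2" by auto
    qed
  next
    assume *: "\<forall>u\<in>stays (K1 \<inter> K2). \<exists>u1\<in>stays K1. \<exists>u2\<in>stays K2. u = u1 * u2"
    have neg: "- u \<in> stays L" if "u \<in> stays L" for u L
      using that U_intros(4) zlat_uminus by (fastforce simp: stays_def)
    have "(u, s) \<in> ?f ` ?A" if v: "u \<in> stays (K1 \<inter> K2)" for u s
    proof -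
      obtain u1 u2 where u: "u1 \<in> stays K1" "u2 \<in> stays K2" "u = u1 * u2" using * v by blast
      have "upper u1 = s \<or> upper (- u1) = s" using upper_uminus[of u1] U_nonzero[of u1] u(1) by (auto simp: stays_def)
      thus ?thesis
      proof
        assume "upper u1 = s"
        thus ?thesis using u by (intro image_eqI[of _ _ "(u1, u2)"]) auto
      next
        assume "upper (- u1) = s"
        thus ?thesis using u neg by (intro image_eqI[of _ _ "(- u1, - u2)"]) auto
      qed
    qed
    thus "?f ` ?A = ?B" using sub by auto
  qed
  finally show "card (stays K1) * card (stays K2) = 2 * card (stays (K1 \<inter> K2)) \<longleftrightarrow>
      (\<forall>u\<in>stays (K1 \<inter> K2). \<exists>u1\<in>stays K1. \<exists>u2\<in>stays K2. u = u1 * u2)" .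
qed

end

text \<open>Splitting sublattices along \<open>m1\<close> and \<open>m2\<close> makes both sides
  sums over the same pairs, compared term by term. Because no term is larger on the left, equality
  of the sums forces equality of all terms.\<close>

theorem class_count_submultiplicative:
  assumes m: "m1 > 0" "m2 > 0" "coprime m1 m2"
  shows "class_count (m1 * m2) \<le> class_count m1 * class_count m2"
    and "class_count (m1 * m2) = class_count m1 * class_count m2 \<longleftrightarrow>
      (\<forall>K1\<in>isub M m1. \<forall>K2\<in>isub M m2. \<forall>u\<in>stays (K1 \<inter> K2). \<exists>u1\<in>stays K1. \<exists>u2\<in>stays K2. u = u1 * u2)"
proof -
  let ?X = "isub M m1 \<times> isub M m2"
  define f where "f = (\<lambda>(K1, K2). 2 / real (card (stays (K1 \<inter> K2))))"
  define g where "g = (\<lambda>(K1, K2). (2 / real (card (stays K1))) * (2 / real (card (stays K2))))"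
  have m12: "m1 * m2 > 0" using m by simp
  have fin: "finite ?X" using finite_isub[OF lattice_area] m by simp
  have "real (class_count (m1 * m2)) = (\<Sum>K\<in>isub M (m1 * m2). 2 / real (card (stays K)))"
    by (rule class_count_sum[OF m12])
  also have "\<dots> = (\<Sum>p\<in>?X. f p)"
    using sum.reindex_bij_betw[OF bij_betw_isub_Int[OF lattice_area m], of "\<lambda>K. 2 / real (card (stays K))"]
    by (simp add: f_def case_prod_unfold)
  finally have F: "real (class_count (m1 * m2)) = (\<Sum>p\<in>?X. f p)" .
  have G: "real (class_count m1 * class_count m2) = (\<Sum>p\<in>?X. g p)"
    by (simp add: class_count_sum m g_def sum_product sum.cartesian_product)
  have pos: "real (card (stays K1)) > 0" "real (card (stays K2)) > 0" "real (card (stays (K1 \<inter> K2))) > 0"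
    if "K1 \<in> isub M m1" "K2 \<in> isub M m2" for K1 K2
    using stays_card(3)[OF m(1) that(1)] stays_card(3)[OF m(2) that(2)]
      stays_card(3)[OF m12 isub_Int[OF lattice_area m that]] by simp_all
  have fg: "f (K1, K2) \<le> g (K1, K2) \<and> (f (K1, K2) = g (K1, K2) \<longleftrightarrow>
      (\<forall>u\<in>stays (K1 \<inter> K2). \<exists>u1\<in>stays K1. \<exists>u2\<in>stays K2. u = u1 * u2))"
    if K: "K1 \<in> isub M m1" "K2 \<in> isub M m2" for K1 K2
  proof -
    note p = pos[OF K]
    have "real (card (stays K1) * card (stays K2)) \<le> real (2 * card (stays (K1 \<inter> K2)))"
      unfolding of_nat_le_iff by (rule stays_Int_card(1)[OF m K])
    hence 1: "real (card (stays K1)) * real (card (stays K2)) \<le> 2 * real (card (stays (K1 \<inter> K2)))" by simp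
    have "f (K1, K2) \<le> g (K1, K2)" using p 1 by (simp add: f_def g_def divide_simps)
    moreover have "f (K1, K2) = g (K1, K2) \<longleftrightarrow>
        real (card (stays K1)) * real (card (stays K2)) = 2 * real (card (stays (K1 \<inter> K2)))"
      using p by (auto simp: f_def g_def divide_simps)
    moreover have "\<dots> \<longleftrightarrow> real (card (stays K1) * card (stays K2)) = real (2 * card (stays (K1 \<inter> K2)))" by simp
    ultimately show ?thesis using stays_Int_card(2)[OF m K] by (simp only: of_nat_eq_iff simp_thms)
  qed
  have le: "(\<Sum>p\<in>?X. f p) \<le> (\<Sum>p\<in>?X. g p)" by (rule sum_mono) (use fg in auto)
  have "real (class_count (m1 * m2)) \<le> real (class_count m1 * class_count m2)" unfolding F G by (rule le)
  thus "class_count (m1 * m2) \<le> class_count m1 * class_count m2" by (simp only: of_nat_le_iff)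
  have "class_count (m1 * m2) = class_count m1 * class_count m2 \<longleftrightarrow> (\<Sum>p\<in>?X. f p) = (\<Sum>p\<in>?X. g p)"
    unfolding F[symmetric] G[symmetric] by (simp only: of_nat_eq_iff)
  also have "\<dots> \<longleftrightarrow> (\<forall>p\<in>?X. f p = g p)"
    using sum_mono_inv[of f ?X g] fg fin by (auto intro!: sum.cong)
  also have "\<dots> \<longleftrightarrow> (\<forall>K1\<in>isub M m1. \<forall>K2\<in>isub M m2. \<forall>u\<in>stays (K1 \<inter> K2). \<exists>u1\<in>stays K1. \<exists>u2\<in>stays K2. u = u1 * u2)"
    using fg by simp
  finally show "class_count (m1 * m2) = class_count m1 * class_count m2 \<longleftrightarrow>
      (\<forall>K1\<in>isub M m1. \<forall>K2\<in>isub M m2. \<forall>u\<in>stays (K1 \<inter> K2). \<exists>u1\<in>stays K1. \<exists>u2\<in>stays K2. u = u1 * u2)" .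
qed

end

section \<open>Multiplicativity and the class group\<close>

text \<open>\<open>x\<close> is the product of the primes dividing \<open>a\<close> but not
  \<open>c\<close>. At such a prime the value is congruent to \<open>c\<close>. At a prime dividing
  \<open>a\<close> and \<open>c\<close> it is congruent to \<open>b x\<close>, where
  \<open>b\<close> is a unit by primitivity and \<open>x\<close> by construction.\<close>

lemma exists_coprime_value:
  fixes a b c :: int
  assumes a: "a > 0" and g: "gcd a (gcd b c) = 1"
  obtains x where "coprime a (a * x\<^sup>2 + b * x + c)"
proof -
  define P where "P = {p \<in> prime_factors a. \<not> p dvd c}"
  define x where "x = \<Prod>P"
  have fin: "finite P" by (simp add: P_def)
  have "coprime a (a * x\<^sup>2 + b * x + c)"
  proof (rule ccontr)
    assume nc: "\<not> coprime a (a * x\<^sup>2 + b * x + c)"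
    hence "gcd a (a * x\<^sup>2 + b * x + c) \<noteq> 1" by (simp add: coprime_iff_gcd_eq_1)
    moreover have "gcd a (a * x\<^sup>2 + b * x + c) \<noteq> 0" using a by simp
    ultimately obtain p where p: "prime p" "p dvd gcd a (a * x\<^sup>2 + b * x + c)"
      by (metis abs_gcd_int prime_divisor_exists zdvd1_eq)
    hence pa: "p dvd a" and pv: "p dvd a * x\<^sup>2 + b * x + c" by simp_all
    hence pv': "p dvd b * x + c" by (metis dvd_add_right_iff dvd_mult2 add.assoc)
    have pP: "p \<in> prime_factors a" using p(1) pa a by (simp add: in_prime_factors_iff)
    show False
    proof (cases "p dvd c")
      case False
      hence "p \<in> P" using pP by (simp add: P_def)
      hence "p dvd x" unfolding x_def by (intro dvd_prodI fin)
      hence "p dvd b * x" by simp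
      hence "p dvd c" using pv' by (simp add: dvd_add_right_iff)
      thus False using False by simp
    next
      case True
      hence "p dvd b * x" using pv' by (simp add: dvd_add_left_iff)
      hence "p dvd b \<or> p dvd x" using p(1) prime_dvd_mult_iff by blast
      thus False
      proof
        assume "p dvd b"
        hence "p dvd gcd a (gcd b c)" using pa True by simp
        thus False using g p(1) not_prime_unit by auto
      next
        assume "p dvd x"
        then obtain q where q: "q \<in> P" "p dvd q" unfolding x_def using prime_dvd_prod_iff[OF fin p(1), of "\<lambda>x. x"] by auto
        hence "prime q" "\<not> q dvd c" by (auto simp: P_def)
        hence "p = q" using q(2) p(1) by (simp add: primes_dvd_imp_eq)
        thus False using True \<open>\<not> q dvd c\<close> by simp
      qed
    qed
  qed
  thus ?thesis by (rule that)
qed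

lemma area_cnj: "area (cnj a) (cnj b) = - area a b"
  by (simp add: area_alt)

lemma cnj_imul: "cnj ` imul I J = imul (cnj ` I) (cnj ` J)"
proof -
  have sub: "cnj ` imul I J \<subseteq> imul (cnj ` I) (cnj ` J)" for I J
  proof -
    have "imul I J \<subseteq> {x. cnj x \<in> imul (cnj ` I) (cnj ` J)}"
      by (rule imul_subset) (auto intro: imul_mult imul_closed)
    thus ?thesis by blast
  qed
  have "cnj ` imul (cnj ` I) (cnj ` J) \<subseteq> imul I J" using sub[of "cnj ` I" "cnj ` J"] by (simp add: image_image)
  hence "cnj ` cnj ` imul (cnj ` I) (cnj ` J) \<subseteq> cnj ` imul I J" by blast
  thus ?thesis using sub[of I J] by (simp add: image_image)
qed

context ideal_lattice begin

lemma imul_cancel: "fi I \<Longrightarrow> fi J \<Longrightarrow> fi K \<Longrightarrow> imul I J = imul I K \<Longrightarrow> J = K"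
proof -
  interpret comm_group "ideal_group F" by (rule ideal_comm_group)
  show "fi I \<Longrightarrow> fi J \<Longrightarrow> fi K \<Longrightarrow> imul I J = imul I K \<Longrightarrow> J = K"
    using right_cancel[of I J K] by (simp add: imul_commute)
qed

text \<open>Conjugation only changes the sign of areas, whereas \<open>w\<close> scales them by the
  square of its modulus.\<close>

lemma conj_multiplier_norm:
  assumes "fi I" "cnj ` I = (*) w ` I"
  shows "cmod w = 1"
proof -
  obtain \<alpha> \<beta> where b: "\<alpha> \<noteq> 0" "I = (*) \<alpha> ` zlat 1 \<beta>" "Im \<beta> > 0"
    using fi_reduced_basis[OF assms(1)] by metis
  hence I: "I = zlat (\<alpha> * 1) (\<alpha> * \<beta>)" using image_mult_zlat by metis
  have ar: "area (\<alpha> * 1) (\<alpha> * \<beta>) \<noteq> 0" unfolding area_mult using b by (simp add: area_alt)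
  have "zlat (cnj (\<alpha> * 1)) (cnj (\<alpha> * \<beta>)) = zlat (w * (\<alpha> * 1)) (w * (\<alpha> * \<beta>))"
    using assms(2) unfolding I image_cnj_zlat image_mult_zlat .
  hence "\<bar>area (cnj (\<alpha> * 1)) (cnj (\<alpha> * \<beta>))\<bar> = \<bar>area (w * (\<alpha> * 1)) (w * (\<alpha> * \<beta>))\<bar>" by (rule zlat_area_unique)
  also have "area (cnj (\<alpha> * 1)) (cnj (\<alpha> * \<beta>)) = - area (\<alpha> * 1) (\<alpha> * \<beta>)" by (rule area_cnj)
  finally have "\<bar>area (\<alpha> * 1) (\<alpha> * \<beta>)\<bar> = (cmod w)\<^sup>2 * \<bar>area (\<alpha> * 1) (\<alpha> * \<beta>)\<bar>"
    unfolding area_mult[of w] by (simp add: abs_mult)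
  hence "(cmod w)\<^sup>2 = 1" using ar by simp
  thus ?thesis by (simp add: power2_eq_1_iff) (use norm_ge_zero[of w] in linarith)
qed

definition den_ideal :: "complex \<Rightarrow> complex set" where
  "den_ideal u = {x \<in> OF. u * x \<in> OF}"

lemma den_ideal_fi:
  assumes "u \<in> U" shows "fi (den_ideal u)"
proof -
  obtain d :: nat where d: "d > 0" "of_nat d * u \<in> OF" using F_denominator assms U_def by auto
  show ?thesis
  proof (rule fiI[of _ "of_nat d" 1])
    show "a * x \<in> den_ideal u" if "a \<in> OF" "x \<in> den_ideal u" for a x
      using that OF_mult[of a x] OF_mult[of a "u * x"] by (simp add: den_ideal_def mult.left_commute)
    show "of_nat d \<in> den_ideal u" using d OF_of_nat by (simp add: den_ideal_def mult.commute)
  qed (use d OF_subset_F zlat_add in \<open>auto simp: den_ideal_def distrib_left\<close>)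
qed

text \<open>If \<open>x\<close> and \<open>u x\<close> are integral, then
  \<open>y = cnj (u x)\<close> satisfies \<open>u y = cnj x\<close>, so conjugation exchanges the
  two integrality conditions.\<close>

lemma den_ideal_cnj:
  assumes u: "u \<in> U" shows "(*) u ` den_ideal u = cnj ` den_ideal u"
proof
  show "(*) u ` den_ideal u \<subseteq> cnj ` den_ideal u"
  proof (rule image_subsetI)
    fix x assume x: "x \<in> den_ideal u"
    have e: "u * cnj (u * x) = cnj x" using U_cnj(1)[OF u] by (simp flip: mult.assoc)
    hence "cnj (u * x) \<in> den_ideal u" using x OF_cnj[of x] OF_cnj[of "u * x"] e
      by (simp add: den_ideal_def del: complex_cnj_mult)
    hence "cnj (cnj (u * x)) \<in> cnj ` den_ideal u" by (rule imageI)
    thus "u * x \<in> cnj ` den_ideal u" by simp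
  qed
  show "cnj ` den_ideal u \<subseteq> (*) u ` den_ideal u"
  proof (rule image_subsetI)
    fix x assume x: "x \<in> den_ideal u"
    have e: "u * cnj (u * x) = cnj x" using U_cnj(1)[OF u] by (simp flip: mult.assoc)
    hence "cnj (u * x) \<in> den_ideal u" using x OF_cnj[of x] OF_cnj[of "u * x"]
      by (simp add: den_ideal_def del: complex_cnj_mult)
    thus "cnj x \<in> (*) u ` den_ideal u" using e by (metis imageI)
  qed
qed

lemma add_mult_OF_fi:
  assumes A: "fi A" "A \<subseteq> OF" and m: "m > 0"
  shows "fi (add_mult A m OF)"
proof (rule fiI[of _ "of_nat m" 1])
  have sg: "is_subgroup (add_mult A m OF)"
    using fiD(2,6)[OF A(1)] by (intro is_subgroup_add_mult is_subgroup_zlat) (auto simp: is_subgroup_def)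
  show "0 \<in> add_mult A m OF" by (rule is_subgroupD(1)[OF sg])
  show "x + y \<in> add_mult A m OF" if "x \<in> add_mult A m OF" "y \<in> add_mult A m OF" for x y
    using that by (rule is_subgroupD(4)[OF sg])
  have sub: "x \<in> OF" if x: "x \<in> add_mult A m OF" for x
    using x A(2) zlat_add OF_mult OF_of_nat unfolding add_mult_def by blast
  thus "x \<in> F" "of_nat 1 * x \<in> OF" if "x \<in> add_mult A m OF" for x using OF_subset_F that by auto
  show "a * x \<in> add_mult A m OF" if ax: "a \<in> OF" "x \<in> add_mult A m OF" for a x
  proof -
    obtain p q where pq: "x = p + of_nat m * q" "p \<in> A" "q \<in> OF" using ax(2) unfolding add_mult_def by blast
    have "a * x = a * p + of_nat m * (a * q)" using pq by (simp add: algebra_simps)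
    moreover have "a * p \<in> A" "a * q \<in> OF" using fiD(4)[OF A(1)] OF_mult ax(1) pq by auto
    ultimately show ?thesis unfolding add_mult_def by blast
  qed
  show "of_nat m \<in> add_mult A m OF" using add_mult_memI2[OF OF_1 fiD(2)[OF A(1)], of m] by simp
qed (use m in auto)

text \<open>A product of elements of \<open>A + (m1)\<close> and \<open>A + (m2)\<close> lies in
  \<open>A + (m1 m2)\<close>, which is \<open>A\<close>. Conversely, for \<open>x\<close> in
  \<open>A\<close> both \<open>m1 x\<close> and \<open>m2 x\<close> are products, and Bezout gives
  \<open>x\<close>.\<close>

lemma imul_add_mult_coprime:
  assumes A: "fi A" "A \<subseteq> OF" and m: "coprime m1 m2" "of_nat (m1 * m2) \<in> A"
  shows "imul (add_mult A m1 OF) (add_mult A m2 OF) = A"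
proof
  note D = fiD[OF A(1)]
  have sg: "is_subgroup A" using D by (auto simp: is_subgroup_def)
  show "imul (add_mult A m1 OF) (add_mult A m2 OF) \<subseteq> A"
  proof (rule imul_subset)
    fix x y assume xy: "x \<in> add_mult A m1 OF" "y \<in> add_mult A m2 OF"
    obtain p q where p: "x = p + of_nat m1 * q" "p \<in> A" "q \<in> OF" using xy(1) unfolding add_mult_def by blast
    obtain r s where r: "y = r + of_nat m2 * s" "r \<in> A" "s \<in> OF" using xy(2) unfolding add_mult_def by blast
    have "x * y = (r + of_nat m2 * s) * p + (of_nat m1 * q) * r + (q * s) * of_nat (m1 * m2)"
      by (simp add: p(1) r(1) algebra_simps)
    moreover have "r \<in> OF" using A(2) r(2) by blast
    ultimately show "x * y \<in> A"
      using p r m(2) by (auto intro!: D(3) D(4) zlat_add OF_mult OF_of_nat)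
  qed (use D in auto)
  show "A \<subseteq> imul (add_mult A m1 OF) (add_mult A m2 OF)"
  proof
    fix x assume x: "x \<in> A"
    have x12: "x \<in> add_mult A m1 OF" "x \<in> add_mult A m2 OF" using x by (auto intro: add_mult_memI)
    have m12: "of_nat m1 \<in> add_mult A m1 OF" "of_nat m2 \<in> add_mult A m2 OF"
      using add_mult_memI2[OF OF_1 D(2), of m1] add_mult_memI2[OF OF_1 D(2), of m2] by simp_all
    show "x \<in> imul (add_mult A m1 OF) (add_mult A m2 OF)"
    proof (rule bezout_membership)
      show "is_subgroup (imul (add_mult A m1 OF) (add_mult A m2 OF))"
        using imul_closed by (auto simp: is_subgroup_def)
      show "coprime (int m1) (int m2)" using m(1) by simp
      show "of_int (int m1) * x \<in> imul (add_mult A m1 OF) (add_mult A m2 OF)"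
        using imul_mult[OF m12(1) x12(2)] by simp
      show "of_int (int m2) * x \<in> imul (add_mult A m1 OF) (add_mult A m2 OF)"
        using imul_mult[OF x12(1) m12(2)] by (simp add: mult.commute)
    qed
  qed
qed

text \<open>\<open>m1 u1 x\<close> lies in \<open>M\<close> because \<open>m1 u1\<close> is
  integral. Also \<open>m2 x\<close> lies in the intersection, so \<open>u1 u2 m2 x\<close> is in
  \<open>M\<close>, and the integer \<open>m2 cnj u2\<close> cancels \<open>u2\<close>, leaving
  \<open>m2^2 u1 x\<close>.\<close>

lemma stays_of_denominators:
  assumes m: "m1 > 0" "m2 > 0" "coprime m1 m2" and K: "K1 \<in> isub M m1" "K2 \<in> isub M m2"
    and u: "u1 * u2 \<in> stays (K1 \<inter> K2)" "u1 \<in> U" "u2 \<in> U" and d: "of_nat m1 * u1 \<in> OF" "of_nat m2 * u2 \<in> OF"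
  shows "u1 \<in> stays K1"
proof -
  have "u1 * x \<in> M" if x: "x \<in> K1" for x
  proof (rule bezout_membership[OF is_subgroup_zlat])
    show "coprime (int m1) (int (m2\<^sup>2))" using m(3) by simp
    have xM: "x \<in> M" using x K by (auto simp: isub_def)
    have "(of_nat m1 * u1) * x \<in> M" by (rule lattice_mult[OF d(1) xM])
    thus "of_int (int m1) * (u1 * x) \<in> M" by (simp add: mult_ac)
    have sg: "is_subgroup K1" using K by (auto simp: isub_def)
    have "of_nat m2 * x \<in> K1 \<inter> K2"
      using subgroup_int_mult[OF sg x, of "int m2"] isub_mult_mem[OF lattice_area m(2) K(2) xM] by simp
    hence "(u1 * u2) * (of_nat m2 * x) \<in> M" using u(1) by (auto simp: stays_def)
    hence "cnj (of_nat m2 * u2) * ((u1 * u2) * (of_nat m2 * x)) \<in> M"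
      by (rule lattice_mult[OF OF_cnj[OF d(2)]])
    also have "cnj (of_nat m2 * u2) * ((u1 * u2) * (of_nat m2 * x)) = (u2 * cnj u2) * (of_int (int (m2\<^sup>2)) * (u1 * x))"
      by (simp add: power2_eq_square mult_ac)
    finally show "of_int (int (m2\<^sup>2)) * (u1 * x) \<in> M" using U_cnj(1)[OF u(3)] by simp
  qed
  thus ?thesis using u(2) by (auto simp: stays_def)
qed

lemma factor_of_ideal_condition:
  assumes C: "\<And>I. fi I \<Longrightarrow> \<exists>w\<in>F. w \<noteq> 0 \<and> cnj ` I = (*) w ` I"
    and m: "m1 > 0" "m2 > 0" "coprime m1 m2" and K: "K1 \<in> isub M m1" "K2 \<in> isub M m2"
    and u: "u \<in> stays (K1 \<inter> K2)"
  shows "\<exists>u1\<in>stays K1. \<exists>u2\<in>stays K2. u = u1 * u2"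
proof -
  have uU: "u \<in> U" using u by (simp add: stays_def)
  have m12: "m1 * m2 > 0" using m by simp
  have K12: "K1 \<inter> K2 \<in> isub M (m1 * m2)" by (rule isub_Int[OF lattice_area m K])
  have mu: "of_nat (m1 * m2) * u \<in> OF" by (rule stays_denominator[OF m12 K12 u])
  let ?A = "den_ideal u"
  let ?A1 = "add_mult ?A m1 OF" and ?A2 = "add_mult ?A m2 OF"
  have A: "fi ?A" "?A \<subseteq> OF" using den_ideal_fi[OF uU] by (auto simp: den_ideal_def)
  have mA: "of_nat (m1 * m2) \<in> ?A" using mu OF_of_nat[of "m1 * m2"] by (simp add: den_ideal_def mult.commute)
  have A1: "fi ?A1" and A2: "fi ?A2" using add_mult_OF_fi[OF A] m by auto
  have prod: "imul ?A1 ?A2 = ?A" by (rule imul_add_mult_coprime[OF A m(3) mA])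
  \<comment> \<open>This multiplier is the first factor of \<open>u\<close>; the quotient
    \<open>u / w\<close> will belong to \<open>A2\<close>.\<close>
  obtain w where w: "w \<in> F" "w \<noteq> 0" "cnj ` ?A1 = (*) w ` ?A1" using C[OF A1] by blast
  have "cmod w = 1" by (rule conj_multiplier_norm[OF A1 w(3)])
  hence wU: "w \<in> U" using w(1) by (simp add: U_def)
  define v where "v = u / w"
  have vU: "v \<in> U" unfolding v_def by (intro U_intros uU wU)
  have uwv: "u = w * v" using w(2) by (simp add: v_def)
  \<comment> \<open>Since \<open>u\<close> carries \<open>A1 A2\<close> to its conjugate and
    \<open>w\<close> carries \<open>A1\<close> to its own, cancelling \<open>A1\<close> leaves
    \<open>u / w\<close> carrying \<open>A2\<close> to its conjugate.\<close>
  have "imul ?A1 ((*) u ` ?A2) = (*) u ` ?A" by (simp add: imul_scale_right prod)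
  also have "\<dots> = cnj ` imul ?A1 ?A2" unfolding prod by (rule den_ideal_cnj[OF uU])
  also have "\<dots> = imul ?A1 ((*) w ` cnj ` ?A2)" unfolding cnj_imul w(3) imul_scale imul_scale_right ..
  finally have "(*) u ` ?A2 = (*) w ` cnj ` ?A2"
    by (rule imul_cancel[rotated 3]) (use A1 A2 uU U_nonzero w in \<open>auto intro!: fi_scale fi_cnj simp: U_def\<close>)
  hence v2: "(*) v ` ?A2 = cnj ` ?A2"
    using image_mult_inverse[OF w(2)] by (metis image_mult_mult mult.commute times_divide_eq_right mult_1_right v_def)
  have sub: "add_mult ?A m OF \<subseteq> OF" for m using A(2) zlat_add OF_mult OF_of_nat unfolding add_mult_def by blast
  have mem: "of_nat m \<in> add_mult ?A m OF" for m using add_mult_memI2[OF OF_1 fiD(2)[OF A(1)], of m] by simp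
  \<comment> \<open>\<open>m1\<close> lies in \<open>A1\<close>, so \<open>w m1\<close> lies in the
    integral ideal conjugate to \<open>A1\<close>: the denominator of \<open>w\<close> involves only
    \<open>m1\<close>.\<close>
  have "w * of_nat m1 \<in> cnj ` ?A1" using mem[of m1] unfolding w(3) by blast
  then obtain y where "y \<in> ?A1" "w * of_nat m1 = cnj y" by blast
  hence d1: "of_nat m1 * w \<in> OF" using OF_cnj[OF subsetD[OF sub]] by (metis mult.commute)
  have "v * of_nat m2 \<in> cnj ` ?A2" using mem[of m2] unfolding v2[symmetric] by blast
  then obtain y' where "y' \<in> ?A2" "v * of_nat m2 = cnj y'" by blast
  hence d2: "of_nat m2 * v \<in> OF" using OF_cnj[OF subsetD[OF sub]] by (metis mult.commute)
  have "w \<in> stays K1"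
    by (rule stays_of_denominators[OF m K _ wU vU d1 d2]) (use u uwv in simp)
  moreover have "v \<in> stays K2"
    by (rule stays_of_denominators[OF m(2,1) _ K(2,1) _ vU wU d2 d1])
      (use u uwv m(3) in \<open>simp_all add: coprime_commute Int_commute mult.commute\<close>)
  ultimately show ?thesis using uwv by blast
qed

lemma scaled_lattice_isub:
  assumes "k > 0" shows "zlat (of_nat k * \<mu>) (of_nat k * \<nu>) \<in> isub M (k\<^sup>2)"
  using hermite_in_isub[OF lattice_area, of "int k" "int k" "k\<^sup>2" 0] assms by (simp add: power2_eq_square)

lemma scaled_lattice_mem: "x \<in> zlat (of_nat k * \<mu>) (of_nat k * \<nu>) \<longleftrightarrow> (\<exists>y\<in>M. x = of_nat k * y)"
  unfolding image_mult_zlat[symmetric] by blast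

text \<open>With \<open>J = \<int> + \<int> \<beta>\<close> of norm \<open>1 / a\<close> and \<open>z = x + \<beta>\<close> in \<open>J\<close>, the ideals \<open>a J\<close> and
  \<open>a cnj z J\<close> are integral of coprime norms \<open>a\<close> and \<open>k = a |z|\<^sup>2\<close>, and \<open>u = z / cnj z\<close> carries
  the product of the conjugate of one with the other to its conjugate.\<close>

lemma ideal_condition_of_factor:
  assumes fac: "\<And>m1 m2 K1 K2 u. m1 > 0 \<Longrightarrow> m2 > 0 \<Longrightarrow> coprime m1 m2 \<Longrightarrow> K1 \<in> isub M m1 \<Longrightarrow> K2 \<in> isub M m2 \<Longrightarrow>
      u \<in> stays (K1 \<inter> K2) \<Longrightarrow> \<exists>u1\<in>stays K1. \<exists>u2\<in>stays K2. u = u1 * u2"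
    and I: "fi I"
  shows "\<exists>w\<in>F. w \<noteq> 0 \<and> cnj ` I = (*) w ` I"
proof -
  obtain \<alpha> \<beta> where b: "\<alpha> \<in> I" "\<alpha> \<noteq> 0" "I = (*) \<alpha> ` zlat 1 \<beta>" "Im \<beta> > 0"
    using fi_reduced_basis[OF I] by metis
  let ?J = "zlat 1 \<beta>"
  have aF: "\<alpha> \<in> F" using fiD(1)[OF I] b(1) .
  have "?J = (*) (1 / \<alpha>) ` I" by (rule image_mult_inverse[OF b(2,3)])
  hence J: "fi ?J" using fi_scale[OF I, of "1 / \<alpha>"] aF b(2) by (simp add: F_intros)
  obtain a b' c where abc: "a > 0" "gcd a (gcd b' c) = 1" "of_int a * (\<beta> + cnj \<beta>) = of_int b'"
    "of_int a * (\<beta> * cnj \<beta>) = of_int c" "OF = zlat 1 (of_int a * \<beta>)"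
    using primitive_quadratic[OF J b(4)] by metis
  have a0: "(of_int a :: complex) \<noteq> 0" using abc(1) by simp
  have JJ: "of_int a * (x * cnj y) \<in> OF" if "x \<in> ?J" "y \<in> ?J" for x y
  proof -
    have "x * cnj y \<in> (*) (1 / of_int a) ` OF"
      unfolding imul_cnj_lattice[OF J abc, symmetric] using that by (intro imul_mult imageI)
    thus ?thesis using a0 by auto
  qed
  have OFJ: "OF \<subseteq> ?J" using fiD(4)[OF J, of _ 1] by auto
  \<comment> \<open>The chosen value of the form is \<open>a\<close> times the norm of
    \<open>x + \<beta>\<close>; its coprimality to \<open>a\<close> separates the two
    denominators.\<close>
  obtain x where x: "coprime a (a * x\<^sup>2 + b' * x + c)" using exists_coprime_value[OF abc(1,2)] by blast
  define z where "z = of_int x + \<beta>"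
  have zJ: "z \<in> ?J" unfolding z_def using zlat_1I[of x 1 \<beta>] by simp
  have z0: "z \<noteq> 0" using b(4) by (auto simp: z_def complex_eq_iff)
  define k where "k = a * x\<^sup>2 + b' * x + c"
  have kz: "of_int a * (z * cnj z) = of_int k"
  proof -
    have "of_int a * (z * cnj z) = of_int (a * x\<^sup>2) + of_int x * (of_int a * (\<beta> + cnj \<beta>)) + of_int a * (\<beta> * cnj \<beta>)"
      by (simp add: z_def power2_eq_square algebra_simps)
    thus ?thesis unfolding abc(3,4) by (simp add: k_def mult.commute)
  qed
  have zz: "z * cnj z = complex_of_real ((cmod z)\<^sup>2)" by (simp only: complex_norm_square)
  have "of_int k = complex_of_real (of_int a * (cmod z)\<^sup>2)" unfolding kz[symmetric] zz by simp
  hence "real_of_int k = of_int a * (cmod z)\<^sup>2" by (metis of_real_eq_iff of_real_of_int_eq)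
  also have "\<dots> > 0" using abc(1) z0 by simp
  finally have k: "k > 0" by simp
  define m1 where "m1 = nat a"
  define m2 where "m2 = nat k"
  have m: "m1 > 0" "m2 > 0" "of_nat m1 = (of_int a :: complex)" "of_nat m2 = (of_int k :: complex)"
    using abc(1) k by (simp_all add: m1_def m2_def)
  have cop: "coprime m1 m2"
  proof -
    have "coprime (int m1) (int m2)" using x k abc(1) by (simp add: m1_def m2_def k_def)
    thus ?thesis by simp
  qed
  have zF: "z \<in> F" using fiD(1)[OF J zJ] .
  define u where "u = z / cnj z"
  have uU: "u \<in> U" using zF z0 by (simp add: u_def U_def norm_divide F_intros cnj_F)
  have u_eq: "of_int k * u = of_int a * z\<^sup>2"
    unfolding kz[symmetric] u_def using z0 by (simp add: power2_eq_square)
  \<comment> \<open>For the scaled lattices \<open>m1 M\<close> and \<open>m2 M\<close>, of indices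
    \<open>m1^2\<close> and \<open>m2^2\<close>, the condition \<open>u1 \<in> stays K1\<close> says
    just that \<open>m1 u1\<close> is integral. The splitting of \<open>u\<close> becomes one of
    denominators.\<close>
  define K1 where "K1 = zlat (of_nat m1 * \<mu>) (of_nat m1 * \<nu>)"
  define K2 where "K2 = zlat (of_nat m2 * \<mu>) (of_nat m2 * \<nu>)"
  have K: "K1 \<in> isub M (m1\<^sup>2)" "K2 \<in> isub M (m2\<^sup>2)" unfolding K1_def K2_def by (rule scaled_lattice_isub; use m in simp)+
  have az: "of_int a * z \<in> OF" using JJ[OF zJ, of 1] by simp
  have "u \<in> stays (K1 \<inter> K2)"
  proof -
    have "u * y \<in> M" if y: "y \<in> K1 \<inter> K2" for y
    proof -
      obtain y1 where y1: "y1 \<in> M" "y = of_nat m1 * y1" using y scaled_lattice_mem K1_def by auto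
      obtain y2 where y2: "y2 \<in> M" "y = of_nat m2 * y2" using y scaled_lattice_mem K2_def by auto
      \<comment> \<open>The intersection consists of multiples \<open>m1 m2 y\<close> with
        \<open>y\<close> in \<open>M\<close>, and \<open>m1 m2 u\<close> is the square of the
        integer \<open>a z\<close>.\<close>
      obtain p q where pq: "p * int m1 + q * int m2 = 1" using bezout_int[of "int m1" "int m2"] cop by auto
      have "y = of_int (p * int m1 + q * int m2) * y" unfolding pq by simp
      also have "\<dots> = of_int p * (of_nat m1 * y) + of_int q * (of_nat m2 * y)" by (simp add: algebra_simps)
      also have "\<dots> = of_int p * (of_nat m1 * (of_nat m2 * y2)) + of_int q * (of_nat m2 * (of_nat m1 * y1))"
        using y1(2) y2(2) by metis
      also have "\<dots> = of_nat m1 * of_nat m2 * (of_int p * y2 + of_int q * y1)" by (simp add: algebra_simps)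
      finally have "u * y = (of_nat m1 * of_nat m2 * u) * (of_int p * y2 + of_int q * y1)" by (simp add: mult_ac)
      also have "of_nat m1 * of_nat m2 * u = (of_int a * z) * (of_int a * z)"
        unfolding m using u_eq by (simp add: power2_eq_square mult_ac)
      finally have "u * y = (of_int a * z) * (of_int a * z) * (of_int p * y2 + of_int q * y1)" .
      also have "\<dots> \<in> M" by (intro lattice_mult OF_mult az zlat_add zlat_int_mult y1 y2)
      finally show ?thesis .
    qed
    thus ?thesis using uU by (auto simp: stays_def)
  qed
  moreover have "coprime (m1\<^sup>2) (m2\<^sup>2)" using cop by simp
  ultimately obtain u1 u2 where u12: "u1 \<in> stays K1" "u2 \<in> stays K2" "u = u1 * u2"
    using fac[OF _ _ _ K] m by (metis zero_less_power)
  have U12: "u1 \<in> U" "u2 \<in> U" using u12 by (auto simp: stays_def)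
  have d1: "of_int a * u1 \<in> OF"
  proof (rule mult_M_in_OF)
    show "of_int a * u1 \<in> F" using U12 by (auto simp: U_def intro: F_intros)
    fix y assume "y \<in> M"
    hence "of_nat m1 * y \<in> K1" unfolding K1_def scaled_lattice_mem by blast
    hence "u1 * (of_nat m1 * y) \<in> M" using u12(1) by (auto simp: stays_def)
    thus "of_int a * u1 * y \<in> M" unfolding m by (simp add: mult_ac)
  qed
  have d2: "of_int k * u2 \<in> OF"
  proof (rule mult_M_in_OF)
    show "of_int k * u2 \<in> F" using U12 by (auto simp: U_def intro: F_intros)
    fix y assume "y \<in> M"
    hence "of_nat m2 * y \<in> K2" unfolding K2_def scaled_lattice_mem by blast
    hence "u2 * (of_nat m2 * y) \<in> M" using u12(2) by (auto simp: stays_def)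
    thus "of_int k * u2 * y \<in> M" unfolding m by (simp add: mult_ac)
  qed
  have u1J: "u1 * cnj y \<in> ?J" if y: "y \<in> ?J" for y
  proof (rule bezout_membership[OF is_subgroup_zlat])
    show "coprime (a\<^sup>2) (k\<^sup>2)" using x by (simp add: k_def)
    have "(of_int a * u1) * (of_int a * (1 * cnj y)) \<in> OF" by (intro OF_mult d1 JJ y zlat_basis)
    thus "of_int (a\<^sup>2) * (u1 * cnj y) \<in> ?J" using OFJ by (auto simp: power2_eq_square mult_ac)
    \<comment> \<open>The factor \<open>a z^2\<close> equals \<open>k u1 u2\<close>, so the
      conjugate of \<open>u2\<close> cancels \<open>u2\<close> and only the factor
      \<open>k^2\<close> remains in front of \<open>u1 cnj y\<close>.\<close>
    have "cnj (of_int k * u2) * (of_int a * (z * cnj y)) * z \<in> ?J" by (intro fiD(4)[OF J] OF_mult OF_cnj d2 JJ zJ y)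
    also have "cnj (of_int k * u2) * (of_int a * (z * cnj y)) * z = of_int k * cnj u2 * (of_int a * z\<^sup>2) * cnj y"
      by (simp add: power2_eq_square mult_ac)
    also have "\<dots> = of_int (k\<^sup>2) * ((u2 * cnj u2) * u1 * cnj y)"
      unfolding u_eq[symmetric] u12(3) by (simp add: power2_eq_square mult_ac)
    finally show "of_int (k\<^sup>2) * (u1 * cnj y) \<in> ?J" using U_cnj(1)[OF U12(2)] by simp
  qed
  \<comment> \<open>The map \<open>y\<close> to \<open>u1 cnj y\<close> is an involution because
    \<open>u1\<close> has modulus one, so one inclusion implies the other.\<close>
  have JJ': "(*) u1 ` cnj ` ?J = ?J"
  proof
    show "(*) u1 ` cnj ` ?J \<subseteq> ?J" using u1J by auto
    show "?J \<subseteq> (*) u1 ` cnj ` ?J"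
    proof
      fix y assume y: "y \<in> ?J"
      have "u1 * cnj (u1 * cnj y) = (u1 * cnj u1) * y" by (simp add: mult.assoc)
      hence "y = u1 * cnj (u1 * cnj y)" using U_cnj(1)[OF U12(1)] by simp
      thus "y \<in> (*) u1 ` cnj ` ?J" using u1J[OF y] by blast
    qed
  qed
  have u10: "u1 \<noteq> 0" by (rule U_nonzero[OF U12(1)])
  have cJ: "cnj ` ?J = (*) (1 / u1) ` ?J" by (rule image_mult_inverse[OF u10 JJ'[symmetric]])
  have "cnj ` I = (*) (cnj \<alpha>) ` cnj ` ?J" unfolding b(3) by (auto simp: image_image)
  also have "\<dots> = (*) (cnj \<alpha> / u1 / \<alpha>) ` I" unfolding cJ b(3) image_mult_mult using b(2) by simp
  finally have "cnj ` I = (*) (cnj \<alpha> / u1 / \<alpha>) ` I" .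
  moreover have "cnj \<alpha> / u1 / \<alpha> \<in> F" using U12(1) aF by (auto simp: U_def intro!: F_intros cnj_F)
  ultimately show ?thesis using b(2) u10 by (intro bexI[of _ "cnj \<alpha> / u1 / \<alpha>"]) auto
qed

theorem class_count_multiplicative_iff:
  "(\<forall>m1 m2. m1 > 0 \<longrightarrow> m2 > 0 \<longrightarrow> coprime m1 m2 \<longrightarrow> class_count (m1 * m2) = class_count m1 * class_count m2)
    \<longleftrightarrow> (\<forall>I. fi I \<longrightarrow> (\<exists>w\<in>F. w \<noteq> 0 \<and> cnj ` I = (*) w ` I))"
  (is "?L \<longleftrightarrow> ?R")
proof
  assume ?L
  hence "\<exists>u1\<in>stays K1. \<exists>u2\<in>stays K2. u = u1 * u2"
    if "m1 > 0" "m2 > 0" "coprime m1 m2" "K1 \<in> isub M m1" "K2 \<in> isub M m2" "u \<in> stays (K1 \<inter> K2)" for m1 m2 K1 K2 u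
    using class_count_submultiplicative(2)[OF that(1-3)] that by blast
  thus ?R using ideal_condition_of_factor by blast
next
  assume ?R
  thus ?L using class_count_submultiplicative(2) factor_of_ideal_condition by simp
qed

end

section \<open>Euler products\<close>

lemma prime_power_coprime_induct [consumes 1, case_names one mult]:
  fixes n :: nat
  assumes "n > 0" "P 1" and step: "\<And>p k m. prime p \<Longrightarrow> m > 0 \<Longrightarrow> \<not> p dvd m \<Longrightarrow> P m \<Longrightarrow> P (p ^ k * m)"
  shows "P n"
  using assms(1)
proof (induction n rule: less_induct)
  case (less n)
  show ?case
  proof (cases "n = 1")
    case False
    then obtain p where p: "prime p" "p dvd n" using prime_factor_nat by blast
    have "n \<noteq> 0" "\<not> is_unit p" using less.prems p(1) by auto
    then obtain m where m: "n = p ^ multiplicity p n * m" "\<not> p dvd m"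
      using multiplicity_decompose' by metis
    have "multiplicity p n > 0" using p less.prems by (simp add: prime_multiplicity_gt_zero_iff)
    hence "p ^ multiplicity p n > 1" by (rule one_less_power[OF prime_gt_1_nat[OF p(1)]])
    moreover have m0: "m > 0" using m(1) less.prems by (cases "m = 0") auto
    ultimately have "m < n" by (subst m(1)) simp
    hence "P m" using less.IH m0 by blast
    thus ?thesis using step[OF p(1) m0 m(2)] m(1) by metis
  qed (use assms(2) in simp)
qed

lemma multiplicity_power_mult_coprime:
  fixes p m :: nat
  assumes "prime p" "\<not> p dvd m"
  shows "multiplicity p (p ^ i * m) = i"
proof (rule multiplicity_eqI)
  show "\<not> p ^ Suc i dvd p ^ i * m"
    using assms prime_gt_0_nat[OF assms(1)] by (simp add: dvd_mult_cancel_left mult.commute[of p])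
qed simp

definition smooth :: "nat set \<Rightarrow> nat set" where
  "smooth P = {m. m > 0 \<and> (\<forall>q. prime q \<and> q dvd m \<longrightarrow> q \<in> P)}"

lemma bij_betw_smooth_insert:
  assumes p: "prime p" "p \<notin> P"
  shows "bij_betw (\<lambda>(i, m). p ^ i * m) (UNIV \<times> smooth P) (smooth (insert p P))"
proof -
  have nd: "\<not> p dvd m" if "m \<in> smooth P" for m using that p by (auto simp: smooth_def)
  show ?thesis
  proof (rule bij_betw_imageI)
    show "inj_on (\<lambda>(i, m). p ^ i * m) (UNIV \<times> smooth P)"
    proof (rule inj_onI, clarify)
      fix i m j m' assume m: "m \<in> smooth P" "m' \<in> smooth P" and e: "p ^ i * m = p ^ j * m'"
      have "i = j" using multiplicity_power_mult_coprime[OF p(1) nd[OF m(1)], of i]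
        multiplicity_power_mult_coprime[OF p(1) nd[OF m(2)], of j] e by simp
      thus "i = j \<and> m = m'" using e prime_gt_0_nat[OF p(1)] by simp
    qed
    show "(\<lambda>(i, m). p ^ i * m) ` (UNIV \<times> smooth P) = smooth (insert p P)"
    proof
      show "(\<lambda>(i, m). p ^ i * m) ` (UNIV \<times> smooth P) \<subseteq> smooth (insert p P)"
      proof clarify
        fix i m assume m: "m \<in> smooth P"
        have "q \<in> insert p P" if q: "prime q" "q dvd p ^ i * m" for q
        proof (cases "q dvd m")
          case False
          hence "q dvd p ^ i" using q by (simp add: prime_dvd_mult_iff)
          hence "q dvd p" using q(1) by (rule prime_dvd_power[rotated])
          hence "q = p" using q(1) p(1) by (simp add: primes_dvd_imp_eq)
          thus ?thesis by simp
        qed (use m q in \<open>auto simp: smooth_def\<close>)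
        thus "p ^ i * m \<in> smooth (insert p P)"
          using m prime_gt_0_nat[OF p(1)] by (auto simp: smooth_def)
      qed
      show "smooth (insert p P) \<subseteq> (\<lambda>(i, m). p ^ i * m) ` (UNIV \<times> smooth P)"
      proof
        fix n assume n: "n \<in> smooth (insert p P)"
        hence "n \<noteq> 0" "\<not> is_unit p" using p(1) by (auto simp: smooth_def)
        then obtain m where m: "n = p ^ multiplicity p n * m" "\<not> p dvd m"
          using multiplicity_decompose' by metis
        have "q \<in> P" if "prime q" "q dvd m" for q
        proof -
          have "q dvd n" using that m(1) by (metis dvd_mult)
          hence "q \<in> insert p P" using n that(1) by (auto simp: smooth_def)
          thus ?thesis using that m(2) by blast
        qed
        moreover have "m > 0" using m(1) \<open>n \<noteq> 0\<close> by (cases "m = 0") auto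
        ultimately have "m \<in> smooth P" by (auto simp: smooth_def)
        thus "n \<in> (\<lambda>(i, m). p ^ i * m) ` (UNIV \<times> smooth P)"
          using m(1) by (intro image_eqI[of _ _ "(multiplicity p n, m)"]) auto
      qed
    qed
  qed
qed

lemma smooth_empty: "smooth {} = {1}"
proof -
  have "m = 1" if "m \<in> smooth {}" for m
    using that prime_factor_nat[of m] by (auto simp: smooth_def)
  moreover have "1 \<in> smooth {}" by (auto simp: smooth_def)
  ultimately show ?thesis by blast
qed

text \<open>Adding a prime \<open>p\<close> writes each smooth number uniquely as
  \<open>p ^ i * m\<close>; absolute convergence allows the double sum to be evaluated as an
  iterated one, which splits off the factor at \<open>p\<close>.\<close>

lemma infsum_smooth:
  fixes f :: "nat \<Rightarrow> complex"
  assumes "f 1 = 1" and mult: "\<And>m n. m > 0 \<Longrightarrow> n > 0 \<Longrightarrow> coprime m n \<Longrightarrow> f (m * n) = f m * f n"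
    and sum: "(\<lambda>m. norm (f m)) summable_on {1..}" and P: "finite P" "\<And>p. p \<in> P \<Longrightarrow> prime p"
  shows "infsum f (smooth P) = (\<Prod>p\<in>P. \<Sum>\<^sub>\<infinity>i. f (p ^ i))"
  using P
proof (induction P rule: finite_induct)
  case empty
  show ?case using assms(1) by (simp add: smooth_empty)
next
  case (insert p P)
  have p: "prime p" using insert.prems by blast
  have bij: "bij_betw (\<lambda>(i, m). p ^ i * m) (UNIV \<times> smooth P) (smooth (insert p P))"
    by (rule bij_betw_smooth_insert[OF p insert.hyps(2)])
  have "f summable_on (smooth (insert p P))"
    by (rule summable_on_subset_banach[OF abs_summable_summable[OF sum]]) (auto simp: smooth_def)
  hence s: "(\<lambda>x. f ((\<lambda>(i, m). p ^ i * m) x)) summable_on (UNIV \<times> smooth P)"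
    using summable_on_reindex_bij_betw[OF bij, of f] by blast
  have fm: "f (p ^ i * m) = f (p ^ i) * f m" if "m \<in> smooth P" for i m
  proof (rule mult)
    have "\<not> p dvd m" using that p insert.hyps(2) by (auto simp: smooth_def)
    thus "coprime (p ^ i) m" using p by (simp add: prime_imp_coprime)
  qed (use that p prime_gt_0_nat in \<open>auto simp: smooth_def\<close>)
  have s': "(\<lambda>(i, m). f (p ^ i) * f m) summable_on (UNIV \<times> smooth P)"
    using s by (rule summable_on_cong[THEN iffD1, rotated]) (auto simp: fm)
  have "infsum f (smooth (insert p P)) = infsum (\<lambda>x. f ((\<lambda>(i, m). p ^ i * m) x)) (UNIV \<times> smooth P)"
    by (rule infsum_reindex_bij_betw[OF bij, symmetric])
  also have "\<dots> = infsum (\<lambda>(i, m). f (p ^ i) * f m) (UNIV \<times> smooth P)"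
    by (rule infsum_cong) (auto simp: fm)
  also have "\<dots> = infsum (\<lambda>i. infsum (\<lambda>m. f (p ^ i) * f m) (smooth P)) UNIV"
    by (rule infsum_Sigma'_banach[OF s', symmetric])
  also have "\<dots> = (\<Sum>\<^sub>\<infinity>i. f (p ^ i)) * infsum f (smooth P)"
    by (simp add: infsum_cmult_right' infsum_cmult_left')
  finally show ?case using insert by simp
qed

text \<open>A partial product is the sum over numbers with all prime factors up to \<open>N\<close>.
  What it misses is a tail of an absolutely convergent series.\<close>

theorem euler_product:
  fixes f :: "nat \<Rightarrow> complex"
  assumes f1: "f 1 = 1" and mult: "\<And>m n. m > 0 \<Longrightarrow> n > 0 \<Longrightarrow> coprime m n \<Longrightarrow> f (m * n) = f m * f n"
    and sum: "(\<lambda>m. norm (f m)) summable_on {1..}"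
  shows "(\<lambda>p. if prime p then \<Sum>\<^sub>\<infinity>i. f (p ^ i) else 1) has_prod (\<Sum>\<^sub>\<infinity>m\<in>{1..}. f m)"
proof -
  define g where "g p = (if prime p then \<Sum>\<^sub>\<infinity>i. f (p ^ i) else 1)" for p
  define Pr where "Pr N = {p. prime p \<and> p \<le> N}" for N :: nat
  have fin: "finite (Pr N)" for N unfolding Pr_def by (rule finite_subset[of _ "{..N}"]) auto
  have part: "(\<Prod>p\<le>N. g p) = infsum f (smooth (Pr N))" for N
  proof -
    have "(\<Prod>p\<le>N. g p) = (\<Prod>p\<in>Pr N. g p)"
      by (rule prod.mono_neutral_right) (auto simp: Pr_def g_def)
    also have "\<dots> = (\<Prod>p\<in>Pr N. \<Sum>\<^sub>\<infinity>i. f (p ^ i))"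
      by (rule prod.cong) (auto simp: Pr_def g_def)
    also have "\<dots> = infsum f (smooth (Pr N))"
      by (rule infsum_smooth[symmetric, OF f1 mult sum fin]) (auto simp: Pr_def)
    finally show ?thesis .
  qed
  have fsum: "f summable_on {1..}" by (rule abs_summable_summable[OF sum])
  have lim: "(\<lambda>N. \<Prod>p\<le>N. g p) \<longlonglongrightarrow> infsum f {1..}"
  proof (rule LIMSEQ_I)
    fix e :: real assume e: "e > 0"
    \<comment> \<open>Once \<open>N\<close> exceeds every element of \<open>A\<close>, all of
      \<open>A\<close> is smooth, and the missing terms have total size at most
      \<open>e / 2\<close>.\<close>
    obtain A where A: "finite A" "A \<subseteq> {1..}" "dist (\<Sum>m\<in>A. norm (f m)) (infsum (\<lambda>m. norm (f m)) {1..}) \<le> e / 2"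
      using infsum_finite_approximation[OF sum, of "e / 2"] e by auto
    have "norm ((\<Prod>p\<le>N. g p) - infsum f {1..}) < e" if N: "N \<ge> Max (insert 0 A)" for N
    proof -
      let ?S = "smooth (Pr N)"
      have AS: "A \<subseteq> ?S"
      proof
        fix m assume m: "m \<in> A"
        have "m \<le> N" using N A(1) m by simp
        moreover have "m > 0" using A(2) m by auto
        ultimately show "m \<in> ?S" by (auto simp: smooth_def Pr_def dest!: dvd_imp_le)
      qed
      have S: "?S \<subseteq> {1..}" by (auto simp: smooth_def)
      have ab: "(\<lambda>m. norm (f m)) summable_on B" if "B \<subseteq> {1..}" for B
        by (rule summable_on_subset_banach[OF sum that])
      have "infsum f ({1..} - ?S) = infsum f {1..} - infsum f ?S"
        by (rule infsum_Diff[OF fsum _ S]) (rule summable_on_subset_banach[OF fsum S])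
      hence "norm ((\<Prod>p\<le>N. g p) - infsum f {1..}) = norm (infsum f ({1..} - ?S))"
        unfolding part by (simp add: norm_minus_commute)
      also have "\<dots> \<le> infsum (\<lambda>m. norm (f m)) ({1..} - ?S)"
        by (rule norm_infsum_bound) (rule ab, blast)
      also have "\<dots> \<le> infsum (\<lambda>m. norm (f m)) ({1..} - A)"
        by (rule infsum_mono2) (use ab AS in auto)
      also have "\<dots> = infsum (\<lambda>m. norm (f m)) {1..} - infsum (\<lambda>m. norm (f m)) A"
        by (rule infsum_Diff[OF sum ab A(2)]) (use A in auto)
      also have "\<dots> = infsum (\<lambda>m. norm (f m)) {1..} - (\<Sum>m\<in>A. norm (f m))" using A(1) by simp
      also have "\<dots> \<le> e / 2" using A(3) unfolding dist_real_def by linarith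
      also have "\<dots> < e" using e by simp
      finally show ?thesis .
    qed
    thus "\<exists>no. \<forall>N\<ge>no. norm ((\<Prod>p\<le>N. g p) - infsum f {1..}) < e" by blast
  qed
  \<comment> \<open>\<open>has_prod\<close> demands more than a limit of partial products: it rules
    out drifting to zero without a zero factor. The deviations from 1 are bounded by sums over prime
    powers, and distinct prime powers are distinct indices of the original series.\<close>
  have "summable (\<lambda>p. norm (g p - 1))"
  proof -
    define Ps where "Ps = {p::nat. prime p}"
    define pw where "pw = (\<lambda>(p::nat, i::nat). p ^ i)"
    have inj: "inj_on pw (Ps \<times> {1..})"
    proof (rule inj_onI)
      fix x y assume xy: "x \<in> Ps \<times> {1..}" "y \<in> Ps \<times> {1..}" "pw x = pw y"
      obtain p i q j where e: "x = (p, i)" "y = (q, j)" by (cases x, cases y)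
      from xy have pq: "prime p" "prime q" "i \<ge> 1" "j \<ge> 1" "p ^ i = q ^ j" by (auto simp: Ps_def pw_def e)
      have "p dvd p ^ i" using pq(3) by (intro dvd_power) auto
      hence "p dvd q" unfolding pq(5) using pq(1) by (rule prime_dvd_power[rotated])
      hence "p = q" using pq(1,2) by (simp add: primes_dvd_imp_eq)
      moreover from this have "i = j" using pq(5) prime_gt_1_nat[OF pq(1)] by simp
      ultimately show "x = y" by (simp add: e)
    qed
    have "(\<lambda>m. norm (f m)) summable_on pw ` (Ps \<times> {1..})"
    proof (rule summable_on_subset_banach[OF sum])
      show "pw ` (Ps \<times> {1..}) \<subseteq> {1..}"
      proof clarify
        fix p i assume "p \<in> Ps"
        hence "p > 0" by (auto simp: Ps_def prime_gt_0_nat)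
        thus "pw (p, i) \<ge> 1" by (simp add: pw_def Suc_le_eq)
      qed
    qed
    hence "((\<lambda>m. norm (f m)) \<circ> pw) summable_on (Ps \<times> {1..})"
      using summable_on_reindex[OF inj] by blast
    hence s2: "(\<lambda>(p, i). norm (f (p ^ i))) summable_on (Ps \<times> {1..})"
      by (simp add: pw_def o_def case_prod_unfold)
    hence s3: "(\<lambda>p. infsum (\<lambda>i. norm (f (p ^ i))) {1..}) summable_on Ps"
      by (rule summable_on_Sigma_banach)
    have g1: "norm (g p - 1) \<le> infsum (\<lambda>i. norm (f (p ^ i))) {1..}" if p: "p \<in> Ps" for p
    proof -
      have pp: "prime p" using p by (simp add: Ps_def)
      have "inj (\<lambda>i. p ^ i)" using prime_gt_1_nat[OF pp] by (auto intro: injI)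
      moreover have "f summable_on range (\<lambda>i. p ^ i)"
        by (rule summable_on_subset_banach[OF fsum]) (use prime_gt_0_nat[OF pp] in \<open>auto simp: Suc_le_eq\<close>)
      ultimately have sp: "(\<lambda>i. f (p ^ i)) summable_on UNIV"
        using summable_on_reindex[of "\<lambda>i. p ^ i" UNIV f] by (simp add: o_def)
      have sp': "(\<lambda>i. norm (f (p ^ i))) summable_on {1..}"
      proof -
        have "inj_on (\<lambda>i. p ^ i) {1..}" using prime_gt_1_nat[OF pp] by (auto intro: inj_onI)
        moreover have "(\<lambda>m. norm (f m)) summable_on (\<lambda>i. p ^ i) ` {1..}"
          by (rule summable_on_subset_banach[OF sum]) (use prime_gt_0_nat[OF pp] in \<open>auto simp: Suc_le_eq\<close>)
        ultimately show ?thesis using summable_on_reindex[of "\<lambda>i. p ^ i" "{1..}" "\<lambda>m. norm (f m)"] by (simp add: o_def)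
      qed
      have "infsum (\<lambda>i. f (p ^ i)) (UNIV - {0}) = infsum (\<lambda>i. f (p ^ i)) UNIV - infsum (\<lambda>i. f (p ^ i)) {0}"
        by (rule infsum_Diff[OF sp]) auto
      moreover have "UNIV - {0::nat} = {1..}" by auto
      ultimately have "g p - 1 = infsum (\<lambda>i. f (p ^ i)) {1..}" using pp f1 by (simp add: g_def)
      thus ?thesis using norm_infsum_bound[OF sp'] by simp
    qed
    have "(\<lambda>p. norm (g p - 1)) summable_on Ps"
      by (rule summable_on_comparison_test[OF s3 g1]) auto
    moreover have "(\<lambda>p. norm (g p - 1)) summable_on Ps \<longleftrightarrow> (\<lambda>p. norm (g p - 1)) summable_on UNIV"
      by (rule summable_on_cong_neutral) (auto simp: Ps_def g_def)
    ultimately show ?thesis using summable_on_imp_summable by blast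
  qed
  hence conv: "convergent_prod g"
    by (intro abs_convergent_prod_imp_convergent_prod summable_imp_abs_convergent_prod)
  have "prodinf g = infsum f {1..}"
    using LIMSEQ_unique[OF convergent_prod_LIMSEQ[OF conv] lim] .
  hence "g has_prod infsum f {1..}" using conv by (metis convergent_prod_has_prod)
  thus ?thesis by (simp add: g_def[abs_def])
qed

section \<open>Majorisation by the divisor sum\<close>

definition divisor_sum :: "nat \<Rightarrow> nat" where "divisor_sum m = \<Sum> {d. d dvd m}"

lemma summable_powr_ge1: "y > 1 \<Longrightarrow> (\<lambda>n. real n powr - y) summable_on {1..}"
proof -
  assume "y > 1"
  hence "summable (\<lambda>n. real n powr - y)" by (simp add: summable_real_powr_iff)
  hence "(\<lambda>n. real n powr - y) summable_on UNIV" by (rule summable_nonneg_imp_summable_on) simp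
  thus ?thesis by (rule summable_on_subset_banach) simp
qed

text \<open>Writing \<open>m = d e\<close> turns the series into the product of the zeta series at
  \<open>x - 1\<close> and at \<open>x\<close>; the former is the reason for
  \<open>x > 2\<close>.\<close>

lemma summable_divisor_sum:
  assumes x: "x > 2"
  shows "(\<lambda>m. real (divisor_sum m) * real m powr - x) summable_on {1..}"
proof -
  let ?h = "\<lambda>(m::nat, d::nat). real d * real m powr - x"
  let ?S = "SIGMA m:{1..}. {d. d dvd m}"
  have bij: "bij_betw (\<lambda>(d, e). (d * e, d)) ({1::nat..} \<times> {1..}) ?S"
    by (rule bij_betw_byWitness[where f' = "\<lambda>(m, d). (d, m div d)"])
      (auto simp: Suc_le_eq elim!: dvdE)
  have "(\<lambda>(d, e). real d powr - (x - 1) * real e powr - x) summable_on ({1::nat..} \<times> {1::nat..})"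
  proof (rule summable_on_SigmaI)
    show "((\<lambda>e. case (d, e) of (d, e) \<Rightarrow> real d powr - (x - 1) * real e powr - x) has_sum
        (real d powr - (x - 1) * infsum (\<lambda>e. real e powr - x) {1..})) {1..}" for d
      using has_sum_cmult_right[OF has_sum_infsum[OF summable_powr_ge1[of x]]] x by simp
    show "(\<lambda>d. real d powr - (x - 1) * infsum (\<lambda>e. real e powr - x) {1..}) summable_on {1..}"
      by (rule summable_on_cmult_left[OF summable_powr_ge1]) (use x in simp)
  qed simp
  moreover have "real d powr - (x - 1) * real e powr - x = ?h (d * e, d)" if "d \<ge> 1" "e \<ge> 1" for d e :: nat
  proof -
    have "real d powr - (x - 1) = real d * real d powr - x"
      using that powr_add[of "real d" 1 "- x"] by simp
    thus ?thesis by (simp add: powr_mult)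
  qed
  ultimately have "(\<lambda>y. ?h ((\<lambda>(d, e). (d * e, d)) y)) summable_on ({1::nat..} \<times> {1::nat..})"
    by (subst summable_on_cong[where g = "\<lambda>(d, e). real d powr - (x - 1) * real e powr - x"]) auto
  hence "?h summable_on ?S" by (simp only: summable_on_reindex_bij_betw[OF bij])
  hence "(\<lambda>m. infsum (\<lambda>d. real d * real m powr - x) {d. d dvd m}) summable_on {1..}"
    by (rule summable_on_Sigma_banach)
  moreover have "infsum (\<lambda>d. real d * real m powr - x) {d. d dvd m} = real (divisor_sum m) * real m powr - x"
    if "m \<in> {1..}" for m
    using that by (simp add: divisor_sum_def sum_distrib_right)
  ultimately show ?thesis by (subst summable_on_cong) auto
qed

text \<open>Distinct pairs of divisors have distinct products, each a divisor of
  \<open>m * n\<close>.\<close>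

lemma divisor_sum_mult_le:
  assumes "coprime m n" "m > 0" "n > 0"
  shows "divisor_sum m * divisor_sum n \<le> divisor_sum (m * n)"
proof -
  have fin: "finite {d. d dvd k}" if "k > 0" for k :: nat using that by simp
  have inj: "inj_on (\<lambda>(d, e). d * e) ({d. d dvd m} \<times> {e. e dvd n})"
  proof (rule inj_onI, clarify)
    fix d e d' e' assume d: "d dvd m" "d' dvd m" and e: "e dvd n" "e' dvd n" and eq: "d * e = d' * e'"
    have c: "coprime d e'" "coprime d' e" using assms(1) d e by (meson coprime_divisors)+
    have "d dvd d'" using eq c by (metis coprime_dvd_mult_left_iff dvd_triv_left)
    moreover have "d' dvd d" using eq c by (metis coprime_dvd_mult_left_iff dvd_triv_left)
    ultimately have "d = d'" by (rule dvd_antisym)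
    moreover have "d > 0" using d assms(2) by (auto intro: Nat.gr0I)
    ultimately show "d = d' \<and> e = e'" using eq by simp
  qed
  have "divisor_sum m * divisor_sum n = (\<Sum>(d, e)\<in>{d. d dvd m} \<times> {e. e dvd n}. d * e)"
    by (simp add: divisor_sum_def sum_product sum.cartesian_product)
  also have "\<dots> = \<Sum> ((\<lambda>(d, e). d * e) ` ({d. d dvd m} \<times> {e. e dvd n}))"
    by (subst sum.reindex[OF inj]) (simp add: case_prod_unfold o_def)
  also have "\<dots> \<le> divisor_sum (m * n)"
    unfolding divisor_sum_def by (rule sum_mono2) (use assms in \<open>auto intro: mult_dvd_mono\<close>)
  finally show ?thesis .
qed

text \<open>The multiplicative function with the same prime power values as \<open>a\<close>, when
  \<open>a 1 = 1\<close>: it has the same Euler factors, so it is the function to compare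
  \<open>a\<close> with.\<close>

definition mult_ext :: "(nat \<Rightarrow> nat) \<Rightarrow> nat \<Rightarrow> nat" where
  "mult_ext a m = (\<Prod>p\<in>prime_factors m. a (p ^ multiplicity p m))"

lemma mult_ext_1: "mult_ext a 1 = 1" by (simp add: mult_ext_def)

lemma mult_ext_mult:
  assumes "coprime m n" "m > 0" "n > 0"
  shows "mult_ext a (m * n) = mult_ext a m * mult_ext a n"
proof -
  have disj: "prime_factors m \<inter> prime_factors n = {}"
    using assms(1)
    by (auto simp: in_prime_factors_iff) (metis coprime_common_divisor not_prime_unit)
  have 1: "multiplicity p (m * n) = multiplicity p m" if p: "p \<in> prime_factors m" for p
  proof -
    have "\<not> p dvd n" using p disj assms(3) by (auto simp: prime_factors_dvd)
    thus ?thesis using p assms by (simp add: prime_elem_multiplicity_mult_distrib in_prime_factors_iff not_dvd_imp_multiplicity_0)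
  qed
  have 2: "multiplicity p (m * n) = multiplicity p n" if p: "p \<in> prime_factors n" for p
  proof -
    have "\<not> p dvd m" using p disj assms(2) by (auto simp: prime_factors_dvd)
    thus ?thesis using p assms by (simp add: prime_elem_multiplicity_mult_distrib in_prime_factors_iff not_dvd_imp_multiplicity_0)
  qed
  have "prime_factors (m * n) = prime_factors m \<union> prime_factors n"
    using assms by (simp add: prime_factors_product)
  hence "mult_ext a (m * n) = (\<Prod>p\<in>prime_factors m. a (p ^ multiplicity p (m * n)))
      * (\<Prod>p\<in>prime_factors n. a (p ^ multiplicity p (m * n)))"
    using disj by (simp add: mult_ext_def prod.union_disjoint)
  also have "\<dots> = mult_ext a m * mult_ext a n"
    unfolding mult_ext_def using 1 2 by (intro arg_cong2[of _ _ _ _ "(*)"] prod.cong) auto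
  finally show ?thesis .
qed

lemma mult_ext_prime_power:
  assumes "prime p" "a 1 = 1"
  shows "mult_ext a (p ^ i) = a (p ^ i)"
proof (cases "i = 0")
  case False
  hence "prime_factors (p ^ i) = {p}" using assms(1)
    by (auto simp: prime_factors_dvd dest: prime_dvd_power intro: primes_dvd_imp_eq)
  thus ?thesis using assms(1) by (simp add: mult_ext_def)
qed (use assms mult_ext_1 in simp)

lemma of_nat_powr_mult:
  "(of_nat (m * n) :: complex) powr z = of_nat m powr z * of_nat n powr z"
  by (simp add: powr_times_real)

lemma of_nat_power_powr:
  assumes "p > 0"
  shows "(of_nat (p ^ i) :: complex) powr (- s) = of_nat p powr (- (of_nat i * s))"
proof -
  have "Ln (of_nat (p ^ i) :: complex) = of_real (ln (real (p ^ i)))"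
    using assms by (intro Ln_of_nat) simp
  also have "ln (real (p ^ i)) = real i * ln (real p)" using assms by (simp add: ln_realpow)
  finally have "Ln (of_nat (p ^ i) :: complex) = of_nat i * Ln (of_nat p)"
    using assms by (simp add: Ln_of_nat del: of_nat_power)
  thus ?thesis using assms by (simp add: powr_def mult_ac del: of_nat_power)
qed

text \<open>One value of \<open>s\<close> suffices for the converse: a submultiplicative \<open>a\<close> is bounded by the
  multiplicative function \<open>mult_ext a\<close> with the same values at prime powers, and the two Dirichlet
  series agree at \<open>s = 3\<close>.\<close>

theorem euler_product_iff_multiplicative:
  fixes a :: "nat \<Rightarrow> nat"
  assumes a1: "a 1 = 1"
    and sub: "\<And>m n. m > 0 \<Longrightarrow> n > 0 \<Longrightarrow> coprime m n \<Longrightarrow> a (m * n) \<le> a m * a n"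
    and bound: "\<And>m. m > 0 \<Longrightarrow> a m \<le> divisor_sum m"
  shows "(\<forall>s::complex. Re s > 2 \<longrightarrow>
      (\<lambda>p. if prime p then \<Sum>\<^sub>\<infinity>i\<in>UNIV. of_nat (a (p ^ i)) * of_nat p powr (- (of_nat i * s)) else 1)
        has_prod (\<Sum>\<^sub>\<infinity>m\<in>{1..}. of_nat (a m) * of_nat m powr (- s)))
    \<longleftrightarrow> (\<forall>m n. m > 0 \<longrightarrow> n > 0 \<longrightarrow> coprime m n \<longrightarrow> a (m * n) = a m * a n)"
proof -
  have summ: "(\<lambda>m. norm (of_nat (c m) * of_nat m powr (- s) :: complex)) summable_on {1..}"
    if c: "\<And>m. m > 0 \<Longrightarrow> c m \<le> divisor_sum m" and s: "Re s > 2" for c :: "nat \<Rightarrow> nat" and s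
  proof (rule summable_on_comparison_test[OF summable_divisor_sum[OF s]])
    fix m :: nat assume "m \<in> {1..}"
    hence "m > 0" by simp
    thus "norm (of_nat (c m) * of_nat m powr (- s) :: complex) \<le> real (divisor_sum m) * real m powr - Re s"
      using c by (simp add: norm_mult norm_powr_real_powr mult_right_mono)
  qed simp
  have prod: "(\<lambda>p. if prime p then \<Sum>\<^sub>\<infinity>i\<in>UNIV. of_nat (c (p ^ i)) * of_nat p powr (- (of_nat i * s)) else 1)
        has_prod (\<Sum>\<^sub>\<infinity>m\<in>{1..}. of_nat (c m) * of_nat m powr (- s) :: complex)"
    if c: "\<And>m. m > 0 \<Longrightarrow> c m \<le> divisor_sum m" "c 1 = 1"
      "\<And>m n. m > 0 \<Longrightarrow> n > 0 \<Longrightarrow> coprime m n \<Longrightarrow> c (m * n) = c m * c n" and s: "Re s > 2"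
    for c :: "nat \<Rightarrow> nat" and s
  proof -
    define f where "f m = (of_nat (c m) * of_nat m powr (- s) :: complex)" for m
    have "(\<lambda>p. if prime p then \<Sum>\<^sub>\<infinity>i. f (p ^ i) else 1) has_prod (\<Sum>\<^sub>\<infinity>m\<in>{1..}. f m)"
    proof (rule euler_product)
      show "f 1 = 1" using c(2) by (simp add: f_def)
      show "f (m * n) = f m * f n" if "m > 0" "n > 0" "coprime m n" for m n
        unfolding f_def c(3)[OF that] of_nat_powr_mult by simp
      show "(\<lambda>m. norm (f m)) summable_on {1..}" unfolding f_def using c(1) s by (rule summ)
    qed
    also have "(\<lambda>p. if prime p then \<Sum>\<^sub>\<infinity>i. f (p ^ i) else 1) =
        (\<lambda>p. if prime p then \<Sum>\<^sub>\<infinity>i\<in>UNIV. of_nat (c (p ^ i)) * of_nat p powr (- (of_nat i * s)) else 1)"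
      unfolding f_def using of_nat_power_powr[OF prime_gt_0_nat] by (intro ext) (simp del: of_nat_power)
    finally show ?thesis unfolding f_def .
  qed
  show ?thesis
  proof
    assume "\<forall>m n. m > 0 \<longrightarrow> n > 0 \<longrightarrow> coprime m n \<longrightarrow> a (m * n) = a m * a n"
    thus "\<forall>s::complex. Re s > 2 \<longrightarrow>
      (\<lambda>p. if prime p then \<Sum>\<^sub>\<infinity>i\<in>UNIV. of_nat (a (p ^ i)) * of_nat p powr (- (of_nat i * s)) else 1)
        has_prod (\<Sum>\<^sub>\<infinity>m\<in>{1..}. of_nat (a m) * of_nat m powr (- s))"
      by (intro allI impI prod bound a1) auto
  next
    assume *: "\<forall>s::complex. Re s > 2 \<longrightarrow>
      (\<lambda>p. if prime p then \<Sum>\<^sub>\<infinity>i\<in>UNIV. of_nat (a (p ^ i)) * of_nat p powr (- (of_nat i * s)) else 1)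
        has_prod (\<Sum>\<^sub>\<infinity>m\<in>{1..}. of_nat (a m) * of_nat m powr (- s))"
    define b where "b = mult_ext a"
    have b1: "b 1 = 1" unfolding b_def by (rule mult_ext_1)
    have bm: "b (m * n) = b m * b n" if "m > 0" "n > 0" "coprime m n" for m n
      unfolding b_def by (rule mult_ext_mult) (use that in auto)
    have bp: "b (p ^ i) = a (p ^ i)" if "prime p" for p i
      unfolding b_def by (rule mult_ext_prime_power[where a = a, OF that a1])
    have cop: "coprime (p ^ k) m" if "prime p" "\<not> p dvd m" for p k m :: nat
      using that by (simp add: prime_imp_coprime)
    have ab: "a m \<le> b m" if "m > 0" for m
      using that
    proof (induction rule: prime_power_coprime_induct)
      case one thus ?case using a1 b1 by simp
    next
      case (mult p k m)
      have "p ^ k > 0" using mult(1) prime_gt_0_nat by simp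
      hence "a (p ^ k * m) \<le> a (p ^ k) * a m" using sub mult cop by blast
      also have "\<dots> \<le> b (p ^ k) * b m" using bp mult by (intro mult_mono) auto
      also have "\<dots> = b (p ^ k * m)" using bm[of "p ^ k" m] mult cop \<open>p ^ k > 0\<close> by simp
      finally show ?case .
    qed
    \<comment> \<open>The bound passes from prime powers to all arguments, so the series of
      \<open>b\<close> also converges and has an Euler product.\<close>
    have bs: "b m \<le> divisor_sum m" if "m > 0" for m
      using that
    proof (induction rule: prime_power_coprime_induct)
      case one thus ?case using b1 by (simp add: divisor_sum_def)
    next
      case (mult p k m)
      have pk: "p ^ k > 0" using mult(1) prime_gt_0_nat by simp
      hence "b (p ^ k * m) = a (p ^ k) * b m" using bm[of "p ^ k" m] bp mult cop by simp
      also have "\<dots> \<le> divisor_sum (p ^ k) * divisor_sum m" using bound pk mult by (intro mult_mono) auto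
      also have "\<dots> \<le> divisor_sum (p ^ k * m)" using mult cop pk by (intro divisor_sum_mult_le) auto
      finally show ?case .
    qed
    have s3: "Re (3 :: complex) > 2" by simp
    have "(\<lambda>p. if prime p then \<Sum>\<^sub>\<infinity>i\<in>UNIV. of_nat (b (p ^ i)) * of_nat p powr (- (of_nat i * 3)) else 1)
        = (\<lambda>p. if prime p then \<Sum>\<^sub>\<infinity>i\<in>UNIV. of_nat (a (p ^ i)) * of_nat p powr (- (of_nat i * 3)) else (1::complex))"
      using bp by (intro ext) simp
    note fe = this
    have "(\<Sum>\<^sub>\<infinity>m\<in>{1..}. of_nat (b m) * of_nat m powr (- 3)) = (\<Sum>\<^sub>\<infinity>m\<in>{1..}. of_nat (a m) * of_nat m powr (- 3) :: complex)"
      by (rule has_prod_unique2[OF prod[where c = b and s = 3, OF bs b1 bm s3, unfolded fe] *[rule_format, OF s3]])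
    note eq = this
    \<comment> \<open>Equal Euler factors give equal sums at 3. The terms \<open>u m\<close> are
      non-negative by \<open>ab\<close> and sum to zero, so each of them vanishes.\<close>
    define u where "u m = (real (b m) - real (a m)) * real m powr - 3" for m
    have sa: "(\<lambda>m. of_nat (a m) * of_nat m powr (- 3) :: complex) summable_on {1..}"
      "(\<lambda>m. of_nat (b m) * of_nat m powr (- 3) :: complex) summable_on {1..}"
      using abs_summable_summable[OF summ[where c = a, OF bound s3]] abs_summable_summable[OF summ[where c = b, OF bs s3]]
      by blast+
    have "((\<lambda>m. of_nat (b m) * of_nat m powr (- 3) - of_nat (a m) * of_nat m powr (- 3) :: complex) has_sum 0) {1..}"
      using has_sum_add[OF has_sum_infsum[OF sa(2)] has_sum_uminusI[OF has_sum_infsum[OF sa(1)]]] eq by simp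
    moreover have "of_nat (b m) * of_nat m powr (- 3) - of_nat (a m) * of_nat m powr (- 3) = complex_of_real (u m)" if "m \<in> {1..}" for m
    proof -
      have "complex_of_real (real m powr - 3) = of_nat m powr (- 3)" using powr_of_real[of "real m" "- 3"] by simp
      thus ?thesis by (simp add: u_def algebra_simps)
    qed
    ultimately have "((\<lambda>m. complex_of_real (u m)) has_sum complex_of_real 0) {1..}"
      by (subst has_sum_cong[where g = "\<lambda>m. of_nat (b m) * of_nat m powr (- 3) - of_nat (a m) * of_nat m powr (- 3)"]) auto
    hence u0: "(u has_sum 0) {1..}" by (simp only: has_sum_of_real_iff)
    have "u m = 0" if "m \<in> {1..}" for m
      using nonneg_has_sum_le_0D[OF u0] that ab by (auto simp: u_def)
    hence eq: "a m = b m" if "m > 0" for m using that by (fastforce simp: u_def)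
    show "\<forall>m n. m > 0 \<longrightarrow> n > 0 \<longrightarrow> coprime m n \<longrightarrow> a (m * n) = a m * a n"
      using eq bm by simp
  qed
qed

section \<open>Embedding a binary lattice into the complex plane\<close>

lemma Re_of_rat [simp]: "Re (of_rat q) = of_rat q" and Im_of_rat [simp]: "Im (of_rat q) = 0"
  by (simp_all flip: of_real_of_rat)

lemma cnj_of_rat [simp]: "cnj (of_rat q) = of_rat q"
  by (simp add: complex_eq_iff)

lemma det_mat_2: "det (mat 2 2 g) = g (0, 0) * g (1, 1) - g (0, 1) * g (1, 0)"
  for g :: "nat \<times> nat \<Rightarrow> 'a::comm_ring_1"
proof -
  let ?A = "mat 2 2 g"
  have A: "?A \<in> carrier_mat 2 2" by simp
  have s: "{..<2::nat} = {0, 1}" by auto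
  have "det ?A = (\<Sum>i<2. ?A $$ (i, 0) * cofactor ?A i 0)"
    by (rule laplace_expansion_column[OF A]) simp
  moreover have "det (mat_delete ?A 0 0) = g (1, 1)" "det (mat_delete ?A 1 0) = g (0, 1)"
    by (subst det_single; auto simp: mat_delete_def)+
  ultimately show ?thesis by (simp add: s cofactor_def mult.commute)
qed

lemma coset_index_image:
  assumes inj: "inj \<phi>" and add: "\<And>x y. \<phi> (x + y) = \<phi> x + \<phi> y"
  shows "coset_index (\<phi> ` L) (\<phi> ` K) = coset_index L K"
proof -
  have "(\<lambda>x. (+) x ` \<phi> ` K) ` \<phi> ` L = image \<phi> ` (\<lambda>x. (+) x ` K) ` L"
    unfolding image_image by (intro image_cong refl) (auto simp: add image_image simp flip: add)
  moreover have "inj (image \<phi>)" using inj by (auto simp: inj_image_eq_iff intro: injI)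
  ultimately show ?thesis unfolding coset_index_def
    by (metis card_image inj_on_subset subset_UNIV)
qed

locale binary_lattice = quadratic_space scale B
  for scale :: "rat \<Rightarrow> 'v::ab_group_add \<Rightarrow> 'v" and B :: "'v \<Rightarrow> 'v \<Rightarrow> rat" +
  fixes e f :: 'v and L :: "'v set"
  assumes pd: "positive_definite" and ef: "e \<noteq> f" "independent {e, f}" "span {e, f} = UNIV"
    and L_eq: "L = Z_span {e, f}" and L_int: "x \<in> L \<Longrightarrow> B x x \<in> \<int>"
begin

sublocale finite_dimensional_vector_space scale "{e, f}"
  by unfold_locales (use ef in auto)

definition qa where "qa = B e e"
definition qb where "qb = 2 * B e f"
definition qc where "qc = B f f"
definition cx where "cx v = representation {e, f} v e"
definition cy where "cy v = representation {e, f} v f"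
text \<open>The root of \<open>qa X^2 - qb X + qc\<close> in the upper half-plane, chosen so that
  \<open>qa\<close> times the squared modulus of \<open>x + y tau\<close> is the quadratic
  form.\<close>

definition tau :: complex where
  "tau = Complex (of_rat (qb / (2 * qa))) (sqrt (of_rat (4 * qa * qc - qb\<^sup>2)) / (2 * of_rat qa))"
definition emb :: "'v \<Rightarrow> complex" where "emb v = of_rat (cx v) + of_rat (cy v) * tau"

lemma decomp: "v = scale (cx v) e + scale (cy v) f"
proof -
  have "(\<Sum>b\<in>{e, f}. scale (representation {e, f} v b) b) = v"
    by (rule sum_representation_eq) (use ef in auto)
  thus ?thesis using ef(1) by (simp add: cx_def cy_def)
qed

lemma coords_add: "cx (u + v) = cx u + cx v" "cy (u + v) = cy u + cy v"
  unfolding cx_def cy_def using ef by (simp_all add: representation_add)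

lemma coords_scale: "cx (scale r v) = r * cx v" "cy (scale r v) = r * cy v"
  unfolding cx_def cy_def using ef by (simp_all add: representation_scale)

lemma coords_basis: "cx e = 1" "cy e = 0" "cx f = 0" "cy f = 1"
  unfolding cx_def cy_def using ef by (simp_all add: representation_basis)

lemma emb_add: "emb (u + v) = emb u + emb v"
  by (simp add: emb_def coords_add of_rat_add algebra_simps)

lemma emb_scale: "emb (scale r v) = of_rat r * emb v"
  by (simp add: emb_def coords_scale of_rat_mult algebra_simps)

lemma emb_0: "emb 0 = 0"
  using emb_scale[of 0 0] by simp

lemma emb_basis: "emb e = 1" "emb f = tau"
  by (simp_all add: emb_def coords_basis)

lemma basis_nonzero: "e \<noteq> 0" "f \<noteq> 0"
  using ef(2) dependent_zero by fastforce+

lemma qa_pos: "qa > 0"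
  using pd basis_nonzero by (simp add: positive_definite_def qa_def)

lemma form_expand: "B u v = cx u * cx v * qa + (cx u * cy v + cy u * cx v) * qb / 2 + cy u * cy v * qc"
proof -
  have r: "B x (y + z) = B x y + B x z" "B x (scale k y) = k * B x y" for x y z k
    using form_add[of y z x] form_scale[of k y x] by (simp_all add: form_sym)
  have "B u v = B (scale (cx u) e + scale (cy u) f) (scale (cx v) e + scale (cy v) f)"
    using decomp[of u] decomp[of v] by simp
  also have "\<dots> = cx u * cx v * B e e + cx u * cy v * B e f + cy u * cx v * B f e + cy u * cy v * B f f"
    by (simp add: r form_add form_scale algebra_simps)
  also have "B f e = B e f" by (rule form_sym)
  finally show ?thesis by (simp add: qa_def qb_def qc_def algebra_simps)
qed

lemma disc_pos: "4 * qa * qc - qb\<^sup>2 > 0"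
proof -
  \<comment> \<open>A vector orthogonal to \<open>e\<close>; its value under the form is
    \<open>qa\<close> times the quantity in question.\<close>
  let ?v = "scale qb e + scale (- 2 * qa) f"
  have c: "cx ?v = qb" "cy ?v = - 2 * qa" by (simp_all only: coords_add coords_scale coords_basis mult_1_right mult_zero_right add_0_right add_0_left)
  have "?v \<noteq> 0" using c(2) qa_pos coords_scale(2)[of 0 0] by auto
  hence "B ?v ?v > 0" using pd by (simp add: positive_definite_def)
  also have "B ?v ?v = qa * (4 * qa * qc - qb\<^sup>2)"
    using form_expand[of ?v ?v] unfolding c by (simp add: power2_eq_square algebra_simps)
  finally show ?thesis using qa_pos by (simp add: zero_less_mult_iff)
qed

lemma Re_tau: "2 * of_rat qa * Re tau = of_rat qb"
  using qa_pos by (simp add: tau_def of_rat_divide of_rat_mult)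

lemma Im_tau: "Im tau > 0" "(2 * of_rat qa * Im tau)\<^sup>2 = of_rat (4 * qa * qc - qb\<^sup>2)"
proof -
  have p: "(of_rat (4 * qa * qc - qb\<^sup>2) :: real) > 0" "(of_rat qa :: real) > 0"
    using disc_pos qa_pos by (simp_all only: zero_less_of_rat_iff)
  show "Im tau > 0" using p by (simp add: tau_def)
  have "2 * of_rat qa * Im tau = sqrt (of_rat (4 * qa * qc - qb\<^sup>2))" using p by (simp add: tau_def)
  thus "(2 * of_rat qa * Im tau)\<^sup>2 = of_rat (4 * qa * qc - qb\<^sup>2)" using p by simp
qed

lemma norm_tau: "of_rat qa * (cmod tau)\<^sup>2 = of_rat qc"
proof -
  have a: "(of_rat qa :: real) > 0" using qa_pos by simp
  have "4 * of_rat qa * (of_rat qa * (cmod tau)\<^sup>2) = (2 * of_rat qa * Re tau)\<^sup>2 + (2 * of_rat qa * Im tau)\<^sup>2"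
    by (simp only: cmod_power2) (simp add: power2_eq_square algebra_simps)
  also have "\<dots> = 4 * of_rat qa * of_rat qc"
    unfolding Re_tau Im_tau by (simp add: of_rat_diff of_rat_mult of_rat_power)
  finally show ?thesis using a by simp
qed

lemma emb_Re_Im: "Re (emb v) = of_rat (cx v) + of_rat (cy v) * Re tau" "Im (emb v) = of_rat (cy v) * Im tau"
  by (simp_all add: emb_def)

lemma emb_form: "of_rat qa * Re (cnj (emb u) * emb v) = of_rat (B u v)"
proof -
  have "of_rat qa * Re (cnj (emb u) * emb v) = of_rat (cx u) * of_rat (cx v) * of_rat qa
     + (of_rat (cx u) * of_rat (cy v) + of_rat (cy u) * of_rat (cx v)) * (2 * of_rat qa * Re tau) / 2
     + of_rat (cy u) * of_rat (cy v) * (of_rat qa * (cmod tau)\<^sup>2)"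
    by (simp only: cmod_power2) (simp add: emb_Re_Im power2_eq_square field_simps)
  also have "\<dots> = of_rat (B u v)"
    unfolding Re_tau norm_tau
    by (simp only: form_expand[of u v] of_rat_add of_rat_mult of_rat_divide of_rat_numeral_eq)
  finally show ?thesis .
qed

lemma emb_norm: "of_rat qa * (cmod (emb v))\<^sup>2 = of_rat (B v v)"
  using emb_form[of v v] by (simp only: cmod_power2) (simp add: power2_eq_square)

lemma emb_area: "area (emb u) (emb v) = of_rat (cx u * cy v - cy u * cx v) * Im tau"
  by (simp add: area_alt emb_Re_Im of_rat_diff of_rat_mult algebra_simps)

lemma inj_emb: "inj emb"
proof (rule injI)
  fix u v assume eq: "emb u = emb v"
  have "Im (emb u) = Im (emb v)" "Re (emb u) = Re (emb v)" using eq by simp_all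
  hence "cy u = cy v" using Im_tau(1) by (simp add: emb_Re_Im)
  moreover from this have "cx u = cx v" using \<open>Re (emb u) = Re (emb v)\<close> by (simp add: emb_Re_Im)
  ultimately show "u = v" using decomp[of u] decomp[of v] by simp
qed

lemma range_emb: "range emb = {of_rat x + of_rat y * tau | x y. True}"
proof
  show "range emb \<subseteq> {of_rat x + of_rat y * tau | x y. True}" by (auto simp: emb_def)
  have "emb (scale x e + scale y f) = of_rat x + of_rat y * tau" for x y
    by (simp add: emb_add emb_scale emb_basis)
  thus "{of_rat x + of_rat y * tau | x y. True} \<subseteq> range emb" by (auto simp: image_def) metis
qed

lemma Z_span_pair: "Z_span {g, h} = {scale (of_int p) g + scale (of_int q) h | p q. True}"
proof -
  interpret Z: Modules.module "\<lambda>k::int. scale (of_int k)"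
    by unfold_locales (simp_all add: scale_right_distrib scale_left_distrib)
  show ?thesis unfolding Z_span_def Z.span_insert
    by (auto simp: algebra_simps)
qed

lemma emb_Z_span: "emb ` Z_span {g, h} = zlat (emb g) (emb h)"
proof
  show "emb ` Z_span {g, h} \<subseteq> zlat (emb g) (emb h)"
    by (auto simp: Z_span_pair emb_add emb_scale intro!: zlatI)
  have "emb (scale (of_int p) g + scale (of_int q) h) = of_int p * emb g + of_int q * emb h" for p q
    by (simp add: emb_add emb_scale)
  thus "zlat (emb g) (emb h) \<subseteq> emb ` Z_span {g, h}"
    unfolding zlat_def Z_span_pair by (auto simp: image_def) metis
qed

lemma emb_L: "emb ` L = zlat 1 tau"
  unfolding L_eq emb_Z_span emb_basis ..

lemma is_basis_length: "is_basis bs \<Longrightarrow> \<exists>g h. bs = [g, h] \<and> g \<noteq> h \<and> independent {g, h} \<and> span {g, h} = UNIV"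
proof -
  assume b: "is_basis bs"
  hence "card (set bs) = dim UNIV" by (intro basis_card_eq_dim) (auto simp: is_basis_def)
  also have "\<dots> = card {e, f}" by (intro basis_card_eq_dim[symmetric]) (use ef in auto)
  also have "\<dots> = 2" using ef(1) by simp
  finally have "length bs = 2" using b by (simp add: is_basis_def distinct_card)
  then obtain g h where "bs = [g, h]" by (auto simp: length_Suc_conv numeral_2_eq_2)
  thus ?thesis using b by (auto simp: is_basis_def)
qed

lemma basis_iff_area: "is_basis [g, h] \<longleftrightarrow> area (emb g) (emb h) \<noteq> 0"
proof
  assume b: "is_basis [g, h]"
  hence ind: "independent {g, h}" "g \<noteq> h" by (auto simp: is_basis_def)
  have h0: "h \<noteq> 0" using ind(1) dependent_zero by fastforce
  have notin: "g \<notin> span {h}" using ind by (auto simp: independent_insert)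
  show "area (emb g) (emb h) \<noteq> 0"
  proof
    assume "area (emb g) (emb h) = 0"
    hence z: "cx g * cy h = cy g * cx h" using Im_tau(1) by (simp add: emb_area)
    have "\<exists>r. g = scale r h"
    proof (cases "cx h = 0")
      case True
      have "cy h \<noteq> 0" using h0 True decomp[of h] by auto
      hence "cx g = 0" using z True by simp
      hence "g = scale (cy g / cy h) h" using True \<open>cy h \<noteq> 0\<close> decomp[of g] arg_cong[OF decomp[of h], of "scale (cy g / cy h)"]
        by (simp add: scale_right_distrib)
      thus ?thesis by blast
    next
      case False
      have "cy g = cx g / cx h * cy h" using z False by (simp add: field_simps)
      hence "g = scale (cx g / cx h) h"
        using False decomp[of g] arg_cong[OF decomp[of h], of "scale (cx g / cx h)"]
        by (simp add: scale_right_distrib)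
      thus ?thesis by blast
    qed
    thus False using notin span_scale[OF span_base[of h "{h}"]] by auto
  qed
next
  assume ar: "area (emb g) (emb h) \<noteq> 0"
  have gh: "g \<noteq> h" using ar by (auto simp: area_alt)
  have h0: "h \<noteq> 0" using ar by (auto simp: area_alt emb_0)
  have "g \<notin> span {h}"
  proof
    assume "g \<in> span {h}"
    then obtain r where "g = scale r h" by (auto simp: span_insert)
    thus False using ar by (simp add: emb_scale area_alt)
  qed
  hence ind: "independent {g, h}" using gh h0 by (simp add: independent_insert)
  have "card {g, h} = dim UNIV" using gh ef(1) basis_card_eq_dim[of "{e, f}" UNIV] ef by simp
  hence "UNIV \<subseteq> span {g, h}" using card_eq_dim[of "{g, h}" UNIV] ind by simp
  thus "is_basis [g, h]" using gh ind by (auto simp: is_basis_def)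
qed

text \<open>Lagrange's identity: the product of two squared moduli minus the square of the inner
  product is the square of the area.\<close>

lemma gram_det: "of_rat (det (gram_matrix [g, h])) = (of_rat qa * area (emb g) (emb h))\<^sup>2"
proof -
  have "det (gram_matrix [g, h]) = B g g * B h h - B g h * B g h"
    unfolding gram_matrix_def using form_sym[of h g] by (simp add: det_mat_2 numeral_2_eq_2[symmetric])
  hence "of_rat (det (gram_matrix [g, h])) = of_rat (B g g) * of_rat (B h h) - of_rat (B g h) * (of_rat (B g h) :: real)"
    by (simp add: of_rat_diff of_rat_mult)
  also have "\<dots> = (of_rat qa * area (emb g) (emb h))\<^sup>2"
    unfolding emb_form[symmetric] by (simp add: area_alt power2_eq_square algebra_simps)
  finally show ?thesis .
qed

theorem lattice_det_eq: "4 * lattice_det L = 4 * qa * qc - qb\<^sup>2"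
proof -
  have bas: "is_basis [e, f]" using ef by (simp add: is_basis_def)
  have "lattice_det L = det (gram_matrix [e, f])"
    unfolding lattice_det_def
  proof (rule the_equality)
    show "\<exists>bs. lattice_basis L bs \<and> det (gram_matrix [e, f]) = det (gram_matrix bs)"
      using bas L_eq by (intro exI[of _ "[e, f]"]) (simp add: lattice_basis_def)
  next
    fix d assume "\<exists>bs. lattice_basis L bs \<and> d = det (gram_matrix bs)"
    then obtain bs where bs: "lattice_basis L bs" "d = det (gram_matrix bs)" by blast
    obtain g h where gh: "bs = [g, h]" using is_basis_length bs(1) lattice_basis_def by blast
    have "L = Z_span {g, h}" using bs(1) gh by (simp add: lattice_basis_def)
    hence "zlat (emb g) (emb h) = zlat (emb e) (emb f)" using emb_Z_span L_eq by metis
    hence "\<bar>area (emb g) (emb h)\<bar> = \<bar>area (emb e) (emb f)\<bar>" by (rule zlat_area_unique)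
    hence "(area (emb g) (emb h))\<^sup>2 = (area (emb e) (emb f))\<^sup>2" by (simp add: abs_eq_iff power2_eq_iff)
    hence "(of_rat d :: real) = of_rat (det (gram_matrix [e, f]))"
      unfolding bs(2) gh gram_det by (simp add: power_mult_distrib)
    thus "d = det (gram_matrix [e, f])" by (simp only: of_rat_eq_iff)
  qed
  also have "det (gram_matrix [e, f]) = B e e * B f f - B e f * B e f"
    unfolding gram_matrix_def using form_sym[of f e] by (simp add: det_mat_2 numeral_2_eq_2[symmetric])
  finally show ?thesis by (simp add: qa_def qb_def qc_def power2_eq_square)
qed

text \<open>The determinant is the factor by which areas are scaled, whichever basis is used; this
  also shows that the definite description is meaningful.\<close>

lemma endo_det_eq:
  assumes lin: "Vector_Spaces.linear scale scale \<sigma>"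
    and d: "\<And>u v. area (emb (\<sigma> u)) (emb (\<sigma> v)) = of_rat d * area (emb u) (emb v)"
  shows "endo_det \<sigma> = d"
proof -
  have det: "det (endo_matrix bs \<sigma>) = d" if bs: "is_basis bs" for bs
  proof -
    obtain g h where gh: "bs = [g, h]" "g \<noteq> h" "independent {g, h}" "span {g, h} = UNIV"
      using is_basis_length bs by metis
    have ar: "area (emb g) (emb h) \<noteq> 0" using basis_iff_area bs gh(1) by blast
    define R where "R v w = representation {g, h} v w" for v w
    have dec: "v = scale (R v g) g + scale (R v h) h" for v
    proof -
      have "(\<Sum>b\<in>{g, h}. scale (representation {g, h} v b) b) = v"
        by (rule sum_representation_eq) (use gh in auto)
      thus ?thesis using gh(2) by (simp add: R_def)
    qed
    define D where "D = R (\<sigma> g) g * R (\<sigma> h) h - R (\<sigma> h) g * R (\<sigma> g) h"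
    have "det (endo_matrix bs \<sigma>) = D"
      unfolding endo_matrix_def gh(1) by (simp add: det_mat_2 D_def R_def flip: numeral_2_eq_2)
    moreover have "area (emb (\<sigma> g)) (emb (\<sigma> h)) = of_rat D * area (emb g) (emb h)"
    proof -
      have "emb (\<sigma> g) = of_rat (R (\<sigma> g) g) * emb g + of_rat (R (\<sigma> g) h) * emb h"
        "emb (\<sigma> h) = of_rat (R (\<sigma> h) g) * emb g + of_rat (R (\<sigma> h) h) * emb h"
        using arg_cong[OF dec[of "\<sigma> g"], of emb] arg_cong[OF dec[of "\<sigma> h"], of emb]
        by (simp_all add: emb_add emb_scale)
      thus ?thesis by (simp add: area_alt D_def of_rat_diff of_rat_mult algebra_simps)
    qed
    hence "of_rat D * area (emb g) (emb h) = of_rat d * area (emb g) (emb h)" by (simp only: d)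
    hence "(of_rat D :: real) = of_rat d" using ar by simp
    ultimately show ?thesis by simp
  qed
  have "is_basis [e, f]" using ef by (simp add: is_basis_def)
  thus ?thesis unfolding endo_det_def using det by (intro the_equality) auto
qed

text \<open>After division by the image \<open>u\<close> of \<open>e\<close>, the image of
  \<open>f\<close> has the real part and the modulus of \<open>tau\<close>, so it is
  \<open>tau\<close> or its conjugate. The second case reverses areas and has determinant
  -1.\<close>

lemma O_plus_multiplier:
  assumes s: "\<sigma> \<in> O_plus"
  obtains u where "u \<in> range emb" "cmod u = 1" "\<And>v. emb (\<sigma> v) = u * emb v"
proof -
  have lin: "Vector_Spaces.linear scale scale \<sigma>" and pres: "\<And>x y. B (\<sigma> x) (\<sigma> y) = B x y" and det: "endo_det \<sigma> = 1"
    using s by (auto simp: O_plus_def O_group_def)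
  interpret l: Vector_Spaces.linear scale scale \<sigma> by (rule lin)
  have qa: "(of_rat qa :: real) > 0" using qa_pos by simp
  have form: "Re (cnj (emb (\<sigma> x)) * emb (\<sigma> y)) = Re (cnj (emb x) * emb y)" for x y
  proof -
    have "of_rat qa * Re (cnj (emb (\<sigma> x)) * emb (\<sigma> y)) = of_rat qa * Re (cnj (emb x) * emb y)"
      unfolding emb_form pres ..
    thus ?thesis using qa by simp
  qed
  have norm: "cmod (emb (\<sigma> x)) = cmod (emb x)" for x
  proof -
    have "of_rat qa * (cmod (emb (\<sigma> x)))\<^sup>2 = of_rat qa * (cmod (emb x))\<^sup>2" unfolding emb_norm pres ..
    thus ?thesis using qa by (simp add: power2_eq_iff_nonneg)
  qed
  define u where "u = emb (\<sigma> e)"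
  have u1: "cmod u = 1" using norm[of e] by (simp add: u_def emb_basis)
  have uu: "u * cnj u = 1" using u1 by (simp flip: complex_norm_square)
  define r where "r = cnj u * emb (\<sigma> f)"
  have ur: "emb (\<sigma> f) = u * r" using uu by (simp add: r_def flip: mult.assoc)
  have "Re r = Re tau" using form[of e f] by (simp add: r_def u_def emb_basis)
  moreover have "cmod r = cmod tau" using norm[of f] u1 by (simp add: r_def norm_mult emb_basis)
  hence "(Re r)\<^sup>2 + (Im r)\<^sup>2 = (Re tau)\<^sup>2 + (Im tau)\<^sup>2" by (simp flip: cmod_power2)
  ultimately have "(Im r)\<^sup>2 = (Im tau)\<^sup>2" by simp
  hence "Im r = Im tau \<or> Im r = - Im tau" by (simp add: power2_eq_iff)
  hence cases: "r = tau \<or> r = cnj tau" using \<open>Re r = Re tau\<close> by (simp add: complex_eq_iff)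
  have exp: "emb (\<sigma> v) = u * (of_rat (cx v) + of_rat (cy v) * r)" for v
  proof -
    have "\<sigma> v = scale (cx v) (\<sigma> e) + scale (cy v) (\<sigma> f)"
      using arg_cong[OF decomp[of v], of \<sigma>] by (simp add: l.add l.scale)
    thus ?thesis by (simp add: emb_add emb_scale ur algebra_simps flip: u_def)
  qed
  have "r = tau"
  proof (rule ccontr)
    assume "r \<noteq> tau"
    hence r: "r = cnj tau" using cases by blast
    have e: "emb (\<sigma> v) = u * cnj (emb v)" for v
      unfolding exp r by (simp add: emb_def)
    have "area (emb (\<sigma> x)) (emb (\<sigma> y)) = of_rat (- 1) * area (emb x) (emb y)" for x y
      unfolding e area_mult using u1 by (simp add: area_cnj)
    hence "endo_det \<sigma> = - 1" by (rule endo_det_eq[OF lin])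
    thus False using det by simp
  qed
  hence "emb (\<sigma> v) = u * emb v" for v using exp[of v] by (simp add: emb_def[of v])
  thus ?thesis using that[of u] u1 u_def by blast
qed

text \<open>Stability under \<open>u\<close> defines the map on the quadratic space; stability under
  the conjugate, which is the inverse of \<open>u\<close>, makes it surjective.\<close>

lemma multiplier_O_plus:
  assumes u: "cmod u = 1" and st: "\<And>x. x \<in> range emb \<Longrightarrow> u * x \<in> range emb" "\<And>x. x \<in> range emb \<Longrightarrow> cnj u * x \<in> range emb"
  obtains \<sigma> where "\<sigma> \<in> O_plus" "\<And>v. emb (\<sigma> v) = u * emb v"
proof -
  define \<sigma> where "\<sigma> v = inv_into UNIV emb (u * emb v)" for v
  have s: "emb (\<sigma> v) = u * emb v" for v
    unfolding \<sigma>_def by (rule f_inv_into_f) (use st(1) in blast)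
  have uu: "u * cnj u = 1" using u by (simp flip: complex_norm_square)
  have u0: "u \<noteq> 0" using u by auto
  have injD: "x = y" if "emb x = emb y" for x y using inj_emb that by (rule injD)
  have lin: "Vector_Spaces.linear scale scale \<sigma>"
    by unfold_locales (auto intro!: injD simp: emb_add emb_scale s algebra_simps)
  have "bij \<sigma>"
  proof (rule bijI)
    show "inj \<sigma>"
    proof (rule injI)
      fix x y assume "\<sigma> x = \<sigma> y"
      hence "u * emb x = u * emb y" using s by metis
      thus "x = y" using u0 injD by simp
    qed
    show "surj \<sigma>"
    proof (rule surjI)
      fix y
      have m: "cnj u * emb y \<in> range emb" by (rule st(2)) simp
      have "emb (\<sigma> (inv_into UNIV emb (cnj u * emb y))) = u * (cnj u * emb y)"
        unfolding s f_inv_into_f[OF m] ..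
      also have "\<dots> = emb y" using uu by (simp flip: mult.assoc)
      finally show "\<sigma> (inv_into UNIV emb (cnj u * emb y)) = y" by (rule injD)
    qed
  qed
  moreover have "B (\<sigma> x) (\<sigma> y) = B x y" for x y
  proof -
    have "cnj (emb (\<sigma> x)) * emb (\<sigma> y) = (u * cnj u) * (cnj (emb x) * emb y)" by (simp add: s mult_ac)
    hence "(of_rat (B (\<sigma> x) (\<sigma> y)) :: real) = of_rat (B x y)" unfolding emb_form[symmetric] uu by simp
    thus ?thesis by (simp only: of_rat_eq_iff)
  qed
  moreover have "endo_det \<sigma> = 1"
    by (rule endo_det_eq[OF lin]) (simp add: s area_mult u)
  ultimately have "\<sigma> \<in> O_plus" using lin by (simp add: O_plus_def O_group_def)
  thus ?thesis using that s by blast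
qed

text \<open>A subgroup of positive index in the plane has a basis of non-zero area, hence comes from
  a basis of the quadratic space; its values are integral because it lies in
  \<open>L\<close>.\<close>

lemma sublattices_emb:
  assumes m: "m > 0"
  shows "bij_betw (image emb) (sublattices L m) (isub (zlat 1 tau) m)"
proof (rule bij_betw_imageI)
  have ar: "area 1 tau \<noteq> 0" using Im_tau(1) by (simp add: area_alt)
  have idx: "coset_index (zlat 1 tau) (emb ` K) = lattice_index L K" for K
    unfolding emb_L[symmetric] using coset_index_image[OF inj_emb emb_add] by (simp add: coset_index_def lattice_index_def)
  show "inj_on (image emb) (sublattices L m)"
    by (meson inj_emb inj_image_eq_iff inj_onI)
  show "image emb ` sublattices L m = isub (zlat 1 tau) m"
  proof
    show "image emb ` sublattices L m \<subseteq> isub (zlat 1 tau) m"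
    proof (rule image_subsetI)
      fix K assume K: "K \<in> sublattices L m"
      then obtain bs where bs: "lattice_basis K bs" by (auto simp: sublattices_def is_lattice_def)
      obtain g h where gh: "bs = [g, h]" using is_basis_length bs lattice_basis_def by blast
      have "emb ` K = zlat (emb g) (emb h)" using bs emb_Z_span by (simp add: gh lattice_basis_def)
      hence "is_subgroup (emb ` K)" using is_subgroup_zlat by simp
      moreover have "emb ` K \<subseteq> zlat 1 tau" using K emb_L by (auto simp: sublattices_def)
      ultimately show "emb ` K \<in> isub (zlat 1 tau) m" using idx K by (simp add: isub_def sublattices_def)
    qed
    show "isub (zlat 1 tau) m \<subseteq> image emb ` sublattices L m"
    proof
      fix K' assume K': "K' \<in> isub (zlat 1 tau) m"
      then obtain c d where cd: "K' = zlat c d" "\<bar>area c d\<bar> = real m * \<bar>area 1 tau\<bar>" "K' \<subseteq> zlat 1 tau"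
        unfolding isub_area[OF ar m] by blast
      have "c \<in> emb ` L" "d \<in> emb ` L" using cd(1,3) emb_L zlat_basis by auto
      then obtain g h where gh: "g \<in> L" "h \<in> L" "c = emb g" "d = emb h" by auto
      define K where "K = Z_span {g, h}"
      have eK: "emb ` K = K'" unfolding K_def emb_Z_span cd(1) gh ..
      have "area c d \<noteq> 0" using cd(2) ar m by auto
      hence "is_basis [g, h]" using basis_iff_area gh by simp
      hence "lattice_basis K [g, h]" by (simp add: lattice_basis_def K_def)
      moreover have KL: "K \<subseteq> L" using cd(3) eK emb_L inj_emb by (metis inj_image_subset_iff)
      ultimately have "is_lattice K" using L_int by (auto simp: is_lattice_def)
      moreover have "lattice_index L K = m" using idx[of K] eK K' by (simp add: isub_def)
      ultimately have "K \<in> sublattices L m" using KL by (simp add: sublattices_def)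
      thus "K' \<in> image emb ` sublattices L m" using eK by blast
    qed
  qed
qed

end

lemma card_quotient_bij:
  assumes bij: "bij_betw h X Y" and r: "r \<subseteq> X \<times> X" "s \<subseteq> Y \<times> Y"
    and iff: "\<And>x y. x \<in> X \<Longrightarrow> y \<in> X \<Longrightarrow> (x, y) \<in> r \<longleftrightarrow> (h x, h y) \<in> s"
  shows "card (X // r) = card (Y // s)"
proof -
  have inj: "inj_on h X" and Y: "Y = h ` X" using bij by (auto simp: bij_betw_def)
  have cls: "s `` {h x} = h ` (r `` {x})" if x: "x \<in> X" for x
  proof
    show "s `` {h x} \<subseteq> h ` (r `` {x})"
    proof
      fix z assume z: "z \<in> s `` {h x}"
      hence "z \<in> Y" using r(2) by auto
      then obtain y where y: "y \<in> X" "z = h y" using Y by auto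
      thus "z \<in> h ` (r `` {x})" using z iff[OF x y(1)] by auto
    qed
    show "h ` (r `` {x}) \<subseteq> s `` {h x}" using iff[OF x] r(1) by auto
  qed
  have "card (X // r) = card ((\<lambda>x. r `` {x}) ` X)"
    unfolding quotient_def by (simp add: UNION_singleton_eq_range)
  also have "\<dots> = card ((\<lambda>x. s `` {h x}) ` X)"
  proof (rule card_image_eq_of_iff)
    fix x y assume "x \<in> X" "y \<in> X"
    moreover have "r `` {x} \<subseteq> X" "r `` {y} \<subseteq> X" using r(1) by auto
    ultimately show "r `` {x} = r `` {y} \<longleftrightarrow> s `` {h x} = s `` {h y}"
      using cls inj_on_image_eq_iff[OF inj] by simp
  qed
  also have "\<dots> = card (Y // s)"
    unfolding quotient_def Y by (simp add: UNION_singleton_eq_range image_image)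
  finally show ?thesis .
qed

section \<open>The binary lattice as an ideal of the field\<close>

context binary_lattice begin

lemma integral_coefficients:
  obtains a b c :: int where "qa = of_int a" "qb = of_int b" "qc = of_int c"
proof -
  have mem: "e \<in> L" "f \<in> L" "e + f \<in> L"
  proof -
    have "scale (of_int p) e + scale (of_int q) f \<in> L" for p q unfolding L_eq Z_span_pair by blast
    from this[of 1 0] this[of 0 1] this[of 1 1] show "e \<in> L" "f \<in> L" "e + f \<in> L" by simp_all
  qed
  have "qa \<in> \<int>" "qc \<in> \<int>" using L_int[OF mem(1)] L_int[OF mem(2)] by (simp_all add: qa_def qc_def)
  moreover have "B (e + f) (e + f) = qa + qb + qc"
    by (simp add: form_expand coords_add coords_basis)
  hence "qb = B (e + f) (e + f) - qa - qc" by simp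
  hence "qb \<in> \<int>" using L_int[OF mem(3)] calculation by simp
  ultimately show ?thesis using that by (metis Ints_cases)
qed

text \<open>Equality of discriminants makes \<open>a tau\<close> an integer translate of \<omega>.
  Stability under \<omega> is then stability under \<open>a tau\<close>, which follows from
  \<open>a tau^2 = b tau - c\<close>.\<close>

theorem ideal_lattice_of_disc:
  assumes "imag_quad F \<omega> t n" and D: "- 4 * lattice_det L = of_int (t\<^sup>2 - 4 * n)"
    and not: "t\<^sup>2 - 4 * n \<noteq> - 3" "t\<^sup>2 - 4 * n \<noteq> - 4"
  shows "ideal_lattice F \<omega> t n 1 tau" and "range emb = F"
proof -
  interpret iq: imag_quad F \<omega> t n by fact
  obtain a b c :: int where abc: "qa = of_int a" "qb = of_int b" "qc = of_int c" using integral_coefficients by blast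
  have a0: "a > 0" using qa_pos abc(1) by simp
  have "of_int (b\<^sup>2 - 4 * a * c) = (of_int (t\<^sup>2 - 4 * n) :: rat)"
    using D lattice_det_eq unfolding abc by simp
  hence disc: "b\<^sup>2 - 4 * a * c = t\<^sup>2 - 4 * n" by (simp only: of_int_eq_iff)
  have "even (b\<^sup>2 - t\<^sup>2)"
  proof -
    have "b\<^sup>2 - t\<^sup>2 = 2 * (2 * (a * c - n))" using disc by simp
    thus ?thesis by simp
  qed
  hence "even (b - t)" by simp
  \<comment> \<open>Equal discriminants force \<open>b\<close> and \<open>t\<close> to have the same
    parity; half their difference is the translation between \<open>a tau\<close> and
    \<omega>.\<close>
  then obtain k where k: "b - t = 2 * k" by blast
  have re: "2 * of_int a * Re tau = of_int b" using Re_tau by (simp add: abc)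
  have "4 * qa * qc - qb\<^sup>2 = of_int (4 * a * c - b\<^sup>2)" by (simp add: abc)
  hence "(2 * of_int a * Im tau)\<^sup>2 = of_int (4 * a * c - b\<^sup>2)"
    using Im_tau(2) by (simp only: abc(1) of_rat_of_int_eq)
  also have "4 * a * c - b\<^sup>2 = - (t\<^sup>2 - 4 * n)" using disc by simp
  also have "real_of_int (- (t\<^sup>2 - 4 * n)) = (2 * Im \<omega>)\<^sup>2" using iq.disc_eq by (simp add: power_mult_distrib)
  finally have "2 * of_int a * Im tau = 2 * Im \<omega>"
    by (rule power2_eq_imp_eq) (use a0 Im_tau(1) iq.Im_omega in auto)
  hence im: "of_int a * Im tau = Im \<omega>" by simp
  have at: "of_int a * tau = \<omega> + of_int k"
  proof -
    have "2 * (of_int a * Re tau) = 2 * Re \<omega> + 2 * of_int k"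
      using re iq.re_omega arg_cong[OF k, of real_of_int] by simp
    thus ?thesis using im by (simp add: complex_eq_iff)
  qed
  have sq: "of_int a * tau\<^sup>2 = of_int b * tau - of_int c"
  proof -
    have "of_int a * (tau + cnj tau) = of_int b" using re by (simp add: complex_eq_iff)
    moreover have "of_int a * (tau * cnj tau) = of_int c"
    proof -
      have "of_int a * (cmod tau)\<^sup>2 = (of_int c :: real)" using norm_tau by (simp add: abc)
      hence "complex_of_real (of_int a * (cmod tau)\<^sup>2) = of_int c" by simp
      thus ?thesis by (simp only: of_real_mult of_real_of_int_eq complex_norm_square)
    qed
    moreover have "of_int a * tau\<^sup>2 = of_int a * (tau + cnj tau) * tau - of_int a * (tau * cnj tau)"
      by (simp add: algebra_simps power2_eq_square)
    ultimately show ?thesis by simp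
  qed
  have om: "\<omega> = of_int a * tau - of_int k" using at by simp
  have tau_eq: "tau = (\<omega> + of_int k) / of_int a" using at a0 by (simp add: field_simps)
  have tauF: "tau \<in> F" unfolding tau_eq by (intro iq.F_intros iq.omega_in_F)
  show "range emb = F"
  proof
    show "range emb \<subseteq> F" unfolding range_emb using tauF by (auto intro!: iq.F_intros)
    show "F \<subseteq> range emb"
    proof
      fix z assume "z \<in> F"
      then obtain x y where xy: "z = of_rat x + of_rat y * \<omega>" using iq.F_eq by auto
      have "z = of_rat (x - y * of_int k) + of_rat (y * of_int a) * tau"
        by (simp add: xy om of_rat_diff of_rat_mult algebra_simps)
      thus "z \<in> range emb" unfolding range_emb by blast
    qed
  qed
  show "ideal_lattice F \<omega> t n 1 tau"
  proof
    show "1 \<in> F" by (rule iq.F_1)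
    show "tau \<in> F" by (rule tauF)
    show "area 1 tau \<noteq> 0" using Im_tau(1) by (simp add: area_alt)
    show "x * y \<in> zlat 1 tau" if xy: "x \<in> zlat 1 \<omega>" "y \<in> zlat 1 tau" for x y
    proof -
      obtain r s where x: "x = of_int r + of_int s * \<omega>" using xy(1) by (auto simp: zlat_def)
      obtain p q where y: "y = of_int p + of_int q * tau" using xy(2) by (auto simp: zlat_def)
      have "x * y = of_int r * of_int p + of_int r * of_int q * tau
          + of_int s * of_int p * (of_int a * tau - of_int k)
          + of_int s * of_int q * (of_int a * tau\<^sup>2 - of_int k * tau)"
        unfolding x y om by (simp add: algebra_simps power2_eq_square)
      also have "\<dots> = of_int (r * p - s * p * k - s * q * c) + of_int (r * q + s * p * a + s * q * b - s * q * k) * tau"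
        unfolding sq by (simp add: algebra_simps)
      finally show ?thesis by (simp only: zlat_1I)
    qed
  qed (use not in auto)
qed

text \<open>Under \<open>emb\<close> the proper isometries are exactly the multiplications by
  elements of \<open>U\<close>; the range being all of \<open>F\<close> is what lets such a
  multiplication return to the quadratic space.\<close>

theorem a_plus_eq_class_count:
  assumes il: "ideal_lattice F \<omega> t n 1 tau" and rng: "range emb = F" and m: "m > 0"
  shows "a_plus L m = ideal_lattice.class_count F 1 tau m"
proof -
  interpret il: ideal_lattice F \<omega> t n 1 tau by (rule il)
  have iff: "(K1, K2) \<in> proper_equiv \<longleftrightarrow> (emb ` K1, emb ` K2) \<in> il.rot_rel" for K1 K2
  proof
    assume "(K1, K2) \<in> proper_equiv"
    then obtain \<sigma> where s: "\<sigma> \<in> O_plus" "\<sigma> ` K1 = K2" by (auto simp: proper_equiv_def)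
    obtain u where u: "u \<in> range emb" "cmod u = 1" "\<And>v. emb (\<sigma> v) = u * emb v"
      using O_plus_multiplier[OF s(1)] by metis
    have "u \<in> il.U" using u(1,2) rng by (simp add: il.U_def)
    moreover have "(*) u ` emb ` K1 = emb ` K2" unfolding s(2)[symmetric] image_image u(3) ..
    ultimately show "(emb ` K1, emb ` K2) \<in> il.rot_rel" by (auto simp: il.rot_rel_def)
  next
    assume "(emb ` K1, emb ` K2) \<in> il.rot_rel"
    then obtain u where u: "u \<in> il.U" "(*) u ` emb ` K1 = emb ` K2" by (auto simp: il.rot_rel_def)
    have uF: "u \<in> F" "cmod u = 1" using u(1) by (auto simp: il.U_def)
    obtain \<sigma> where s: "\<sigma> \<in> O_plus" "\<And>v. emb (\<sigma> v) = u * emb v"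
    proof (rule multiplier_O_plus[OF uF(2)])
      show "u * x \<in> range emb" "cnj u * x \<in> range emb" if "x \<in> range emb" for x
        using that uF(1) unfolding rng by (auto intro: il.F_mult il.cnj_F)
    qed (rule that)
    have "emb ` \<sigma> ` K1 = emb ` K2" unfolding u(2)[symmetric] image_image s(2) ..
    hence "\<sigma> ` K1 = K2" using inj_emb by (simp add: inj_image_eq_iff)
    thus "(K1, K2) \<in> proper_equiv" using s(1) by (auto simp: proper_equiv_def)
  qed
  show ?thesis unfolding a_plus_def il.class_count_def
  proof (rule card_quotient_bij[OF sublattices_emb[OF m]])
    fix K1 K2 assume "K1 \<in> sublattices L m" "K2 \<in> sublattices L m"
    moreover from this have "emb ` K1 \<in> isub (zlat 1 tau) m" "emb ` K2 \<in> isub (zlat 1 tau) m"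
      using bij_betwE[OF sublattices_emb[OF m]] by auto
    ultimately show "(K1, K2) \<in> Restr proper_equiv (sublattices L m) \<longleftrightarrow>
        (emb ` K1, emb ` K2) \<in> Restr il.rot_rel (isub (zlat 1 tau) m)"
      using iff by auto
  qed auto
qed

end

section \<open>From the binary lattice to the class group\<close>

theorem theorem1p6:
  fixes scale :: "rat \<Rightarrow> 'v::ab_group_add \<Rightarrow> 'v"
    and B :: "'v \<Rightarrow> 'v \<Rightarrow> rat"
    and L :: "'v set"
    and F :: "complex set"
  assumes "quadratic_space scale B"
    and "quadratic_space.positive_definite B"
    and "vector_space.dim scale (UNIV :: 'v set) = 2"
    and "quadratic_space.is_lattice scale B L"
    and "imaginary_quadratic_field F"
    and "- 4 * quadratic_space.lattice_det scale B L = of_int (discriminant F)"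
    and "discriminant F \<noteq> - 3"
    and "discriminant F \<noteq> - 4"
  shows "(\<forall>s::complex. Re s > 2 \<longrightarrow>
            (\<lambda>p::nat. if prime p then quadratic_space.zeta_SL_local scale B L p s else 1)
              has_prod quadratic_space.zeta_SL scale B L s)
         \<longleftrightarrow> (\<exists>e::nat. class_group F \<cong> product_group {..<e} (\<lambda>_. integer_mod_group 2))"
proof -
  interpret Q: quadratic_space scale B by fact
  obtain bs where bs: "Q.lattice_basis L bs" and L_int: "\<And>x. x \<in> L \<Longrightarrow> B x x \<in> \<int>"
    using assms(4) by (auto simp: Q.is_lattice_def)
  have basis: "distinct bs" "Q.independent (set bs)" "Q.span (set bs) = UNIV" and L: "L = Q.Z_span (set bs)"
    using bs by (auto simp: Q.lattice_basis_def Q.is_basis_def)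
  have "card (set bs) = 2"
    using Q.basis_card_eq_dim[of "set bs" UNIV] basis assms(3) by simp
  hence "length bs = 2" using basis(1) by (simp add: distinct_card)
  then obtain e f where ef: "bs = [e, f]" by (auto simp: length_Suc_conv numeral_2_eq_2)
  interpret bl: binary_lattice scale B e f L
    by unfold_locales (use assms(2) basis L L_int ef in auto)
  obtain \<omega> t n where iq: "imag_quad F \<omega> t n" using imaginary_quadratic_field_imag_quad[OF assms(5)] by metis
  have disc: "discriminant F = t\<^sup>2 - 4 * n" by (rule imag_quad.discriminant_eq[OF iq])
  have il: "ideal_lattice F \<omega> t n 1 bl.tau" and rng: "range bl.emb = F"
    using bl.ideal_lattice_of_disc[OF iq] assms(6-8) unfolding disc by auto
  interpret il: ideal_lattice F \<omega> t n 1 bl.tau by (rule il)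
  have count: "Q.a_plus L m = il.class_count m" if "m > 0" for m
    by (rule bl.a_plus_eq_class_count[OF il rng that])
  have "Q.zeta_SL L s = (\<Sum>\<^sub>\<infinity>m\<in>{1..}. of_nat (il.class_count m) * of_nat m powr (- s))" for s
    unfolding Q.zeta_SL_def by (rule infsum_cong) (simp add: count)
  moreover have "(\<lambda>p. if prime p then Q.zeta_SL_local L p s else 1) =
      (\<lambda>p. if prime p then \<Sum>\<^sub>\<infinity>i\<in>UNIV. of_nat (il.class_count (p ^ i)) * of_nat p powr (- (of_nat i * s)) else 1)" for s
    unfolding Q.zeta_SL_local_def using count prime_gt_0_nat by (intro ext) simp
  moreover have "(\<forall>s::complex. Re s > 2 \<longrightarrow>
      (\<lambda>p. if prime p then \<Sum>\<^sub>\<infinity>i\<in>UNIV. of_nat (il.class_count (p ^ i)) * of_nat p powr (- (of_nat i * s)) else 1)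
        has_prod (\<Sum>\<^sub>\<infinity>m\<in>{1..}. of_nat (il.class_count m) * of_nat m powr (- s)))
    \<longleftrightarrow> (\<forall>m n. m > 0 \<longrightarrow> n > 0 \<longrightarrow> coprime m n \<longrightarrow> il.class_count (m * n) = il.class_count m * il.class_count n)"
  proof (rule euler_product_iff_multiplicative)
    show "il.class_count 1 = 1" by (rule il.class_count_1)
    show "il.class_count (m * n) \<le> il.class_count m * il.class_count n" if "m > 0" "n > 0" "coprime m n" for m n
      by (rule il.class_count_submultiplicative(1)[OF that])
    show "il.class_count m \<le> divisor_sum m" if "m > 0" for m
      unfolding divisor_sum_def using il.class_count_le[OF that] card_isub_le[OF il.lattice_area that] by linarith
  qed
  ultimately show ?thesis
    using il.class_count_multiplicative_iff il.class_group_elementary_2_iff by simp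
qed

end
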